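(* Assume that the operators $A_1,A_2,B_1,B_2$ satisfy the Measurability, Coercivity (with constant $\mu>0$) and Growth conditions and that the projections $\Pi_m$ satisfy the Projection assumption (all stated in the context). Let $q\ge1$ be given and assume that, for all $\ell$, $u_\ell(0)$ is $V_{m_\ell}$-valued and $\mathcal{F}_0$-measurable with $\mathbb{E}|u_\ell(0)|^{2q}<C_0$, where $C_0$ does not depend on $\ell$. Then there are $\epsilon\in(0,\infty)$ and a constant $c>0$, both independent of $\ell$, such that for all $\ell\in\{\ell'\in\mathbb{N}:\mathfrak{c}(m_{\ell'})\tau_{n_{\ell'}}<\epsilon\}$ and any $t\in[0,T]$, $$\mathbb{E}\sup_{s\in[0,t]}|u_\ell(s)|^{2q}+\mu^q\,\mathbb{E}\bigg(\int_0^t\|\bar u_\ell(s)\|_{V_1}^2\,ds\bigg)^q\le c\left(1+\mathbb{E}|u_\ell(0)|^{2q}\right).$$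
   Context: Setting. Let $T>0$, $K>0$, $p\in[2,\infty)$, $p^*:=p/(p-1)$. $(\Omega,\mathcal{F},\mathbb{P})$ is a probability space with a filtration $(\mathcal{F}_t)_{t\in[0,T]}$ such that $\mathcal{F}_0$ contains all $\mathbb{P}$-null sets of $\mathcal{F}$. $W$ is a cylindrical $Q$-Wiener process with $Q=I$, with respect to $(\mathcal{F}_t)$, on a separable Hilbert space $(U,(\cdot,\cdot)_U,|\cdot|_U)$. $(H,(\cdot,\cdot),|\cdot|)$ is a Hilbert space identified with its dual; $(V_1,\|\cdot\|_{V_1})$, $(V_2,\|\cdot\|_{V_2})$ are separable reflexive Banach spaces densely and continuously embedded in $H$, so $V_i\hookrightarrow H\hookrightarrow V_i^*$, $i=1,2$. $V:=V_1\cap V_2$ has norm $\|\cdot\|:=\|\cdot\|_{V_1}+\|\cdot\|_{V_2}$ and is assumed separable and dense in both $V_1$ and $V_2$; its dual is identified with $V^*=V_1^*+V_2^*$ with norm $\|f\|_{V^*}=\inf\{\max(\|f_1\|_{V_1^*},\|f_2\|_{V_2^*}): f=f_1+f_2,\ f_i\in V_i^*\}$. $\langle\cdot,\cdot\rangle$ denotes duality pairings. $L_2(U,H)$ is the space of Hilbert–Schmidt operators from $U$ to $H$. Operators. $A_i:V_i\times\Omega\to V_i^*$ and $B_i:V_i\times\Omega\to L_2(U,H)$, $i=1,2$; $A:=A_1+A_2: V\times\Omega\to V^*$, $B:=B_1+B_2:V\times\Omega\to L_2(U,H)$. Conditions: Measurability: for all $v,w\in V_i$, $g\in U$, $h\in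 H$ the real random variables $\langle A_iv,w\rangle$ and $((B_iv)g,h)$ are $\mathcal{F}_0$-measurable. Coercivity: there is $\mu>0$ with $2\langle A_1v,v\rangle+\|B_1v\|_{L_2(U,H)}^2\le-\mu\|v\|_{V_1}^2+K(1+|v|^2)$ for all $v\in V_1$, and $2\langle A_2v,v\rangle+\|B_2v\|_{L_2(U,H)}^2\le K(1+|v|^2)$ for all $v\in V_2$. Growth: $\|A_1v\|_{V_1^*}^2\le K(1+\|v\|_{V_1}^2)$ for all $v\in V_1$; $\|A_2v\|_{V_2^*}^{p^*}\le K(1+\|v\|_{V_2}^p)$ for all $v\in V_2$; $\|Bv\|_{L_2(U,H)}^2\le K(1+|v|^2)$ for all $v\in V$. Galerkin scheme. $(V_m)_{m\in\mathbb{N}}$ are finite-dimensional subspaces of $V$, $\dim V_m=m$, $V_m\subseteq V_{m+1}$, and $\lim_{m\to\infty}\inf\{\|v-\varphi\|:\varphi\in V_m\}=0$ for all $v\in V$. Projection assumption: for every $m$, $\Pi_m:V^*\to V_m$ satisfies (1) $\Pi_mv=v$ for $v\in V_m$; (2) $\langle f,\Pi_mv\rangle=\langle v,\Pi_mf\rangle$ for $f\in V^*$, $v\in V$; (3) $(\Pi_mg,h)=(\Pi_mh,g)$ and $|\Pi_mh|\le|h|$ for $g,h\in H$; (4) there is a constant $\mathfrak{c}(m)$ with $|\Pi_mf|^2\le\mathfrak{c}(m)\|f\|_{V^*}^2$ for all $f\in V^*$. Numerical scheme. $(\chi_j)_{j\in\mathbb{N}}$ is an orthonormal basis of $U$ and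 $W_k(t):=\sum_{j=1}^k(W(t),\chi_j)_U\chi_j$. $((n_\ell,m_\ell,k_\ell))_{\ell\in\mathbb{N}}$ is a sequence of triples of natural numbers with $n_\ell,m_\ell,k_\ell\to\infty$. $\tau_n:=T/n$, $t^n_i:=i\tau_n$, $\kappa_{n}(t):=t^n_i$ for $t\in[t^n_i,t^n_{i+1})$, $i=0,\dots,n-1$, and $\kappa_n(T):=T$. The tamed operator is $A_{2,\ell}v:=\dfrac{1}{1+n_\ell^{-1/2}|\Pi_{m_\ell}A_2v|}A_2v$ for $v\in V_2$. Given a $V_{m_\ell}$-valued $\mathcal{F}_0$-measurable $u_\ell(0)$, the process $u_\ell$ on $[0,T]$ is defined by $$u_\ell(t)=u_\ell(0)+\int_0^t\Pi_{m_\ell}\big[A_1u_\ell(\kappa_{n_\ell}(s))+A_{2,\ell}u_\ell(\kappa_{n_\ell}(s))\big]ds+\int_0^t\Pi_{m_\ell}Bu_\ell(\kappa_{n_\ell}(s))\,dW_{k_\ell}(s),$$ and $\bar u_\ell(t):=u_\ell(\kappa_{n_\ell}(t))$. Constants. $c$ may depend on $T$, $q$, the embedding constants and the constants in the conditions above, but not on the discretization parameters $m_\ell,n_\ell,k_\ell$. *)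

theory Defs
  imports "HOL-Probability.Probability"
begin

text \<open>
  The spaces \<open>U\<close>, \<open>H\<close>, \<open>V\<^sub>1\<close>, \<open>V\<^sub>2\<close> and \<open>V = V\<^sub>1 \<inter> V\<^sub>2\<close> are types \<open>'u\<close>, \<open>'h\<close>, \<open>'a\<close>, \<open>'b\<close>, \<open>'v\<close>, and each
  inclusion is an injective bounded linear map: \<open>j1\<close> and \<open>j2\<close> embed \<open>V\<^sub>1\<close> and \<open>V\<^sub>2\<close> into \<open>H\<close>, and
  \<open>i1\<close> and \<open>i2\<close> embed \<open>V\<close> into \<open>V\<^sub>1\<close> and \<open>V\<^sub>2\<close>. The dual of a space \<open>X\<close> is the type of bounded linear
  functionals on \<open>X\<close>, so duality pairings are function application. Separability is the class
  \<open>second_countable_topology\<close>.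
\<close>

section \<open>The spaces\<close>

definition reflexive_space :: "'x::real_normed_vector itself \<Rightarrow> bool" where
  "reflexive_space _ \<longleftrightarrow>
     (\<forall>\<Phi> :: ('x \<Rightarrow>\<^sub>L real) \<Rightarrow>\<^sub>L real. \<exists>x. \<forall>f. blinfun_apply \<Phi> f = blinfun_apply f x)"

text \<open>
  The last three conjuncts say that, inside \<open>H\<close>, the space \<open>'v\<close> is \<open>V\<^sub>1 \<inter> V\<^sub>2\<close> with the norm
  \<open>\<parallel>v\<parallel>\<^bsub>V1\<^esub> + \<parallel>v\<parallel>\<^bsub>V2\<^esub>\<close>; injectivity of \<open>i1\<close> and \<open>i2\<close> follows. The numbers \<open>e1\<close> and \<open>e2\<close> are embedding constants.
\<close>
definition intersection_setting ::
  "real \<Rightarrow> real \<Rightarrow>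
   ('a::{banach, second_countable_topology} \<Rightarrow>\<^sub>L 'h::{real_inner, banach}) \<Rightarrow>
   ('b::{banach, second_countable_topology} \<Rightarrow>\<^sub>L 'h) \<Rightarrow>
   ('v::{banach, second_countable_topology} \<Rightarrow>\<^sub>L 'a) \<Rightarrow> ('v \<Rightarrow>\<^sub>L 'b) \<Rightarrow> bool" where
  "intersection_setting e1 e2 j1 j2 i1 i2 \<longleftrightarrow>
     reflexive_space TYPE('a) \<and> reflexive_space TYPE('b) \<and>
     inj (blinfun_apply j1) \<and> inj (blinfun_apply j2) \<and>
     closure (range (blinfun_apply j1)) = UNIV \<and> closure (range (blinfun_apply j2)) = UNIV \<and>
     (\<forall>v. norm (j1 v) \<le> e1 * norm v) \<and> (\<forall>v. norm (j2 v) \<le> e2 * norm v) \<and>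
     closure (range (blinfun_apply i1)) = UNIV \<and> closure (range (blinfun_apply i2)) = UNIV \<and>
     (\<forall>v. j1 (i1 v) = j2 (i2 v)) \<and>
     range (\<lambda>v. j1 (i1 v)) = range (blinfun_apply j1) \<inter> range (blinfun_apply j2) \<and>
     (\<forall>v. norm v = norm (i1 v) + norm (i2 v))"

text \<open>The inclusion \<open>H \<subseteq> V\<^sup>*\<close> given by \<open>h \<mapsto> (h, \<sqdot>)\<close>, where \<open>j\<close> is the embedding of \<open>V\<close> into \<open>H\<close>.\<close>
definition H_to_dual ::
  "('v::real_normed_vector \<Rightarrow>\<^sub>L 'h::real_inner) \<Rightarrow> 'h \<Rightarrow> ('v \<Rightarrow>\<^sub>L real)" where
  "H_to_dual j h = blinfun_inner_right h o\<^sub>L j"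

text \<open>
  The element \<open>f\<^sub>1 + f\<^sub>2\<close> of \<open>V\<^sup>* = V\<^sub>1\<^sup>* + V\<^sub>2\<^sup>*\<close>, as a functional on \<open>V\<close>. By the Hahn-Banach theorem
  every functional on \<open>V\<close> has this form, so the infimum below is over a nonempty set.
\<close>
definition dual_add ::
  "('v::real_normed_vector \<Rightarrow>\<^sub>L 'a::real_normed_vector) \<Rightarrow> ('v \<Rightarrow>\<^sub>L 'b::real_normed_vector) \<Rightarrow>
   ('a \<Rightarrow>\<^sub>L real) \<Rightarrow> ('b \<Rightarrow>\<^sub>L real) \<Rightarrow> ('v \<Rightarrow>\<^sub>L real)" where
  "dual_add i1 i2 f1 f2 = (f1 o\<^sub>L i1) + (f2 o\<^sub>L i2)"

definition dual_norm ::
  "('v::real_normed_vector \<Rightarrow>\<^sub>L 'a::real_normed_vector) \<Rightarrow> ('v \<Rightarrow>\<^sub>L 'b::real_normed_vector) \<Rightarrow>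
   ('v \<Rightarrow>\<^sub>L real) \<Rightarrow> real" where
  "dual_norm i1 i2 f = Inf {max (norm f1) (norm f2) | f1 f2. f = dual_add i1 i2 f1 f2}"

section \<open>Orthonormal bases and Hilbert-Schmidt operators\<close>

text \<open>Bases are indexed from 0, so the sum over \<open>j = 1, \<dots>, k\<close> becomes the sum over \<open>j < k\<close>.\<close>
definition orthonormal_basis :: "(nat \<Rightarrow> 'u::real_inner) \<Rightarrow> bool" where
  "orthonormal_basis chi \<longleftrightarrow>
     (\<forall>i j. inner (chi i) (chi j) = (if i = j then 1 else 0)) \<and> closure (span (range chi)) = UNIV"

text \<open>
  Hilbert-Schmidt operators and their norm, computed in an orthonormal basis \<open>chi\<close>; neither depends
  on the choice of that basis.
\<close>
definition hilbert_schmidt ::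
  "(nat \<Rightarrow> 'u::real_inner) \<Rightarrow> ('u \<Rightarrow>\<^sub>L 'h::real_inner) \<Rightarrow> bool" where
  "hilbert_schmidt chi S \<longleftrightarrow> summable (\<lambda>j. (norm (S (chi j)))\<^sup>2)"

definition hs_norm :: "(nat \<Rightarrow> 'u::real_inner) \<Rightarrow> ('u \<Rightarrow>\<^sub>L 'h::real_inner) \<Rightarrow> real" where
  "hs_norm chi S = sqrt (\<Sum>j. (norm (S (chi j)))\<^sup>2)"

section \<open>Filtration and cylindrical Wiener process\<close>

definition filtration_on :: "'w measure \<Rightarrow> real \<Rightarrow> (real \<Rightarrow> 'w measure) \<Rightarrow> bool" where
  "filtration_on M T F \<longleftrightarrow>
     (\<forall>t\<in>{0..T}. subalgebra M (F t)) \<and>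
     (\<forall>s t. 0 \<le> s \<and> s \<le> t \<and> t \<le> T \<longrightarrow> sets (F s) \<subseteq> sets (F t)) \<and>
     null_sets M \<subseteq> sets (F 0)"

text \<open>
  \<open>W t h\<close> is the real random variable \<open>(W(t), h)\<^bsub>U\<^esub>\<close>; for \<open>Q = I\<close> the process \<open>W(t)\<close> does not take values in
  \<open>U\<close>. The covariance \<open>E (W(t),g) (W(s),h) = min t s * (g,h)\<close> follows from linearity and the variances.
  The increments \<open>W(t) - W(s)\<close>, jointly in all directions \<open>h\<close>, are independent of \<open>F s\<close>.
\<close>
definition cylindrical_wiener ::
  "'w measure \<Rightarrow> real \<Rightarrow> (real \<Rightarrow> 'w measure) \<Rightarrow> (real \<Rightarrow> 'u::real_inner \<Rightarrow> 'w \<Rightarrow> real) \<Rightarrow> bool" where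
  "cylindrical_wiener M T F W \<longleftrightarrow>
     (\<forall>t\<in>{0..T}. \<forall>h. W t h \<in> borel_measurable (F t)) \<and>
     (\<forall>t\<in>{0..T}. \<forall>a b g h.
        AE \<omega> in M. W t (a *\<^sub>R g + b *\<^sub>R h) \<omega> = a * W t g \<omega> + b * W t h \<omega>) \<and>
     (\<forall>h. AE \<omega> in M. W 0 h \<omega> = 0) \<and>
     (\<forall>h. AE \<omega> in M. continuous_on {0..T} (\<lambda>t. W t h \<omega>)) \<and>
     (\<forall>s t h. 0 \<le> s \<and> s < t \<and> t \<le> T \<and> h \<noteq> 0 \<longrightarrow>
        distributed M lborel (\<lambda>\<omega>. W t h \<omega> - W s h \<omega>) (normal_density 0 (sqrt (t - s) * norm h))) \<and>
     (\<forall>s t. 0 \<le> s \<and> s < t \<and> t \<le> T \<longrightarrow>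
        prob_space.indep_set M (sets (F s))
          (sigma_sets (space M)
            {(\<lambda>\<omega>. W t h \<omega> - W s h \<omega>) -` S \<inter> space M | h S. S \<in> sets borel}))"

section \<open>The operators\<close>

text \<open>The dependence on \<open>\<omega>\<close> is explicit, and inequalities between random quantities hold almost surely.\<close>

definition op_measurability ::
  "(nat \<Rightarrow> 'u::real_inner) \<Rightarrow> 'w measure \<Rightarrow> 'w measure \<Rightarrow>
   ('x::real_normed_vector \<Rightarrow> 'w \<Rightarrow> ('x \<Rightarrow>\<^sub>L real)) \<Rightarrow>
   ('x \<Rightarrow> 'w \<Rightarrow> ('u \<Rightarrow>\<^sub>L 'h::real_inner)) \<Rightarrow> bool" where
  "op_measurability chi M F0 A B \<longleftrightarrow>
     (\<forall>v. \<forall>\<omega>\<in>space M. hilbert_schmidt chi (B v \<omega>)) \<and>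
     (\<forall>v w. (\<lambda>\<omega>. A v \<omega> w) \<in> borel_measurable F0) \<and>
     (\<forall>v g h. (\<lambda>\<omega>. inner (B v \<omega> g) h) \<in> borel_measurable F0)"

definition op_coercivity ::
  "real \<Rightarrow> real \<Rightarrow> (nat \<Rightarrow> 'u::real_inner) \<Rightarrow> 'w measure \<Rightarrow>
   ('a::real_normed_vector \<Rightarrow>\<^sub>L 'h::real_inner) \<Rightarrow> ('b::real_normed_vector \<Rightarrow>\<^sub>L 'h) \<Rightarrow>
   ('a \<Rightarrow> 'w \<Rightarrow> ('a \<Rightarrow>\<^sub>L real)) \<Rightarrow> ('b \<Rightarrow> 'w \<Rightarrow> ('b \<Rightarrow>\<^sub>L real)) \<Rightarrow>
   ('a \<Rightarrow> 'w \<Rightarrow> ('u \<Rightarrow>\<^sub>L 'h)) \<Rightarrow> ('b \<Rightarrow> 'w \<Rightarrow> ('u \<Rightarrow>\<^sub>L 'h)) \<Rightarrow> bool" where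
  "op_coercivity K \<mu> chi M j1 j2 A1 A2 B1 B2 \<longleftrightarrow>
     (AE \<omega> in M. \<forall>v. 2 * A1 v \<omega> v + (hs_norm chi (B1 v \<omega>))\<^sup>2
                       \<le> - \<mu> * (norm v)\<^sup>2 + K * (1 + (norm (j1 v))\<^sup>2)) \<and>
     (AE \<omega> in M. \<forall>v. 2 * A2 v \<omega> v + (hs_norm chi (B2 v \<omega>))\<^sup>2
                       \<le> K * (1 + (norm (j2 v))\<^sup>2))"

definition B_sum ::
  "('v::real_normed_vector \<Rightarrow>\<^sub>L 'a::real_normed_vector) \<Rightarrow> ('v \<Rightarrow>\<^sub>L 'b::real_normed_vector) \<Rightarrow>
   ('a \<Rightarrow> 'w \<Rightarrow> ('u::real_inner \<Rightarrow>\<^sub>L 'h::real_inner)) \<Rightarrow> ('b \<Rightarrow> 'w \<Rightarrow> ('u \<Rightarrow>\<^sub>L 'h)) \<Rightarrow>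
   'v \<Rightarrow> 'w \<Rightarrow> ('u \<Rightarrow>\<^sub>L 'h)" where
  "B_sum i1 i2 B1 B2 v \<omega> = B1 (i1 v) \<omega> + B2 (i2 v) \<omega>"

definition op_growth ::
  "real \<Rightarrow> real \<Rightarrow> (nat \<Rightarrow> 'u::real_inner) \<Rightarrow> 'w measure \<Rightarrow>
   ('a::real_normed_vector \<Rightarrow>\<^sub>L 'h::real_inner) \<Rightarrow>
   ('v::real_normed_vector \<Rightarrow>\<^sub>L 'a) \<Rightarrow> ('v \<Rightarrow>\<^sub>L 'b::real_normed_vector) \<Rightarrow>
   ('a \<Rightarrow> 'w \<Rightarrow> ('a \<Rightarrow>\<^sub>L real)) \<Rightarrow> ('b \<Rightarrow> 'w \<Rightarrow> ('b \<Rightarrow>\<^sub>L real)) \<Rightarrow>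
   ('a \<Rightarrow> 'w \<Rightarrow> ('u \<Rightarrow>\<^sub>L 'h)) \<Rightarrow> ('b \<Rightarrow> 'w \<Rightarrow> ('u \<Rightarrow>\<^sub>L 'h)) \<Rightarrow> bool" where
  "op_growth K p chi M j1 i1 i2 A1 A2 B1 B2 \<longleftrightarrow>
     (AE \<omega> in M. \<forall>v. (norm (A1 v \<omega>))\<^sup>2 \<le> K * (1 + (norm v)\<^sup>2)) \<and>
     (AE \<omega> in M. \<forall>v. norm (A2 v \<omega>) powr (p / (p - 1)) \<le> K * (1 + norm v powr p)) \<and>
     (AE \<omega> in M. \<forall>v. (hs_norm chi (B_sum i1 i2 B1 B2 v \<omega>))\<^sup>2 \<le> K * (1 + (norm (j1 (i1 v)))\<^sup>2))"

section \<open>Galerkin spaces and projections\<close>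

text \<open>
  The clause for \<open>m = 0\<close> is harmless: it only sets \<open>V\<^sub>0 = {0}\<close>. The dimension is given by a finite
  basis because \<^const>\<open>dim\<close> is 0 on infinite-dimensional spaces.
\<close>
definition galerkin_scheme :: "(nat \<Rightarrow> 'v::real_normed_vector set) \<Rightarrow> bool" where
  "galerkin_scheme Vm \<longleftrightarrow>
     (\<forall>m. \<exists>B. finite B \<and> independent B \<and> card B = m \<and> Vm m = span B) \<and>
     (\<forall>m. Vm m \<subseteq> Vm (Suc m)) \<and>
     (\<forall>v. (\<lambda>m. INF \<phi>\<in>Vm m. norm (v - \<phi>)) \<longlonglongrightarrow> 0)"

definition projection_assumption ::
  "('a::real_normed_vector \<Rightarrow>\<^sub>L 'h::real_inner) \<Rightarrow>
   ('v::real_normed_vector \<Rightarrow>\<^sub>L 'a) \<Rightarrow> ('v \<Rightarrow>\<^sub>L 'b::real_normed_vector) \<Rightarrow>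
   (nat \<Rightarrow> 'v set) \<Rightarrow> (nat \<Rightarrow> ('v \<Rightarrow>\<^sub>L real) \<Rightarrow> 'v) \<Rightarrow> (nat \<Rightarrow> real) \<Rightarrow> bool" where
  "projection_assumption j1 i1 i2 Vm Pr \<cc> \<longleftrightarrow>
     (let j = blinfun_apply (j1 o\<^sub>L i1); \<iota> = H_to_dual (j1 o\<^sub>L i1) in
      \<forall>m. (\<forall>f. Pr m f \<in> Vm m) \<and>
          (\<forall>v\<in>Vm m. Pr m (\<iota> (j v)) = v) \<and>
          (\<forall>f v. blinfun_apply f (Pr m (\<iota> (j v))) = blinfun_apply (\<iota> (j v)) (Pr m f)) \<and>
          (\<forall>g h. inner (j (Pr m (\<iota> g))) h = inner (j (Pr m (\<iota> h))) g) \<and>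
          (\<forall>h. norm (j (Pr m (\<iota> h))) \<le> norm h) \<and>
          (\<forall>f. (norm (j (Pr m f)))\<^sup>2 \<le> \<cc> m * (dual_norm i1 i2 f)\<^sup>2))"

section \<open>The numerical scheme\<close>

definition grid :: "real \<Rightarrow> nat \<Rightarrow> nat \<Rightarrow> real" where
  "grid T n i = real i * (T / real n)"

text \<open>For \<open>t = T\<close> and \<open>n > 0\<close> this gives \<open>T\<close>, as required.\<close>
definition kappa :: "real \<Rightarrow> nat \<Rightarrow> real \<Rightarrow> real" where
  "kappa T n t = of_int \<lfloor>t / (T / real n)\<rfloor> * (T / real n)"

text \<open>The tamed operator, where \<open>Pv\<close> stands for the element \<open>\<Pi>\<^sub>m A\<^sub>2 v\<close> of \<open>H\<close>.\<close>
definition tamed :: "nat \<Rightarrow> 'h::real_inner \<Rightarrow> ('b::real_normed_vector \<Rightarrow>\<^sub>L real) \<Rightarrow> ('b \<Rightarrow>\<^sub>L real)" where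
  "tamed n Pv f = (1 / (1 + real n powr (- 1 / 2) * norm Pv)) *\<^sub>R f"

text \<open>The drift \<open>\<Pi>\<^sub>m (A\<^sub>1 v + A\<^bsub>2,l\<^esub> v)\<close>.\<close>
definition scheme_drift ::
  "('a::real_normed_vector \<Rightarrow>\<^sub>L 'h::real_inner) \<Rightarrow>
   ('v::real_normed_vector \<Rightarrow>\<^sub>L 'a) \<Rightarrow> ('v \<Rightarrow>\<^sub>L 'b::real_normed_vector) \<Rightarrow>
   ('a \<Rightarrow> 'w \<Rightarrow> ('a \<Rightarrow>\<^sub>L real)) \<Rightarrow> ('b \<Rightarrow> 'w \<Rightarrow> ('b \<Rightarrow>\<^sub>L real)) \<Rightarrow>
   (('v \<Rightarrow>\<^sub>L real) \<Rightarrow> 'v) \<Rightarrow> nat \<Rightarrow> 'v \<Rightarrow> 'w \<Rightarrow> 'v" where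
  "scheme_drift j1 i1 i2 A1 A2 P n v \<omega> =
     P (dual_add i1 i2 (A1 (i1 v) \<omega>)
         (tamed n (j1 (i1 (P (A2 (i2 v) \<omega> o\<^sub>L i2)))) (A2 (i2 v) \<omega>)))"

text \<open>The operator \<open>\<Pi>\<^sub>m B v\<close>, evaluated at \<open>g \<in> U\<close>.\<close>
definition scheme_diffusion ::
  "('a::real_normed_vector \<Rightarrow>\<^sub>L 'h::real_inner) \<Rightarrow>
   ('v::real_normed_vector \<Rightarrow>\<^sub>L 'a) \<Rightarrow> ('v \<Rightarrow>\<^sub>L 'b::real_normed_vector) \<Rightarrow>
   ('a \<Rightarrow> 'w \<Rightarrow> ('u::real_inner \<Rightarrow>\<^sub>L 'h)) \<Rightarrow> ('b \<Rightarrow> 'w \<Rightarrow> ('u \<Rightarrow>\<^sub>L 'h)) \<Rightarrow>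
   (('v \<Rightarrow>\<^sub>L real) \<Rightarrow> 'v) \<Rightarrow> 'v \<Rightarrow> 'w \<Rightarrow> 'u \<Rightarrow> 'v" where
  "scheme_diffusion j1 i1 i2 B1 B2 P v \<omega> g =
     P (H_to_dual (j1 o\<^sub>L i1) (B_sum i1 i2 B1 B2 v \<omega> g))"

text \<open>
  The Ito integral over \<open>[0,t]\<close>, with respect to \<open>W\<^sub>k = (\<Sum>j<k. (W, chi j) chi j)\<close>, of an operator-valued
  process \<open>\<Phi>\<close> that is constant in time on every cell \<open>[t\<^sub>i, t\<^bsub>i+1\<^esub>)\<close> of the grid: the integral of a
  step process is a finite sum. \<open>\<Phi> s \<omega> g\<close> is the value at \<open>g\<close> of the operator \<open>\<Phi>(s, \<omega>)\<close>.
\<close>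
definition step_ito_integral ::
  "real \<Rightarrow> nat \<Rightarrow> nat \<Rightarrow> (nat \<Rightarrow> 'u) \<Rightarrow> (real \<Rightarrow> 'u \<Rightarrow> 'w \<Rightarrow> real) \<Rightarrow>
   (real \<Rightarrow> 'w \<Rightarrow> 'u \<Rightarrow> 'v::real_vector) \<Rightarrow> real \<Rightarrow> 'w \<Rightarrow> 'v" where
  "step_ito_integral T n k chi W \<Phi> t \<omega> =
     (\<Sum>i<n. \<Sum>j<k.
        (W (min t (grid T n (Suc i))) (chi j) \<omega> - W (min t (grid T n i)) (chi j) \<omega>)
          *\<^sub>R \<Phi> (grid T n i) \<omega> (chi j))"

text \<open>
  The process \<open>u\<close> is a solution of the scheme with discretization parameters \<open>n, k\<close> and \<open>P = \<Pi>\<^sub>m\<close>.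
  The two measurability clauses are part of the meaning of the stochastic integral, whose integrand
  has to be adapted. They do not follow from measurability of the operators at each fixed \<open>v\<close>.
\<close>
definition is_scheme ::
  "'w measure \<Rightarrow> real \<Rightarrow> (real \<Rightarrow> 'w measure) \<Rightarrow> (real \<Rightarrow> 'u::real_inner \<Rightarrow> 'w \<Rightarrow> real) \<Rightarrow>
   (nat \<Rightarrow> 'u) \<Rightarrow>
   ('a::real_normed_vector \<Rightarrow>\<^sub>L 'h::real_inner) \<Rightarrow>
   ('v::{banach, second_countable_topology} \<Rightarrow>\<^sub>L 'a) \<Rightarrow> ('v \<Rightarrow>\<^sub>L 'b::real_normed_vector) \<Rightarrow>
   ('a \<Rightarrow> 'w \<Rightarrow> ('a \<Rightarrow>\<^sub>L real)) \<Rightarrow> ('b \<Rightarrow> 'w \<Rightarrow> ('b \<Rightarrow>\<^sub>L real)) \<Rightarrow>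
   ('a \<Rightarrow> 'w \<Rightarrow> ('u \<Rightarrow>\<^sub>L 'h)) \<Rightarrow> ('b \<Rightarrow> 'w \<Rightarrow> ('u \<Rightarrow>\<^sub>L 'h)) \<Rightarrow>
   (('v \<Rightarrow>\<^sub>L real) \<Rightarrow> 'v) \<Rightarrow> nat \<Rightarrow> nat \<Rightarrow> (real \<Rightarrow> 'w \<Rightarrow> 'v) \<Rightarrow> bool" where
  "is_scheme M T F W chi j1 i1 i2 A1 A2 B1 B2 P n k u \<longleftrightarrow>
     (\<forall>t\<in>{0..T}. u t \<in> borel_measurable (F t)) \<and>
     (\<forall>i<n. \<forall>g. (\<lambda>\<omega>. scheme_diffusion j1 i1 i2 B1 B2 P (u (grid T n i) \<omega>) \<omega> g)
                     \<in> borel_measurable (F (grid T n i))) \<and>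
     (AE \<omega> in M. \<forall>t\<in>{0..T}.
        u t \<omega> = u 0 \<omega>
          + (LINT s:{0..t}|lborel. scheme_drift j1 i1 i2 A1 A2 P n (u (kappa T n s) \<omega>) \<omega>)
          + step_ito_integral T n k chi W
              (\<lambda>s \<omega>. scheme_diffusion j1 i1 i2 B1 B2 P (u (kappa T n s) \<omega>) \<omega>) t \<omega>)"

end

theory Submission
  imports Defs
begin

text \<open>
  On one cell of the grid, coercivity, the taming and the bound on \<open>\<cc>(m) \<tau>\<close> absorb the drift, and
  \<open>|u(s)|\<^sup>2\<close> plus the accumulated \<open>V\<^sub>1\<close>-cost is bounded by an explicit quadratic function \<open>X\<close> of the
  Brownian increments. On a refinement of the grid, \<open>X\<close> changes by \<open>2(v, \<Delta>M) + 2|\<Delta>M|\<^sup>2\<close>, up to a factor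
  \<open>1 + O(\<delta>)\<close>, where \<open>|v|\<^sup>2\<close> and the quadratic variation of \<open>M\<close> are \<open>O(X)\<close>. Hence, for an integer \<open>N > q\<close>,
  the process \<open>X\<^sup>N\<close> times a factor \<open>exp(-ct)\<close> is a positive supermartingale, as soon as the refinement is
  fine enough. For a positive supermartingale \<open>S\<close> and \<open>\<alpha> < 1\<close>, \<open>E (max S)\<^sup>\<alpha>\<close> is at most
  \<open>E S\<^sub>0\<^sup>\<alpha> / (1 - \<alpha>)\<close>. With \<open>\<alpha> = q/N\<close> this bounds the \<open>q\<close>-th moment of the maximum of \<open>X\<close>, with no
  use of the Burkholder-Davis-Gundy inequality; letting the refinement tend to zero, Fatou's lemma and the continuity of
  paths give the supremum over all times.
\<close>

section \<open>Power expansions\<close>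

text \<open>The step of the scheme is fixed by \<open>n\<close>, while the number \<open>k\<close>
  of noise coordinates bears no relation to it, and the remainder in the expansion of an N-th power
  over one cell is bounded only with a constant depending on \<open>k\<close>. On a refined grid
  this remainder is of order \<delta> to the power 3/2 per step, negligible against \<delta>; what
  survives at order \<delta> is controlled by the Hilbert-Schmidt growth bound, in which
  \<open>k\<close> does not occur. Only E |u(0)|^(2q) is assumed finite, so E X^N may be infinite.
  The supermartingale property is therefore stated for nonnegative integrals against nonnegative
  weights known at the earlier time, with the value infinity allowed, and the maximal inequality
  starts from the power \<alpha> of S at time 0, which has a finite mean. The majorant carries the
  cost of all completed cells, so one maximal estimate yields both terms of the theorem. The
  threshold \<epsilon> = \<mu> / (8 K) is chosen so that the squared drift consumes half of the
  coercivity; the other half pays for the integral of the squared \<open>V1\<close> norm.\<close>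

lemma one_plus_power_le:
  fixes x :: real
  assumes "- 1 \<le> x"
  shows "(1 + x) ^ N \<le> 1 + real N * x + (real N)\<^sup>2 * x\<^sup>2 * (1 + \<bar>x\<bar>) ^ N"
proof (induction N)
  case 0
  then show ?case by simp
next
  case (Suc N)
  define P where "P = (1 + \<bar>x\<bar>) ^ N"
  have P1: "1 \<le> P" unfolding P_def by (rule one_le_power) simp
  \<comment> \<open>Multiplying the induction hypothesis by \<open>1 + x\<close> preserves the
    inequality because this factor is nonnegative. The absolute value is confined to the
    remainder.\<close>
  have "(1 + x) ^ Suc N \<le> (1 + x) * (1 + real N * x + (real N)\<^sup>2 * x\<^sup>2 * P)"
    using Suc assms unfolding P_def by (simp add: mult_left_mono)
  also have "\<dots> = 1 + real (Suc N) * x + real N * x\<^sup>2 + (1 + x) * ((real N)\<^sup>2 * x\<^sup>2 * P)"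
    by (simp add: algebra_simps power2_eq_square)
  also have "\<dots> \<le> 1 + real (Suc N) * x + (real (Suc N))\<^sup>2 * x\<^sup>2 * ((1 + \<bar>x\<bar>) * P)"
  proof -
    have "(1 + x) * ((real N)\<^sup>2 * x\<^sup>2 * P) \<le> (1 + \<bar>x\<bar>) * ((real N)\<^sup>2 * x\<^sup>2 * P)"
      using P1 by (intro mult_right_mono) auto
    moreover have "real N * x\<^sup>2 \<le> real N * x\<^sup>2 * ((1 + \<bar>x\<bar>) * P)"
    proof -
      have "1 * 1 \<le> (1 + \<bar>x\<bar>) * P"
        using P1 by (intro mult_mono) auto
      then show ?thesis
        using mult_left_mono[of 1 "(1 + \<bar>x\<bar>) * P" "real N * x\<^sup>2"] by simp
    qed
    moreover have "real N * x\<^sup>2 * ((1 + \<bar>x\<bar>) * P) + (1 + \<bar>x\<bar>) * ((real N)\<^sup>2 * x\<^sup>2 * P)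
       \<le> (real (Suc N))\<^sup>2 * x\<^sup>2 * ((1 + \<bar>x\<bar>) * P)"
    proof -
      have "(real N + (real N)\<^sup>2) * (x\<^sup>2 * ((1 + \<bar>x\<bar>) * P)) \<le> (real (Suc N))\<^sup>2 * (x\<^sup>2 * ((1 + \<bar>x\<bar>) * P))"
        using P1 by (intro mult_right_mono mult_nonneg_nonneg) (auto simp: power2_eq_square algebra_simps)
      then show ?thesis by (simp add: algebra_simps)
    qed
    ultimately show ?thesis by linarith
  qed
  finally show ?case by (simp add: P_def)
qed

text \<open>Peels the 1 off \<open>(1 + t) ^ N\<close>: the surplus carries a factor
  \<open>t\<close>, which raises a second-order remainder to third order.\<close>

lemma one_plus_power_le_linear:
  fixes t :: real
  assumes "0 \<le> t"
  shows "(1 + t) ^ N \<le> 1 + real N * t * (1 + t) ^ N"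
proof (induction N)
  case (Suc N)
  have "1 \<le> (1 + t) ^ Suc N" using assms by (intro one_le_power) simp
  then have "t * 1 \<le> t * (1 + t) ^ Suc N"
    using assms by (rule mult_left_mono)
  moreover have "(1 + t) ^ Suc N \<le> (1 + t) * (1 + real N * t * (1 + t) ^ N)"
    using Suc assms by (simp add: mult_left_mono)
  ultimately show ?case by (simp add: algebra_simps)
qed simp

lemma sum_power_le:
  fixes f :: "nat \<Rightarrow> real"
  assumes "\<And>j. j < k \<Longrightarrow> 0 \<le> f j" "0 < p"
  shows "(\<Sum>j<k. f j) ^ p \<le> real k ^ p * (\<Sum>j<k. f j ^ p)"
proof (cases "k = 0")
  case False
  define m where "m = Max (f ` {..<k})"
  have fin: "finite (f ` {..<k})" "f ` {..<k} \<noteq> {}" using False by (auto simp: lessThan_empty_iff)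
  have "m \<in> f ` {..<k}" unfolding m_def using fin by (rule Max_in)
  then obtain i where i: "i < k" "m = f i" by auto
  have "(\<Sum>j<k. f j) \<le> real k * m"
    using sum_bounded_above[of "{..<k}" f m] fin by (auto simp: m_def)
  then have "(\<Sum>j<k. f j) ^ p \<le> (real k * m) ^ p"
    using assms by (intro power_mono sum_nonneg) auto
  also have "\<dots> = real k ^ p * f i ^ p" using i by (simp add: power_mult_distrib)
  also have "f i ^ p \<le> (\<Sum>j<k. f j ^ p)"
    using i assms by (intro member_le_sum) auto
  finally show ?thesis by (simp add: mult_left_mono)
qed (use assms in \<open>simp add: zero_power\<close>)

text \<open>The second-order remainder z^2 (1 + |z|)^N with z = 2 A + 2 D is split. The square of
  the linear term \<open>A\<close> is kept explicitly, as 2 (2 A)^2 = 8 A^2, because its mean can be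
  bounded without reference to \<open>k\<close>; everything else is at least cubic in the sum of the
  |w j| and may carry constants depending on \<open>k\<close>. The constant is uniform in \<gamma>
  and \<eta>, so these may later be random.\<close>

lemma power_expansion_bound:
  fixes c :: real
  assumes "0 \<le> c"
  shows "\<exists>R\<ge>0. \<forall>\<gamma> \<eta> (w :: nat \<Rightarrow> real).
    (\<forall>j<k. \<bar>\<gamma> j\<bar> \<le> c) \<longrightarrow> (\<forall>j<k. \<forall>l<k. \<bar>\<eta> j l\<bar> \<le> c) \<longrightarrow>
    0 \<le> 1 + 2 * (\<Sum>j<k. \<gamma> j * w j) + 2 * (\<Sum>j<k. \<Sum>l<k. \<eta> j l * (w j * w l)) \<longrightarrow>
    (1 + 2 * (\<Sum>j<k. \<gamma> j * w j) + 2 * (\<Sum>j<k. \<Sum>l<k. \<eta> j l * (w j * w l))) ^ N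
    \<le> 1 + 2 * real N * (\<Sum>j<k. \<gamma> j * w j) + 2 * real N * (\<Sum>j<k. \<Sum>l<k. \<eta> j l * (w j * w l))
      + 8 * (real N)\<^sup>2 * (\<Sum>j<k. \<gamma> j * w j)\<^sup>2
      + R * (\<Sum>j<k. \<bar>w j\<bar> ^ 3 + \<bar>w j\<bar> ^ (6 + 2 * N))"
proof -
  \<comment> \<open>For r \<ge> 1 the bound |z| \<le> 4 c r^2 turns |z|^3 (1 + |z|)^N into a
    multiple of r to the power 6 + 2 N; for r \<le> 1 the cubic term suffices.\<close>
  define L where "L = 6 + 2 * N"
  define R0 where "R0 = (real N)\<^sup>2 * (8 * c\<^sup>2 + 64 * real N * c ^ 3 * (1 + 4 * c) ^ N)"
  define R where "R = R0 * (real k ^ 3 + real k ^ L)"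
  have R0: "0 \<le> R0" using assms by (simp add: R0_def)
  show ?thesis
  proof (intro exI[of _ R] conjI allI impI)
    show "0 \<le> R" using R0 by (simp add: R_def)
  next
    fix \<gamma> \<eta> and w :: "nat \<Rightarrow> real"
    assume \<gamma>: "\<forall>j<k. \<bar>\<gamma> j\<bar> \<le> c" and \<eta>: "\<forall>j<k. \<forall>l<k. \<bar>\<eta> j l\<bar> \<le> c"
    define r where "r = (\<Sum>j<k. \<bar>w j\<bar>)"
    define A where "A = (\<Sum>j<k. \<gamma> j * w j)"
    define D where "D = (\<Sum>j<k. \<Sum>l<k. \<eta> j l * (w j * w l))"
    define z where "z = 2 * A + 2 * D"
    assume "0 \<le> 1 + 2 * (\<Sum>j<k. \<gamma> j * w j) + 2 * (\<Sum>j<k. \<Sum>l<k. \<eta> j l * (w j * w l))"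
    then have z1: "- 1 \<le> z" by (simp add: z_def A_def D_def)
    have r0: "0 \<le> r" by (simp add: r_def sum_nonneg)
    have A: "\<bar>A\<bar> \<le> c * r"
    proof -
      have "\<bar>A\<bar> \<le> (\<Sum>j<k. \<bar>\<gamma> j * w j\<bar>)" unfolding A_def by (rule sum_abs)
      also have "\<dots> \<le> (\<Sum>j<k. c * \<bar>w j\<bar>)"
        using \<gamma> by (intro sum_mono) (auto simp: abs_mult intro: mult_right_mono)
      finally show ?thesis by (simp add: r_def sum_distrib_left)
    qed
    have D: "\<bar>D\<bar> \<le> c * r\<^sup>2"
    proof -
      have "\<bar>D\<bar> \<le> (\<Sum>j<k. \<Sum>l<k. \<bar>\<eta> j l * (w j * w l)\<bar>)"
        unfolding D_def by (rule order_trans[OF sum_abs]) (intro sum_mono sum_abs)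
      also have "\<dots> \<le> (\<Sum>j<k. \<Sum>l<k. c * (\<bar>w j\<bar> * \<bar>w l\<bar>))"
        using \<eta> by (intro sum_mono) (auto simp: abs_mult intro: mult_right_mono)
      also have "\<dots> = c * r\<^sup>2"
        by (simp add: r_def power2_eq_square sum_product flip: sum_distrib_left)
      finally show ?thesis .
    qed
    have z2: "z\<^sup>2 \<le> 8 * A\<^sup>2 + 8 * (c\<^sup>2 * r ^ 4)"
    proof -
      have "z\<^sup>2 \<le> 8 * A\<^sup>2 + 8 * D\<^sup>2"
        using sum_squares_bound[of "2*A" "2*D"] by (simp add: z_def power2_eq_square algebra_simps)
      moreover have "D\<^sup>2 \<le> (c * r\<^sup>2)\<^sup>2"
        using D assms by (intro power2_le_iff_abs_le[THEN iffD2]) auto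
      ultimately show ?thesis by (simp add: power_mult_distrib flip: power_mult)
    qed
    have zr: "\<bar>z\<bar> \<le> 2 * c * (r + r\<^sup>2)"
      using A D by (simp add: z_def algebra_simps)
    have "z\<^sup>2 * (1 + \<bar>z\<bar>) ^ N \<le> 8 * A\<^sup>2 + (8 * c\<^sup>2 + 64 * real N * c ^ 3 * (1 + 4 * c) ^ N) * (r ^ 3 + r ^ L)"
    proof -
      have "z\<^sup>2 * (1 + \<bar>z\<bar>) ^ N \<le> z\<^sup>2 * (1 + real N * \<bar>z\<bar> * (1 + \<bar>z\<bar>) ^ N)"
        by (intro mult_left_mono one_plus_power_le_linear) auto
      also have "\<dots> = z\<^sup>2 + real N * (\<bar>z\<bar> ^ 3 * (1 + \<bar>z\<bar>) ^ N)"
        by (simp add: algebra_simps power3_eq_cube power2_eq_square)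
      also have "\<dots> \<le> (8 * A\<^sup>2 + 8 * (c\<^sup>2 * r ^ 4)) + real N * (64 * c ^ 3 * (1 + 4 * c) ^ N * (r ^ 3 + r ^ L))"
      proof (intro add_mono z2 mult_left_mono)
        show "\<bar>z\<bar> ^ 3 * (1 + \<bar>z\<bar>) ^ N \<le> 64 * c ^ 3 * (1 + 4 * c) ^ N * (r ^ 3 + r ^ L)"
        proof (cases "r \<le> 1")
          case True
          then have "c * r\<^sup>2 \<le> c * r" using r0 assms by (intro mult_left_mono) (auto simp: power2_eq_square mult_left_le)
          then have z4: "\<bar>z\<bar> \<le> 4 * c * r" using zr by (simp add: algebra_simps)
          have "4 * c * r \<le> 4 * c" using True assms r0 by (simp add: mult_left_le)
          with z4 have z5: "\<bar>z\<bar> \<le> 4 * c" by linarith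
          have "\<bar>z\<bar> ^ 3 * (1 + \<bar>z\<bar>) ^ N \<le> (4 * c * r) ^ 3 * (1 + 4 * c) ^ N"
            using z4 z5 assms r0 by (intro mult_mono power_mono) auto
          also have "\<dots> = 64 * c ^ 3 * (1 + 4 * c) ^ N * r ^ 3"
            by (simp add: power_mult_distrib)
          also have "\<dots> \<le> 64 * c ^ 3 * (1 + 4 * c) ^ N * (r ^ 3 + r ^ L)"
            using assms r0 by (intro mult_left_mono) auto
          finally show ?thesis .
        next
          case False
          then have r1: "1 \<le> r" by simp
          have "r \<le> r\<^sup>2" using r1 by (simp add: power2_eq_square)
          then have "c * r \<le> c * r\<^sup>2" using assms by (intro mult_left_mono)
          then have z4: "\<bar>z\<bar> \<le> 4 * c * r\<^sup>2" using zr by (simp add: algebra_simps)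
          have z5: "1 + \<bar>z\<bar> \<le> (1 + 4 * c) * r\<^sup>2"
            using z4 \<open>r \<le> r\<^sup>2\<close> r1 by (simp add: algebra_simps)
          have "\<bar>z\<bar> ^ 3 * (1 + \<bar>z\<bar>) ^ N \<le> (4 * c * r\<^sup>2) ^ 3 * ((1 + 4 * c) * r\<^sup>2) ^ N"
            using z4 z5 assms r0 by (intro mult_mono power_mono) auto
          also have "\<dots> = 64 * c ^ 3 * (1 + 4 * c) ^ N * r ^ L"
            by (simp add: power_mult_distrib L_def power_add flip: power_mult)
          also have "\<dots> \<le> 64 * c ^ 3 * (1 + 4 * c) ^ N * (r ^ 3 + r ^ L)"
            using assms r0 by (intro mult_left_mono) auto
          finally show ?thesis .
        qed
      qed simp
      also have "\<dots> \<le> 8 * A\<^sup>2 + (8 * c\<^sup>2 + 64 * real N * c ^ 3 * (1 + 4 * c) ^ N) * (r ^ 3 + r ^ L)"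
      proof -
        have "r ^ 4 \<le> r ^ 3 + r ^ L"
        proof (cases "r \<le> 1")
          case True
          have "r ^ 4 \<le> r ^ 3" using True r0 by (intro power_decreasing) auto
          then show ?thesis using r0 by (simp add: add_increasing2)
        next
          case False
          have "r ^ 4 \<le> r ^ L" using False by (intro power_increasing) (auto simp: L_def)
          then show ?thesis using r0 by (simp add: add_increasing)
        qed
        then have "c\<^sup>2 * r ^ 4 \<le> c\<^sup>2 * (r ^ 3 + r ^ L)" by (intro mult_left_mono) auto
        then show ?thesis by (simp add: algebra_simps)
      qed
      finally show ?thesis .
    qed
    then have "(real N)\<^sup>2 * (z\<^sup>2 * (1 + \<bar>z\<bar>) ^ N)
        \<le> (real N)\<^sup>2 * (8 * A\<^sup>2 + (8 * c\<^sup>2 + 64 * real N * c ^ 3 * (1 + 4 * c) ^ N) * (r ^ 3 + r ^ L))"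
      by (intro mult_left_mono) auto
    also have "\<dots> = 8 * (real N)\<^sup>2 * A\<^sup>2 + R0 * (r ^ 3 + r ^ L)"
      by (simp add: R0_def algebra_simps)
    also have "R0 * (r ^ 3 + r ^ L) \<le> R * (\<Sum>j<k. \<bar>w j\<bar> ^ 3 + \<bar>w j\<bar> ^ L)"
    proof -
      define s3 where "s3 = (\<Sum>j<k. \<bar>w j\<bar> ^ 3)"
      define sL where "sL = (\<Sum>j<k. \<bar>w j\<bar> ^ L)"
      have s: "0 \<le> s3" "0 \<le> sL" by (auto simp: s3_def sL_def sum_nonneg)
      have "r ^ 3 \<le> real k ^ 3 * s3" "r ^ L \<le> real k ^ L * sL"
        unfolding r_def s3_def sL_def by (auto intro!: sum_power_le simp: L_def)
      moreover have "real k ^ 3 * s3 + real k ^ L * sL \<le> (real k ^ 3 + real k ^ L) * (s3 + sL)"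
        using s by (simp add: algebra_simps)
      ultimately have "R0 * (r ^ 3 + r ^ L) \<le> R0 * ((real k ^ 3 + real k ^ L) * (s3 + sL))"
        using R0 by (intro mult_left_mono) auto
      then show ?thesis by (simp add: R_def s3_def sL_def sum.distrib mult.assoc)
    qed
    finally have "(real N)\<^sup>2 * (z\<^sup>2 * (1 + \<bar>z\<bar>) ^ N)
       \<le> 8 * (real N)\<^sup>2 * A\<^sup>2 + R * (\<Sum>j<k. \<bar>w j\<bar> ^ 3 + \<bar>w j\<bar> ^ L)" by simp
    moreover have "(1 + z) ^ N \<le> 1 + real N * z + (real N)\<^sup>2 * z\<^sup>2 * (1 + \<bar>z\<bar>) ^ N"
      by (rule one_plus_power_le[OF z1])
    ultimately have "(1 + z) ^ N \<le> 1 + real N * z + 8 * (real N)\<^sup>2 * A\<^sup>2 + R * (\<Sum>j<k. \<bar>w j\<bar> ^ 3 + \<bar>w j\<bar> ^ L)"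
      by (simp add: mult.assoc)
    then have "(1 + 2 * A + 2 * D) ^ N \<le> 1 + 2 * real N * A + 2 * real N * D
      + 8 * (real N)\<^sup>2 * A\<^sup>2 + R * (\<Sum>j<k. \<bar>w j\<bar> ^ 3 + \<bar>w j\<bar> ^ (6 + 2 * N))"
      unfolding L_def[symmetric] by (simp add: z_def algebra_simps)
    then show "(1 + 2 * (\<Sum>j<k. \<gamma> j * w j) + 2 * (\<Sum>j<k. \<Sum>l<k. \<eta> j l * (w j * w l))) ^ N
    \<le> 1 + 2 * real N * (\<Sum>j<k. \<gamma> j * w j) + 2 * real N * (\<Sum>j<k. \<Sum>l<k. \<eta> j l * (w j * w l))
      + 8 * (real N)\<^sup>2 * (\<Sum>j<k. \<gamma> j * w j)\<^sup>2
      + R * (\<Sum>j<k. \<bar>w j\<bar> ^ 3 + \<bar>w j\<bar> ^ (6 + 2 * N))"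
      by (simp add: A_def D_def)
  qed
qed

text \<open>Weighted arithmetic-geometric mean inequality for \<open>s\<close> and \<open>m\<close>,
  divided by \<open>m powr (1 - \<alpha>)\<close>. The right side is the tangent at \<open>m\<close>
  of the concave power.\<close>

lemma powr_le_tangent:
  fixes s m \<alpha> :: real
  assumes "0 < m" "0 < s" "0 < \<alpha>" "\<alpha> < 1"
  shows "s powr \<alpha> \<le> (1 - \<alpha>) * m powr \<alpha> + \<alpha> * (m powr (\<alpha> - 1) * s)"
proof -
  have "s powr \<alpha> * m powr (1 - \<alpha>) \<le> \<alpha> * s + (1 - \<alpha>) * m"
    using Youngs_inequality_0[of \<alpha> "1 - \<alpha>" s m] assms by simp
  then have "s powr \<alpha> * m powr (1 - \<alpha>) * m powr (\<alpha> - 1) \<le> (\<alpha> * s + (1 - \<alpha>) * m) * m powr (\<alpha> - 1)"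
    by (intro mult_right_mono) auto
  moreover have "m powr (1 - \<alpha>) * m powr (\<alpha> - 1) = 1"
    using assms by (simp flip: powr_add)
  moreover have "m * m powr (\<alpha> - 1) = m powr \<alpha>"
    using assms by (simp add: powr_diff)
  ultimately show ?thesis by (simp add: algebra_simps)
qed

section \<open>Supermartingales and one-step moment bounds\<close>

text \<open>
  With the running maximum \<open>m\<close> of \<open>S\<close>, the process \<open>(1 - \<alpha>) m\<^sup>\<alpha> + \<alpha> S m\<^sup>\<alpha> / m\<close> is again a
  supermartingale: at a new maximum \<open>S = m\<close> the concave function \<open>s \<mapsto> s\<^sup>\<alpha>\<close> lies below its tangent at the
  old maximum.
\<close>
lemma positive_supermartingale_maximal:
  fixes S :: "nat \<Rightarrow> 'w \<Rightarrow> real"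
  assumes sub: "\<And>g. g \<le> n \<Longrightarrow> subalgebra M (F g)"
    and adapted: "\<And>l g. l \<le> g \<Longrightarrow> g \<le> n \<Longrightarrow> S l \<in> borel_measurable (F g)"
    and pos: "\<And>g \<omega>. 0 < S g \<omega>"
    and step: "\<And>g H. g < n \<Longrightarrow> H \<in> borel_measurable (F g) \<Longrightarrow> (\<And>\<omega>. 0 \<le> H \<omega>) \<Longrightarrow>
        (\<integral>\<^sup>+\<omega>. ennreal (H \<omega> * S (Suc g) \<omega>) \<partial>M) \<le> (\<integral>\<^sup>+\<omega>. ennreal (H \<omega> * S g \<omega>) \<partial>M)"
    and \<alpha>: "0 < \<alpha>" "\<alpha> < 1"
  shows "ennreal (1 - \<alpha>) * (\<integral>\<^sup>+\<omega>. ennreal (Max ((\<lambda>l. S l \<omega>) ` {..n}) powr \<alpha>) \<partial>M)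
     \<le> (\<integral>\<^sup>+\<omega>. ennreal (S 0 \<omega> powr \<alpha>) \<partial>M)"
proof -
  define m where "m g \<omega> = Max ((\<lambda>l. S l \<omega>) ` {..g})" for g \<omega>
  have m0: "m 0 \<omega> = S 0 \<omega>" for \<omega> by (simp add: m_def)
  have mSuc: "m (Suc g) \<omega> = max (S (Suc g) \<omega>) (m g \<omega>)" for g \<omega>
    by (simp add: m_def atMost_Suc)
  have mpos: "0 < m g \<omega>" for g \<omega>
    by (induction g) (simp_all add: m0 mSuc pos max.strict_coboundedI2)
  have mF: "m g \<in> borel_measurable (F g')" if "g \<le> g'" "g' \<le> n" for g g'
    using that(1)
  proof (induction g)
    case 0
    then show ?case using adapted[OF _ that(2)] by (simp add: m0[abs_def])
  next
    case (Suc g)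
    then show ?case using adapted[OF Suc.prems that(2)] by (simp add: mSuc[abs_def])
  qed
  have mM: "m g \<in> borel_measurable M" if "g \<le> n" for g
    using measurable_from_subalg[OF sub mF] that by blast
  have SM: "S g \<in> borel_measurable M" if "g \<le> n" for g
    using measurable_from_subalg[OF sub adapted] that by blast
  define \<Psi> where "\<Psi> g \<omega> = (1 - \<alpha>) * m g \<omega> powr \<alpha> + \<alpha> * m g \<omega> powr (\<alpha> - 1) * S g \<omega>" for g \<omega>
  have "(\<integral>\<^sup>+\<omega>. ennreal (\<Psi> g \<omega>) \<partial>M) \<le> (\<integral>\<^sup>+\<omega>. ennreal (S 0 \<omega> powr \<alpha>) \<partial>M)" if "g \<le> n" for g
    using that
  proof (induction g)
    case 0
    have "\<Psi> 0 \<omega> = S 0 \<omega> powr \<alpha>" for \<omega>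
      using pos[of 0 \<omega>] by (simp add: \<Psi>_def m0 powr_diff algebra_simps)
    then show ?case by simp
  next
    case (Suc g)
    \<comment> \<open>The weight is the slope of the tangent at the old maximum. It is known at step
      \<open>g\<close>, so \<open>step\<close> applies to it, and \<open>S\<close> is integrated
      only in the product with it.\<close>
    define H where "H \<omega> = \<alpha> * m g \<omega> powr (\<alpha> - 1)" for \<omega>
    have g: "g \<le> n" "g < n" using Suc by auto
    have H0: "0 \<le> H \<omega>" for \<omega> using \<alpha> by (simp add: H_def)
    have [measurable]: "m g \<in> borel_measurable M" "S g \<in> borel_measurable M" "S (Suc g) \<in> borel_measurable M"
      using mM SM Suc.prems g by auto
    have [measurable]: "m g \<in> borel_measurable (F g)" using mF g by auto
    have HF: "H \<in> borel_measurable (F g)" unfolding H_def by measurable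
    have [measurable]: "H \<in> borel_measurable M" unfolding H_def by measurable
    have le: "\<Psi> (Suc g) \<omega> \<le> (1 - \<alpha>) * m g \<omega> powr \<alpha> + H \<omega> * S (Suc g) \<omega>" for \<omega>
    proof (cases "S (Suc g) \<omega> \<le> m g \<omega>")
      case True
      then show ?thesis by (simp add: \<Psi>_def mSuc H_def max_def)
    next
      case False
      then have "m (Suc g) \<omega> = S (Suc g) \<omega>" by (simp add: mSuc)
      then have "\<Psi> (Suc g) \<omega> = S (Suc g) \<omega> powr \<alpha>"
        using pos[of "Suc g" \<omega>] by (simp add: \<Psi>_def powr_diff algebra_simps)
      also have "\<dots> \<le> (1 - \<alpha>) * m g \<omega> powr \<alpha> + \<alpha> * (m g \<omega> powr (\<alpha> - 1) * S (Suc g) \<omega>)"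
        by (rule powr_le_tangent) (use mpos pos \<alpha> in auto)
      finally show ?thesis by (simp add: H_def mult.assoc)
    qed
    have "(\<integral>\<^sup>+\<omega>. ennreal (\<Psi> (Suc g) \<omega>) \<partial>M)
      \<le> (\<integral>\<^sup>+\<omega>. ennreal ((1 - \<alpha>) * m g \<omega> powr \<alpha>) + ennreal (H \<omega> * S (Suc g) \<omega>) \<partial>M)"
      using le H0 pos \<alpha> by (intro nn_integral_mono) (simp add: less_imp_le ennreal_leI flip: ennreal_plus)
    also have "\<dots> = (\<integral>\<^sup>+\<omega>. ennreal ((1 - \<alpha>) * m g \<omega> powr \<alpha>) \<partial>M) + (\<integral>\<^sup>+\<omega>. ennreal (H \<omega> * S (Suc g) \<omega>) \<partial>M)"
      by (rule nn_integral_add) measurable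
    also have "\<dots> \<le> (\<integral>\<^sup>+\<omega>. ennreal ((1 - \<alpha>) * m g \<omega> powr \<alpha>) \<partial>M) + (\<integral>\<^sup>+\<omega>. ennreal (H \<omega> * S g \<omega>) \<partial>M)"
      by (intro add_left_mono step g HF H0)
    also have "\<dots> = (\<integral>\<^sup>+\<omega>. ennreal ((1 - \<alpha>) * m g \<omega> powr \<alpha>) + ennreal (H \<omega> * S g \<omega>) \<partial>M)"
      by (rule nn_integral_add[symmetric]) measurable
    also have "\<dots> = (\<integral>\<^sup>+\<omega>. ennreal (\<Psi> g \<omega>) \<partial>M)"
      using H0 pos \<alpha> by (intro nn_integral_cong) (simp add: \<Psi>_def H_def less_imp_le flip: ennreal_plus)
    finally show ?case using Suc.IH g by (auto intro: order_trans)
  qed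
  from this[of n] have "(\<integral>\<^sup>+\<omega>. ennreal (\<Psi> n \<omega>) \<partial>M) \<le> (\<integral>\<^sup>+\<omega>. ennreal (S 0 \<omega> powr \<alpha>) \<partial>M)" by simp
  moreover have "(\<integral>\<^sup>+\<omega>. ennreal (1 - \<alpha>) * ennreal (m n \<omega> powr \<alpha>) \<partial>M) \<le> (\<integral>\<^sup>+\<omega>. ennreal (\<Psi> n \<omega>) \<partial>M)"
    using pos \<alpha> by (intro nn_integral_mono) (auto simp: \<Psi>_def less_imp_le ennreal_leI simp flip: ennreal_mult')
  moreover have "(\<integral>\<^sup>+\<omega>. ennreal (1 - \<alpha>) * ennreal (m n \<omega> powr \<alpha>) \<partial>M)
     = ennreal (1 - \<alpha>) * (\<integral>\<^sup>+\<omega>. ennreal (m n \<omega> powr \<alpha>) \<partial>M)"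
    using mM[OF order_refl] by (intro nn_integral_cmult) simp
  ultimately show ?thesis by (simp add: m_def)
qed

text \<open>Naming the constant makes it a function of \<open>k\<close>, \<open>N\<close> and
  \<open>c\<close> alone, fixed before \<omega>, the coefficients and the step size, so that the
  refinement can be chosen after it.\<close>

definition expansion_const :: "nat \<Rightarrow> nat \<Rightarrow> real \<Rightarrow> real" where
  "expansion_const k N c = (SOME R. 0 \<le> R \<and> (\<forall>\<gamma> \<eta> (w :: nat \<Rightarrow> real).
    (\<forall>j<k. \<bar>\<gamma> j\<bar> \<le> c) \<longrightarrow> (\<forall>j<k. \<forall>l<k. \<bar>\<eta> j l\<bar> \<le> c) \<longrightarrow>
    0 \<le> 1 + 2 * (\<Sum>j<k. \<gamma> j * w j) + 2 * (\<Sum>j<k. \<Sum>l<k. \<eta> j l * (w j * w l)) \<longrightarrow>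
    (1 + 2 * (\<Sum>j<k. \<gamma> j * w j) + 2 * (\<Sum>j<k. \<Sum>l<k. \<eta> j l * (w j * w l))) ^ N
    \<le> 1 + 2 * real N * (\<Sum>j<k. \<gamma> j * w j) + 2 * real N * (\<Sum>j<k. \<Sum>l<k. \<eta> j l * (w j * w l))
      + 8 * (real N)\<^sup>2 * (\<Sum>j<k. \<gamma> j * w j)\<^sup>2
      + R * (\<Sum>j<k. \<bar>w j\<bar> ^ 3 + \<bar>w j\<bar> ^ (6 + 2 * N))))"

lemma expansion_const:
  assumes "0 \<le> c"
  shows "0 \<le> expansion_const k N c"
    and "(\<And>j. j < k \<Longrightarrow> \<bar>\<gamma> j\<bar> \<le> c) \<Longrightarrow> (\<And>j l. j < k \<Longrightarrow> l < k \<Longrightarrow> \<bar>\<eta> j l\<bar> \<le> c) \<Longrightarrow>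
    0 \<le> 1 + 2 * (\<Sum>j<k. \<gamma> j * w j) + 2 * (\<Sum>j<k. \<Sum>l<k. \<eta> j l * (w j * w l)) \<Longrightarrow>
    (1 + 2 * (\<Sum>j<k. \<gamma> j * w j) + 2 * (\<Sum>j<k. \<Sum>l<k. \<eta> j l * (w j * w l))) ^ N
    \<le> 1 + 2 * real N * (\<Sum>j<k. \<gamma> j * w j) + 2 * real N * (\<Sum>j<k. \<Sum>l<k. \<eta> j l * (w j * w l))
      + 8 * (real N)\<^sup>2 * (\<Sum>j<k. \<gamma> j * w j)\<^sup>2
      + expansion_const k N c * (\<Sum>j<k. \<bar>w j\<bar> ^ 3 + \<bar>w j\<bar> ^ (6 + 2 * N))"
proof -
  have ex: "\<exists>R. 0 \<le> R \<and> (\<forall>\<gamma> \<eta> (w :: nat \<Rightarrow> real).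
    (\<forall>j<k. \<bar>\<gamma> j\<bar> \<le> c) \<longrightarrow> (\<forall>j<k. \<forall>l<k. \<bar>\<eta> j l\<bar> \<le> c) \<longrightarrow>
    0 \<le> 1 + 2 * (\<Sum>j<k. \<gamma> j * w j) + 2 * (\<Sum>j<k. \<Sum>l<k. \<eta> j l * (w j * w l)) \<longrightarrow>
    (1 + 2 * (\<Sum>j<k. \<gamma> j * w j) + 2 * (\<Sum>j<k. \<Sum>l<k. \<eta> j l * (w j * w l))) ^ N
    \<le> 1 + 2 * real N * (\<Sum>j<k. \<gamma> j * w j) + 2 * real N * (\<Sum>j<k. \<Sum>l<k. \<eta> j l * (w j * w l))
      + 8 * (real N)\<^sup>2 * (\<Sum>j<k. \<gamma> j * w j)\<^sup>2
      + R * (\<Sum>j<k. \<bar>w j\<bar> ^ 3 + \<bar>w j\<bar> ^ (6 + 2 * N)))"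
    using power_expansion_bound[OF assms, of k N] by blast
  show "0 \<le> expansion_const k N c"
    unfolding expansion_const_def using someI_ex[OF ex] by blast
  show "(1 + 2 * (\<Sum>j<k. \<gamma> j * w j) + 2 * (\<Sum>j<k. \<Sum>l<k. \<eta> j l * (w j * w l))) ^ N
    \<le> 1 + 2 * real N * (\<Sum>j<k. \<gamma> j * w j) + 2 * real N * (\<Sum>j<k. \<Sum>l<k. \<eta> j l * (w j * w l))
      + 8 * (real N)\<^sup>2 * (\<Sum>j<k. \<gamma> j * w j)\<^sup>2
      + expansion_const k N c * (\<Sum>j<k. \<bar>w j\<bar> ^ 3 + \<bar>w j\<bar> ^ (6 + 2 * N))"
    if "\<And>j. j < k \<Longrightarrow> \<bar>\<gamma> j\<bar> \<le> c" "\<And>j l. j < k \<Longrightarrow> l < k \<Longrightarrow> \<bar>\<eta> j l\<bar> \<le> c"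
      "0 \<le> 1 + 2 * (\<Sum>j<k. \<gamma> j * w j) + 2 * (\<Sum>j<k. \<Sum>l<k. \<eta> j l * (w j * w l))"
    unfolding expansion_const_def using someI_ex[OF ex] that by blast
qed

definition std_normal_abs_moment :: "nat \<Rightarrow> real" where
  "std_normal_abs_moment p = (\<integral>x. std_normal_density x * \<bar>x\<bar> ^ p \<partial>lborel)"

text \<open>The conditional moments of Gaussian increments given \<open>G\<close>, encoded as
  integrals against integrable \<open>G\<close>-measurable weights. In this form no conditional
  expectation has to be manipulated.\<close>

definition normal_increments ::
  "'w measure \<Rightarrow> 'w measure \<Rightarrow> real \<Rightarrow> nat \<Rightarrow> (nat \<Rightarrow> 'w \<Rightarrow> real) \<Rightarrow> bool" where
  "normal_increments M G \<delta> k w \<longleftrightarrow>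
     (\<forall>f \<in> borel_measurable G. integrable M f \<longrightarrow>
        (\<forall>j<k. has_bochner_integral M (\<lambda>\<omega>. f \<omega> * w j \<omega>) 0) \<and>
        (\<forall>j<k. \<forall>l<k. has_bochner_integral M (\<lambda>\<omega>. f \<omega> * (w j \<omega> * w l \<omega>))
            (if j = l then \<delta> * integral\<^sup>L M f else 0)) \<and>
        (\<forall>j<k. \<forall>p. has_bochner_integral M (\<lambda>\<omega>. f \<omega> * \<bar>w j \<omega>\<bar> ^ p)
            (sqrt \<delta> ^ p * std_normal_abs_moment p * integral\<^sup>L M f)))"

text \<open>
  The coefficient of \<open>\<delta>\<close> depends only on \<open>N\<close>, \<open>\<kappa>\<close> and \<open>\<kappa>'\<close>; the dependence on the number \<open>k\<close> of noise
  coordinates is confined to terms of order \<open>\<delta>\<close> to the power \<open>3/2\<close>, which disappear when the grid is refined.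
\<close>
lemma normal_increments_power_step:
  fixes X X' :: "'w \<Rightarrow> real"
  assumes sub: "subalgebra M G" and noise: "normal_increments M G \<delta> k w"
    and [measurable]: "X \<in> borel_measurable G" "H \<in> borel_measurable G"
      "\<And>j. j < k \<Longrightarrow> a j \<in> borel_measurable G"
      "\<And>j l. j < k \<Longrightarrow> l < k \<Longrightarrow> e j l \<in> borel_measurable G"
    and pos: "\<And>\<omega>. 0 < X \<omega>" "\<And>\<omega>. 0 \<le> H \<omega>" "\<And>\<omega>. 0 \<le> X' \<omega>" "0 \<le> \<delta>" "0 < \<beta>" "0 \<le> c"
    and le: "AE \<omega> in M. X' \<omega> \<le> \<beta> * (X \<omega> + 2 * (\<Sum>j<k. a j \<omega> * w j \<omega>)
        + 2 * (\<Sum>j<k. \<Sum>l<k. e j l \<omega> * (w j \<omega> * w l \<omega>)))"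
    and abnd: "AE \<omega> in M. \<forall>j<k. \<bar>a j \<omega>\<bar> \<le> c * X \<omega>"
    and ebnd: "AE \<omega> in M. \<forall>j<k. \<forall>l<k. \<bar>e j l \<omega>\<bar> \<le> c * X \<omega>"
    and ssq: "AE \<omega> in M. (\<Sum>j<k. (a j \<omega>)\<^sup>2) \<le> \<kappa>' * (X \<omega>)\<^sup>2"
    and trace: "AE \<omega> in M. (\<Sum>j<k. e j j \<omega>) \<le> \<kappa> * X \<omega>"
    and \<kappa>: "0 \<le> \<kappa>" "0 \<le> \<kappa>'"
  shows "(\<integral>\<^sup>+\<omega>. ennreal (H \<omega> * X' \<omega> ^ N) \<partial>M)
    \<le> ennreal (\<beta> ^ N * (1 + \<delta> * (2 * real N * \<kappa> + 8 * (real N)\<^sup>2 * \<kappa>')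
        + real k * expansion_const k N c * (sqrt \<delta> ^ 3 * std_normal_abs_moment 3
            + sqrt \<delta> ^ (6 + 2 * N) * std_normal_abs_moment (6 + 2 * N))))
      * (\<integral>\<^sup>+\<omega>. ennreal (H \<omega> * X \<omega> ^ N) \<partial>M)"
    (is "?lhs \<le> ennreal (\<beta> ^ N * ?\<theta>) * ?rhs")
proof -
  define L where "L = 6 + 2 * N"
  define R where "R = expansion_const k N c"
  define r where "r = sqrt \<delta> ^ 3 * std_normal_abs_moment 3 + sqrt \<delta> ^ L * std_normal_abs_moment L"
  have R: "0 \<le> R" unfolding R_def by (rule expansion_const) (rule pos)
  have mom: "0 \<le> std_normal_abs_moment p" for p
    unfolding std_normal_abs_moment_def by (intro integral_nonneg_AE) simp
  have r: "0 \<le> r" using mom pos by (simp add: r_def)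
  have \<theta>: "?\<theta> = 1 + \<delta> * (2 * real N * \<kappa> + 8 * (real N)\<^sup>2 * \<kappa>') + real k * R * r"
    by (simp add: r_def R_def L_def)
  have \<theta>1: "1 \<le> ?\<theta>" unfolding \<theta> using pos \<kappa> R r by simp
  show ?thesis
  \<comment> \<open>With an infinite right side the claim holds because the factor in front is
    positive. This case must be covered: \<open>N\<close> will exceed \<open>q\<close>, and
    \<open>X ^ N\<close> need not be integrable.\<close>
  proof (cases "?rhs = \<infinity>")
    case True
    then show ?thesis using \<theta>1 pos by (simp add: ennreal_mult_top ennreal_mult_eq_top_iff)
  next
    case False
    define Y where "Y \<omega> = H \<omega> * X \<omega> ^ N" for \<omega>
    have Y0: "0 \<le> Y \<omega>" for \<omega> using pos by (simp add: Y_def less_imp_le)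
    have [measurable]: "Y \<in> borel_measurable G" unfolding Y_def by measurable
    have intY: "integrable M Y"
    proof (rule integrableI_bounded)
      show "Y \<in> borel_measurable M" by (rule measurable_from_subalg[OF sub]) measurable
      show "(\<integral>\<^sup>+ x. ennreal (norm (Y x)) \<partial>M) < \<infinity>"
        using False Y0 by (simp add: Y_def top.not_eq_extremum)
    qed
    have bnd: "integrable M (\<lambda>\<omega>. Y \<omega> * b \<omega>) \<and> (\<lambda>\<omega>. Y \<omega> * b \<omega>) \<in> borel_measurable G"
      if [measurable]: "b \<in> borel_measurable G" and "AE \<omega> in M. \<bar>b \<omega>\<bar> \<le> C" for b C
    proof
      show m: "(\<lambda>\<omega>. Y \<omega> * b \<omega>) \<in> borel_measurable G" by measurable
      show "integrable M (\<lambda>\<omega>. Y \<omega> * b \<omega>)"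
      proof (rule Bochner_Integration.integrable_bound)
        show "integrable M (\<lambda>\<omega>. Y \<omega> * \<bar>C\<bar>)" using intY by simp
        show "(\<lambda>\<omega>. Y \<omega> * b \<omega>) \<in> borel_measurable M" by (rule measurable_from_subalg[OF sub m])
        show "AE \<omega> in M. norm (Y \<omega> * b \<omega>) \<le> norm (Y \<omega> * \<bar>C\<bar>)"
          using that(2) by eventually_elim (use Y0 in \<open>auto simp: abs_mult intro!: mult_left_mono\<close>)
      qed
    qed
    \<comment> \<open>Dividing by \<open>X\<close> makes the coefficients bounded by the
      deterministic \<open>c\<close>, so one constant \<open>R\<close> serves for almost every
      \<omega>; the factor \<open>X ^ N\<close> has gone into the weight \<open>Y\<close>.\<close>
    define \<gamma> where "\<gamma> j \<omega> = a j \<omega> / X \<omega>" for j \<omega>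
    define \<eta> where "\<eta> j l \<omega> = e j l \<omega> / X \<omega>" for j l \<omega>
    have [measurable]: "\<gamma> j \<in> borel_measurable G" if "j < k" for j
      using that unfolding \<gamma>_def by measurable
    have [measurable]: "\<eta> j l \<in> borel_measurable G" if "j < k" "l < k" for j l
      using that unfolding \<eta>_def by measurable
    have \<gamma>bnd: "AE \<omega> in M. \<forall>j<k. \<bar>\<gamma> j \<omega>\<bar> \<le> c"
      using abnd by eventually_elim (use pos(1) in \<open>auto simp: \<gamma>_def abs_divide divide_simps less_imp_le\<close>)
    have \<eta>bnd: "AE \<omega> in M. \<forall>j<k. \<forall>l<k. \<bar>\<eta> j l \<omega>\<bar> \<le> c"
      using ebnd by eventually_elim (use pos(1) in \<open>auto simp: \<eta>_def abs_divide divide_simps less_imp_le\<close>)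
    \<comment> \<open>The total coefficient of \<open>w j * w l\<close>. After integration only
      \<open>j = l\<close> survives, and the diagonal sum is bounded through \<kappa> and
      \<open>\<kappa>'\<close>, uniformly in \<open>k\<close>.\<close>
    define d where "d j l \<omega> = 2 * real N * \<eta> j l \<omega> + 8 * (real N)\<^sup>2 * (\<gamma> j \<omega> * \<gamma> l \<omega>)" for j l \<omega>
    have dm[measurable]: "d j l \<in> borel_measurable G" if "j < k" "l < k" for j l
      using that unfolding d_def by measurable
    have dbnd: "AE \<omega> in M. \<bar>d j l \<omega>\<bar> \<le> 2 * real N * c + 8 * (real N)\<^sup>2 * (c * c)" if "j < k" "l < k" for j l
      using \<gamma>bnd \<eta>bnd
    proof eventually_elim
      case (elim \<omega>)
      have "\<bar>\<gamma> j \<omega> * \<gamma> l \<omega>\<bar> \<le> c * c"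
        using elim that pos unfolding abs_mult by (intro mult_mono) auto
      then have "8 * (real N)\<^sup>2 * \<bar>\<gamma> j \<omega> * \<gamma> l \<omega>\<bar> \<le> 8 * (real N)\<^sup>2 * (c * c)" by (intro mult_left_mono) auto
      moreover have "2 * real N * \<bar>\<eta> j l \<omega>\<bar> \<le> 2 * real N * c" using elim that by (intro mult_left_mono) auto
      moreover have "\<bar>d j l \<omega>\<bar> \<le> 2 * real N * \<bar>\<eta> j l \<omega>\<bar> + 8 * (real N)\<^sup>2 * \<bar>\<gamma> j \<omega> * \<gamma> l \<omega>\<bar>"
        unfolding d_def by (rule order_trans[OF abs_triangle_ineq]) (simp add: abs_mult)
      ultimately show ?case by linarith
    qed
    define f where "f \<omega> = Y \<omega> + (\<Sum>j<k. 2 * real N * (Y \<omega> * \<gamma> j \<omega> * w j \<omega>))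
      + (\<Sum>j<k. \<Sum>l<k. Y \<omega> * d j l \<omega> * (w j \<omega> * w l \<omega>))
      + (\<Sum>j<k. R * (Y \<omega> * \<bar>w j \<omega>\<bar> ^ 3 + Y \<omega> * \<bar>w j \<omega>\<bar> ^ L))" for \<omega>
    define I where "I = integral\<^sup>L M Y + (\<Sum>j<k. 2 * real N * 0)
      + (\<Sum>j<k. \<Sum>l<k. if j = l then \<delta> * (\<integral>\<omega>. Y \<omega> * d j l \<omega> \<partial>M) else 0)
      + (\<Sum>j<k. R * (sqrt \<delta> ^ 3 * std_normal_abs_moment 3 * integral\<^sup>L M Y
            + sqrt \<delta> ^ L * std_normal_abs_moment L * integral\<^sup>L M Y))"
    have f: "has_bochner_integral M f I"
      unfolding f_def I_def
    proof (intro has_bochner_integral_add has_bochner_integral_sum has_bochner_integral_mult_right)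
      show "has_bochner_integral M Y (integral\<^sup>L M Y)" using intY by (rule has_bochner_integral_integrable)
      fix j assume j: "j \<in> {..<k}"
      show "has_bochner_integral M (\<lambda>\<omega>. Y \<omega> * \<gamma> j \<omega> * w j \<omega>) 0"
      proof -
        have "AE \<omega> in M. \<bar>\<gamma> j \<omega>\<bar> \<le> c"
          using \<gamma>bnd by eventually_elim (use j in auto)
        then have "integrable M (\<lambda>\<omega>. Y \<omega> * \<gamma> j \<omega>) \<and> (\<lambda>\<omega>. Y \<omega> * \<gamma> j \<omega>) \<in> borel_measurable G"
          using j by (intro bnd) auto
        then show ?thesis using noise j unfolding normal_increments_def by blast
      qed
      show "has_bochner_integral M (\<lambda>\<omega>. Y \<omega> * \<bar>w j \<omega>\<bar> ^ 3) (sqrt \<delta> ^ 3 * std_normal_abs_moment 3 * integral\<^sup>L M Y)"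
       "has_bochner_integral M (\<lambda>\<omega>. Y \<omega> * \<bar>w j \<omega>\<bar> ^ L) (sqrt \<delta> ^ L * std_normal_abs_moment L * integral\<^sup>L M Y)"
        using noise j intY unfolding normal_increments_def by auto
      fix l assume l: "l \<in> {..<k}"
      show "has_bochner_integral M (\<lambda>\<omega>. Y \<omega> * d j l \<omega> * (w j \<omega> * w l \<omega>))
        (if j = l then \<delta> * (\<integral>\<omega>. Y \<omega> * d j l \<omega> \<partial>M) else 0)"
      proof -
        have "integrable M (\<lambda>\<omega>. Y \<omega> * d j l \<omega>) \<and> (\<lambda>\<omega>. Y \<omega> * d j l \<omega>) \<in> borel_measurable G"
          using j l by (intro bnd[OF dm dbnd]) auto
        then show ?thesis using noise j l unfolding normal_increments_def by blast
      qed
    qed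
    have I: "I \<le> ?\<theta> * integral\<^sup>L M Y"
    proof -
      have "(\<Sum>j<k. \<integral>\<omega>. Y \<omega> * d j j \<omega> \<partial>M) = (\<integral>\<omega>. (\<Sum>j<k. Y \<omega> * d j j \<omega>) \<partial>M)"
        using bnd[OF dm dbnd] by (intro Bochner_Integration.integral_sum[symmetric]) auto
      also have "\<dots> \<le> (\<integral>\<omega>. Y \<omega> * (2 * real N * \<kappa> + 8 * (real N)\<^sup>2 * \<kappa>') \<partial>M)"
      proof (rule integral_mono_AE)
        show "integrable M (\<lambda>\<omega>. \<Sum>j<k. Y \<omega> * d j j \<omega>)"
          using bnd[OF dm dbnd] by (intro Bochner_Integration.integrable_sum) auto
        show "integrable M (\<lambda>\<omega>. Y \<omega> * (2 * real N * \<kappa> + 8 * (real N)\<^sup>2 * \<kappa>'))" using intY by simp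
        show "AE \<omega> in M. (\<Sum>j<k. Y \<omega> * d j j \<omega>) \<le> Y \<omega> * (2 * real N * \<kappa> + 8 * (real N)\<^sup>2 * \<kappa>')"
          using ssq trace
        proof eventually_elim
          case (elim \<omega>)
          have "(\<Sum>j<k. \<eta> j j \<omega>) \<le> \<kappa>"
            using elim(2) pos(1)[of \<omega>] by (simp add: \<eta>_def divide_simps flip: sum_divide_distrib)
          moreover have "(\<Sum>j<k. \<gamma> j \<omega> * \<gamma> j \<omega>) \<le> \<kappa>'"
            using elim(1) pos(1)[of \<omega>]
            by (simp add: \<gamma>_def divide_simps power2_eq_square flip: sum_divide_distrib)
          ultimately have "2 * real N * (\<Sum>j<k. \<eta> j j \<omega>) + 8 * (real N)\<^sup>2 * (\<Sum>j<k. \<gamma> j \<omega> * \<gamma> j \<omega>)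
             \<le> 2 * real N * \<kappa> + 8 * (real N)\<^sup>2 * \<kappa>'"
            by (intro add_mono mult_left_mono) auto
          then have "(\<Sum>j<k. d j j \<omega>) \<le> 2 * real N * \<kappa> + 8 * (real N)\<^sup>2 * \<kappa>'"
            by (simp add: d_def sum.distrib sum_distrib_left)
          then show ?case using Y0 by (simp add: mult_left_mono flip: sum_distrib_left)
        qed
      qed
      also have "\<dots> = integral\<^sup>L M Y * (2 * real N * \<kappa> + 8 * (real N)\<^sup>2 * \<kappa>')" by simp
      finally have "\<delta> * (\<Sum>j<k. \<integral>\<omega>. Y \<omega> * d j j \<omega> \<partial>M)
          \<le> \<delta> * (integral\<^sup>L M Y * (2 * real N * \<kappa> + 8 * (real N)\<^sup>2 * \<kappa>'))"
        using pos(4) by (rule mult_left_mono)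
      moreover have "I = integral\<^sup>L M Y + \<delta> * (\<Sum>j<k. \<integral>\<omega>. Y \<omega> * d j j \<omega> \<partial>M)
          + real k * (R * (r * integral\<^sup>L M Y))"
        by (simp add: I_def r_def sum_distrib_left distrib_right)
      ultimately have "I \<le> integral\<^sup>L M Y + \<delta> * (integral\<^sup>L M Y * (2 * real N * \<kappa> + 8 * (real N)\<^sup>2 * \<kappa>'))
         + real k * (R * (r * integral\<^sup>L M Y))"
        by linarith
      then show ?thesis unfolding \<theta> by (simp add: algebra_simps)
    qed
    have AEf: "AE \<omega> in M. 0 \<le> f \<omega> \<and> H \<omega> * X' \<omega> ^ N \<le> \<beta> ^ N * f \<omega>"
      using le \<gamma>bnd \<eta>bnd
    proof eventually_elim
      case (elim \<omega>)
      define A where "A = (\<Sum>j<k. \<gamma> j \<omega> * w j \<omega>)"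
      define D where "D = (\<Sum>j<k. \<Sum>l<k. \<eta> j l \<omega> * (w j \<omega> * w l \<omega>))"
      define Q where "Q = (\<Sum>j<k. \<bar>w j \<omega>\<bar> ^ 3 + \<bar>w j \<omega>\<bar> ^ L)"
      have "a j \<omega> = X \<omega> * \<gamma> j \<omega>" "e j l \<omega> = X \<omega> * \<eta> j l \<omega>" for j l
        using pos(1)[of \<omega>] by (auto simp: \<gamma>_def \<eta>_def)
      then have X': "X' \<omega> \<le> \<beta> * (X \<omega> * (1 + 2 * A + 2 * D))"
        using elim(1) by (simp add: A_def D_def sum_distrib_left distrib_left mult.assoc mult.left_commute)
      \<comment> \<open>The expansion requires a nonnegative base. It comes from
        \<open>0 \<le> X'\<close> and the bound on \<open>X'\<close>, after cancelling the positive
        factor \<open>\<beta> * X\<close>.\<close>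
      have "0 \<le> \<beta> * X \<omega> * (1 + 2 * A + 2 * D)" using X' pos(3)[of \<omega>] by (simp add: mult.assoc)
      then have nn: "0 \<le> 1 + 2 * A + 2 * D"
        using mult_pos_pos[OF pos(5) pos(1)[of \<omega>]] by (auto simp: zero_le_mult_iff)
      have "(1 + 2 * A + 2 * D) ^ N \<le> 1 + 2 * real N * A + 2 * real N * D + 8 * (real N)\<^sup>2 * A\<^sup>2 + R * Q"
        unfolding A_def D_def R_def Q_def L_def
        using elim nn by (intro expansion_const(2) pos) (auto simp: A_def D_def)
      then have "Y \<omega> * (1 + 2 * A + 2 * D) ^ N
         \<le> Y \<omega> * (1 + 2 * real N * A + 2 * real N * D + 8 * (real N)\<^sup>2 * A\<^sup>2 + R * Q)"
        using Y0 by (intro mult_left_mono) auto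
      also have "\<dots> = f \<omega>"
      proof -
        have "2 * real N * D + 8 * (real N)\<^sup>2 * A\<^sup>2 = (\<Sum>j<k. \<Sum>l<k. d j l \<omega> * (w j \<omega> * w l \<omega>))"
          by (simp add: A_def D_def d_def power2_eq_square sum_product sum_distrib_left sum.distrib algebra_simps)
        then have "f \<omega> = Y \<omega> + 2 * real N * (Y \<omega> * A) + Y \<omega> * (2 * real N * D + 8 * (real N)\<^sup>2 * A\<^sup>2) + R * (Y \<omega> * Q)"
          by (simp add: f_def A_def Q_def sum_distrib_left mult.assoc distrib_left)
        then show ?thesis by (simp add: algebra_simps)
      qed
      finally have *: "Y \<omega> * (1 + 2 * A + 2 * D) ^ N \<le> f \<omega>" .
      have "0 \<le> Y \<omega> * (1 + 2 * A + 2 * D) ^ N" using Y0 nn by simp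
      with * have "0 \<le> f \<omega>" by linarith
      moreover have "H \<omega> * X' \<omega> ^ N \<le> H \<omega> * (\<beta> * (X \<omega> * (1 + 2 * A + 2 * D))) ^ N"
        using X' pos by (intro mult_left_mono power_mono) auto
      moreover have "\<dots> = \<beta> ^ N * (Y \<omega> * (1 + 2 * A + 2 * D) ^ N)"
        by (simp only: Y_def power_mult_distrib mult_ac)
      moreover have "\<dots> \<le> \<beta> ^ N * f \<omega>" using * pos by (intro mult_left_mono) auto
      ultimately show ?case by simp
    qed
    have intf: "integrable M f" "integral\<^sup>L M f = I"
      using f by (auto simp: has_bochner_integral_iff)
    have "?lhs \<le> (\<integral>\<^sup>+\<omega>. ennreal (\<beta> ^ N * f \<omega>) \<partial>M)"
    proof (rule nn_integral_mono_AE)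
      show "AE \<omega> in M. ennreal (H \<omega> * X' \<omega> ^ N) \<le> ennreal (\<beta> ^ N * f \<omega>)"
        using AEf by eventually_elim (auto intro: ennreal_leI)
    qed
    also have "\<dots> = ennreal (\<integral>\<omega>. \<beta> ^ N * f \<omega> \<partial>M)"
    proof (rule nn_integral_eq_integral)
      show "integrable M (\<lambda>\<omega>. \<beta> ^ N * f \<omega>)" using intf by simp
      show "AE \<omega> in M. 0 \<le> \<beta> ^ N * f \<omega>"
        using AEf by eventually_elim (use pos in auto)
    qed
    also have "\<dots> \<le> ennreal (\<beta> ^ N * ?\<theta> * integral\<^sup>L M Y)"
      using I pos intf by (intro ennreal_leI) (simp add: mult.assoc mult_left_mono)
    also have "\<dots> = ennreal (\<beta> ^ N * ?\<theta>) * ennreal (integral\<^sup>L M Y)"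
      using Y0 by (intro ennreal_mult'') (simp add: integral_nonneg_AE)
    also have "ennreal (integral\<^sup>L M Y) = ?rhs"
      using nn_integral_eq_integral[OF intY] Y0 by (simp add: Y_def)
    finally show ?thesis .
  qed
qed

section \<open>Increments of the Wiener process\<close>

lemma normal_density_abs_moment:
  assumes "0 < \<sigma>"
  shows "integrable lborel (\<lambda>x. normal_density 0 \<sigma> x * \<bar>x\<bar> ^ p)"
    and "(\<integral>x. normal_density 0 \<sigma> x * \<bar>x\<bar> ^ p \<partial>lborel) = \<sigma> ^ p * std_normal_abs_moment p"
proof -
  show "integrable lborel (\<lambda>x. normal_density 0 \<sigma> x * \<bar>x\<bar> ^ p)"
    using integrable_normal_moment_abs[OF assms, of 0 p] by simp
  have "(\<integral>x. normal_density 0 \<sigma> x * \<bar>x\<bar> ^ p \<partial>lborel)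
     = \<bar>\<sigma>\<bar> *\<^sub>R (\<integral>x. normal_density 0 \<sigma> (0 + \<sigma> * x) * \<bar>0 + \<sigma> * x\<bar> ^ p \<partial>lborel)"
    by (rule lborel_integral_real_affine) (use assms in simp)
  also have "\<dots> = (\<integral>x. \<bar>\<sigma>\<bar> * (normal_density 0 \<sigma> (0 + \<sigma> * x) * \<bar>0 + \<sigma> * x\<bar> ^ p) \<partial>lborel)"
    by simp
  also have "\<dots> = (\<integral>x. \<sigma> ^ p * (std_normal_density x * \<bar>x\<bar> ^ p) \<partial>lborel)"
    using assms
    by (intro Bochner_Integration.integral_cong)
      (auto simp: normal_density_def power_mult_distrib real_sqrt_mult abs_mult)
  finally show "(\<integral>x. normal_density 0 \<sigma> x * \<bar>x\<bar> ^ p \<partial>lborel) = \<sigma> ^ p * std_normal_abs_moment p"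
    by (simp add: std_normal_abs_moment_def)
qed

lemma (in prob_space) indep_set_has_bochner_integral_mult:
  fixes f g :: "'a \<Rightarrow> real"
  assumes indep: "indep_set (sets G) (sets N)" and G: "subalgebra M G" and N: "subalgebra M N"
    and f: "f \<in> borel_measurable G" "integrable M f" and g: "g \<in> borel_measurable N" "integrable M g"
  shows "has_bochner_integral M (\<lambda>\<omega>. f \<omega> * g \<omega>) (integral\<^sup>L M f * integral\<^sup>L M g)"
proof -
  have sub: "sigma_sets (space M) {X -` A \<inter> space M |A. A \<in> sets borel} \<subseteq> sets K"
    if "subalgebra M K" "X \<in> borel_measurable K" for X :: "'a \<Rightarrow> real" and K
  proof -
    have sp: "space K = space M" using that by (simp add: subalgebra_def)
    have "{X -` A \<inter> space K |A. A \<in> sets borel} \<subseteq> sets K"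
      using measurable_sets[OF that(2)] by auto
    then have "sigma_sets (space K) {X -` A \<inter> space K |A. A \<in> sets borel} \<subseteq> sets K"
      by (rule sets.sigma_sets_subset)
    then show ?thesis by (simp only: sp)
  qed
  have "indep_set (sigma_sets (space M) {f -` A \<inter> space M |A. A \<in> sets borel})
     (sigma_sets (space M) {g -` A \<inter> space M |A. A \<in> sets borel})"
    using indep sub[OF G f(1)] sub[OF N g(1)] unfolding indep_set_def
    by (elim indep_sets_mono_sets) (auto split: bool.split)
  then have "indep_var borel f borel g"
    using f g by (auto simp: indep_var_eq)
  then show ?thesis
    using f g by (auto simp: has_bochner_integral_iff indep_var_integrable indep_var_lebesgue_integral)
qed

lemma (in prob_space) wiener_normal_increments:
  assumes filt: "filtration_on M T F" and W: "cylindrical_wiener M T F W"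
    and chi: "orthonormal_basis chi" and st: "0 \<le> s" "s < t" "t \<le> T"
  shows "normal_increments M (F s) (t - s) k (\<lambda>j \<omega>. W t (chi j) \<omega> - W s (chi j) \<omega>)"
proof -
  define D where "D h \<omega> = W t h \<omega> - W s h \<omega>" for h \<omega>
  define E where "E = {(\<lambda>\<omega>. W t h \<omega> - W s h \<omega>) -` S \<inter> space M | h S. S \<in> sets borel}"
  \<comment> \<open>The \<sigma>-algebra of the increments in all directions jointly, so that
    products of two coordinates are independent of \<open>F s\<close> as well.\<close>
  define N where "N = sigma (space M) E"
  have sub: "subalgebra M (F r)" if "r \<in> {0..T}" for r
    using filt that by (auto simp: filtration_on_def)
  have "W r h \<in> borel_measurable M" if "r \<in> {0..T}" for r h
    using W that by (auto simp: cylindrical_wiener_def intro!: measurable_from_subalg[OF sub])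
  then have [measurable]: "D h \<in> borel_measurable M" for h
    unfolding D_def using st by (intro borel_measurable_diff) auto
  have EM: "E \<subseteq> sets M"
  proof
    fix A assume "A \<in> E"
    then obtain h S where "A = D h -` S \<inter> space M" "S \<in> sets borel"
      unfolding E_def D_def[abs_def] by blast
    then show "A \<in> sets M" using measurable_sets[of "D h" M borel S] by simp
  qed
  have EP: "E \<subseteq> Pow (space M)" unfolding E_def by auto
  have N: "subalgebra M N" "space N = space M"
    using EM EP sets.sigma_sets_subset[OF EM] by (auto simp: N_def subalgebra_def)
  have D[measurable]: "D h \<in> borel_measurable N" for h
  proof (rule measurableI)
    fix S :: "real set" assume "S \<in> sets borel"
    then have "D h -` S \<inter> space M \<in> E" by (auto simp: E_def D_def[abs_def])
    then show "D h -` S \<inter> space N \<in> sets N" using EP by (auto simp: N_def)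
  qed simp
  have indep: "indep_set (sets (F s)) (sets N)"
    using W st EP by (auto simp: cylindrical_wiener_def N_def E_def)
  have dist: "distributed M lborel (D h) (normal_density 0 (sqrt (t - s) * norm h))" if "h \<noteq> 0" for h
    using W st that unfolding cylindrical_wiener_def D_def[abs_def] by blast
  have \<sigma>: "0 < sqrt (t - s) * norm h" if "h \<noteq> 0" for h :: 'b
    using st that by simp
  have abs: "integrable M (\<lambda>\<omega>. \<bar>D h \<omega>\<bar> ^ p)"
    "(\<integral>\<omega>. \<bar>D h \<omega>\<bar> ^ p \<partial>M) = (sqrt (t - s) * norm h) ^ p * std_normal_abs_moment p" if "h \<noteq> 0" for h p
    using distributed_integrable[OF dist[OF that], of "\<lambda>x. \<bar>x\<bar> ^ p"]
      distributed_integral[OF dist[OF that], of "\<lambda>x. \<bar>x\<bar> ^ p"] normal_density_abs_moment[OF \<sigma>[OF that], of p]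
    by auto
  have sq: "integrable M (\<lambda>\<omega>. (D h \<omega>)\<^sup>2)" "(\<integral>\<omega>. (D h \<omega>)\<^sup>2 \<partial>M) = (t - s) * (norm h)\<^sup>2" if "h \<noteq> 0" for h
    using distributed_integrable[OF dist[OF that], of "\<lambda>x. x\<^sup>2"]
      distributed_integral[OF dist[OF that], of "\<lambda>x. x\<^sup>2"] normal_moment_even[OF \<sigma>[OF that], of 0 1] st \<sigma>[OF that]
    by (auto simp: has_bochner_integral_iff power_mult_distrib)
  have mean: "integrable M (D h)" "(\<integral>\<omega>. D h \<omega> \<partial>M) = 0" if "h \<noteq> 0" for h
    using distributed_integrable[OF dist[OF that], of "\<lambda>x. x"]
      distributed_integral[OF dist[OF that], of "\<lambda>x. x"] normal_moment_odd[OF \<sigma>[OF that], of 0 0]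
    by (auto simp: has_bochner_integral_iff)
  have chi1: "norm (chi j) = 1" "chi j \<noteq> 0" for j
  proof -
    have "inner (chi j) (chi j) = 1" using chi unfolding orthonormal_basis_def by simp
    then show "norm (chi j) = 1" "chi j \<noteq> 0" by (auto simp: norm_eq_sqrt_inner)
  qed
  have lin0: "\<forall>r\<in>{0..T}. \<forall>a b g h.
      AE \<omega> in M. W r (a *\<^sub>R g + b *\<^sub>R h) \<omega> = a * W r g \<omega> + b * W r h \<omega>"
    using W unfolding cylindrical_wiener_def by (elim conjE)
  have cov: "integrable M (\<lambda>\<omega>. D (chi j) \<omega> * D (chi l) \<omega>)"
    "(\<integral>\<omega>. D (chi j) \<omega> * D (chi l) \<omega> \<partial>M) = (if j = l then t - s else 0)" for j l
  proof -
    show i: "integrable M (\<lambda>\<omega>. D (chi j) \<omega> * D (chi l) \<omega>)"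
    proof (rule Bochner_Integration.integrable_bound)
      show "integrable M (\<lambda>\<omega>. (D (chi j) \<omega>)\<^sup>2 + (D (chi l) \<omega>)\<^sup>2)" using sq chi1 by simp
      show "AE \<omega> in M. norm (D (chi j) \<omega> * D (chi l) \<omega>) \<le> norm ((D (chi j) \<omega>)\<^sup>2 + (D (chi l) \<omega>)\<^sup>2)"
      proof (intro AE_I2)
        fix \<omega>
        have "2 * (\<bar>D (chi j) \<omega>\<bar> * \<bar>D (chi l) \<omega>\<bar>) \<le> (D (chi j) \<omega>)\<^sup>2 + (D (chi l) \<omega>)\<^sup>2"
          using sum_squares_bound[of "\<bar>D (chi j) \<omega>\<bar>" "\<bar>D (chi l) \<omega>\<bar>"] by simp
        then have "\<bar>D (chi j) \<omega>\<bar> * \<bar>D (chi l) \<omega>\<bar> \<le> (D (chi j) \<omega>)\<^sup>2 + (D (chi l) \<omega>)\<^sup>2"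
          using zero_le_power2[of "D (chi j) \<omega>"] zero_le_power2[of "D (chi l) \<omega>"] by linarith
        then show "norm (D (chi j) \<omega> * D (chi l) \<omega>) \<le> norm ((D (chi j) \<omega>)\<^sup>2 + (D (chi l) \<omega>)\<^sup>2)"
          by (simp add: abs_mult)
      qed
    qed measurable
    show "(\<integral>\<omega>. D (chi j) \<omega> * D (chi l) \<omega> \<partial>M) = (if j = l then t - s else 0)"
    proof (cases "j = l")
      case True
      then show ?thesis using sq(2)[OF chi1(2)[of l]] by (simp add: chi1 power2_eq_square)
    next
      case False
      then have in0: "inner (chi j) (chi l) = 0" "inner (chi l) (chi j) = 0"
        using chi by (auto simp: orthonormal_basis_def)
      \<comment> \<open>Polarisation: the increment in direction \<open>chi j + chi l\<close> has
        variance 2 (t - s), which is already the sum of the two single variances, so the mixed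
        moment vanishes.\<close>
      have n2: "(norm (chi j + chi l))\<^sup>2 = 2"
        using in0 chi unfolding orthonormal_basis_def
        by (simp add: power2_norm_eq_inner inner_add_left inner_add_right)
      then have nz: "chi j + chi l \<noteq> 0" by auto
      have lin: "AE \<omega> in M. W r (chi j + chi l) \<omega> = W r (chi j) \<omega> + W r (chi l) \<omega>" if "r \<in> {0..T}" for r
        using lin0[rule_format, OF that, of 1 "chi j" 1 "chi l"] by simp
      have "s \<in> {0..T}" "t \<in> {0..T}" using st by auto
      from lin[OF this(1)] lin[OF this(2)]
      have "AE \<omega> in M. (D (chi j + chi l) \<omega>)\<^sup>2
          = (D (chi j) \<omega>)\<^sup>2 + (D (chi l) \<omega>)\<^sup>2 + 2 * (D (chi j) \<omega> * D (chi l) \<omega>)"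
        by eventually_elim (simp add: D_def power2_eq_square algebra_simps)
      then have "(\<integral>\<omega>. (D (chi j + chi l) \<omega>)\<^sup>2 \<partial>M)
          = (\<integral>\<omega>. (D (chi j) \<omega>)\<^sup>2 + (D (chi l) \<omega>)\<^sup>2 + 2 * (D (chi j) \<omega> * D (chi l) \<omega>) \<partial>M)"
        by (intro integral_cong_AE) measurable
      also have "\<dots> = (t - s) + (t - s) + 2 * (\<integral>\<omega>. D (chi j) \<omega> * D (chi l) \<omega> \<partial>M)"
        using sq[OF chi1(2)] i by (simp add: chi1)
      finally show ?thesis using sq(2)[OF nz] n2 False by simp
    qed
  qed
  have prod: "has_bochner_integral M (\<lambda>\<omega>. f \<omega> * g \<omega>) (integral\<^sup>L M g * integral\<^sup>L M f)"
    if "f \<in> borel_measurable (F s)" "integrable M f" "g \<in> borel_measurable N" "integrable M g"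
    for f g :: "'a \<Rightarrow> real"
  proof -
    have "subalgebra M (F s)" using sub st by simp
    then show ?thesis
      using indep_set_has_bochner_integral_mult[OF indep _ N(1) that] by (simp add: mult.commute)
  qed
  show ?thesis
    unfolding normal_increments_def D_def[symmetric]
  proof (intro ballI impI conjI allI)
    fix f :: "'a \<Rightarrow> real" and j assume f: "f \<in> borel_measurable (F s)" "integrable M f"
    show "has_bochner_integral M (\<lambda>\<omega>. f \<omega> * D (chi j) \<omega>) 0"
      using prod[OF f D mean(1)] mean(2) chi1 by (metis mult_zero_left)
    show "has_bochner_integral M (\<lambda>\<omega>. f \<omega> * \<bar>D (chi j) \<omega>\<bar> ^ p)
        (sqrt (t - s) ^ p * std_normal_abs_moment p * integral\<^sup>L M f)" for p
      using prod[OF f _ abs(1)[OF chi1(2)], of j p] abs(2)[OF chi1(2), of j p] by (simp add: chi1)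
    show "has_bochner_integral M (\<lambda>\<omega>. f \<omega> * (D (chi j) \<omega> * D (chi l) \<omega>))
        (if j = l then (t - s) * integral\<^sup>L M f else 0)" for l
      using prod[OF f _ cov(1), of j l] cov(2)[of j l] by (cases "j = l") auto
  qed
qed

section \<open>The time grid\<close>

lemma grid_Suc: "grid T n (Suc i) = grid T n i + T / real n"
  by (simp add: grid_def add_divide_distrib algebra_simps)

lemma grid_0: "grid T n 0 = 0"
  by (simp add: grid_def)

lemma grid_n: "0 < n \<Longrightarrow> grid T n n = T"
  by (simp add: grid_def)

lemma grid_mono: "0 < T \<Longrightarrow> i \<le> l \<Longrightarrow> grid T n i \<le> grid T n l"
  by (auto simp: grid_def intro!: divide_right_mono mult_right_mono)

lemma grid_in: "0 < T \<Longrightarrow> i \<le> n \<Longrightarrow> 0 < n \<Longrightarrow> grid T n i \<in> {0..T}"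
  using grid_mono[of T 0 i n] grid_mono[of T i n n] by (simp add: grid_0 grid_n)

lemma kappa_cell:
  assumes "0 < T" "0 < n" "grid T n i \<le> s" "s < grid T n (Suc i)"
  shows "kappa T n s = grid T n i"
proof -
  have "\<lfloor>s / (T / real n)\<rfloor> = int i"
  proof (rule floor_unique)
    show "real_of_int (int i) \<le> s / (T / real n)"
      using assms by (simp add: grid_def le_divide_eq field_simps)
    show "s / (T / real n) < real_of_int (int i) + 1"
      using assms by (simp add: grid_def divide_less_eq field_simps)
  qed
  then show ?thesis by (simp add: kappa_def grid_def)
qed

lemma kappa_grid: "0 < T \<Longrightarrow> 0 < n \<Longrightarrow> kappa T n (grid T n i) = grid T n i"
  by (rule kappa_cell) (auto simp: grid_Suc)

text \<open>\<open>d\<close> is an arbitrary function, so integrability rests on the step structure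
  alone: the integrand is constant on the cell except possibly at the right end, where
  \<open>kappa\<close> has already jumped to the next node.\<close>

lemma step_set_integral_cell:
  fixes d :: "real \<Rightarrow> 'x::{banach, second_countable_topology}"
  assumes T: "0 < T" "0 < n" and s: "grid T n i \<le> s" "s \<le> grid T n (Suc i)"
  shows "set_integrable lborel {grid T n i<..s} (\<lambda>r. d (kappa T n r))"
    and "(LINT r:{grid T n i<..s}|lborel. d (kappa T n r)) = (s - grid T n i) *\<^sub>R d (grid T n i)"
proof -
  let ?t = "grid T n i"
  have ae: "AE r in lborel. indicator {?t<..s} r *\<^sub>R d (kappa T n r) = indicator {?t<..s} r *\<^sub>R d ?t"
    using AE_lborel_singleton[of s]
  proof eventually_elim
    case (elim r)
    then show ?case using kappa_cell[OF T, of i r] s by (cases "r \<in> {?t<..s}") auto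
  qed
  \<comment> \<open>An identity at every point, not only almost everywhere; it supplies the
    measurability of the integrand.\<close>
  have eq: "indicator {?t<..s} r *\<^sub>R d (kappa T n r) =
      indicator {?t<..<s} r *\<^sub>R d ?t + indicator ({?t<..s} \<inter> {s}) r *\<^sub>R d (kappa T n s)" for r
    using kappa_cell[OF T, of i r] s by (auto simp: indicator_def)
  have int0: "integrable lborel (\<lambda>r. indicator {?t<..s} r *\<^sub>R d ?t)"
    by (intro integrable_scaleR_left integrable_real_indicator) (use s in auto)
  have int: "integrable lborel (\<lambda>r. indicator {?t<..s} r *\<^sub>R d (kappa T n r))"
    unfolding eq
    by (intro Bochner_Integration.integrable_add integrable_scaleR_left integrable_real_indicator)
      (use s in \<open>auto simp: le_less intro: le_less_trans[OF emeasure_mono[of _ "{s}"]]\<close>)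
  then show "set_integrable lborel {?t<..s} (\<lambda>r. d (kappa T n r))"
    by (simp add: set_integrable_def)
  have "(LINT r:{?t<..s}|lborel. d (kappa T n r)) = (\<integral>r. indicator {?t<..s} r *\<^sub>R d ?t \<partial>lborel)"
    unfolding set_lebesgue_integral_def using int int0 ae by (intro integral_cong_AE) auto
  also have "\<dots> = (s - ?t) *\<^sub>R d ?t"
    using s by (subst integral_scaleR_left) auto
  finally show "(LINT r:{?t<..s}|lborel. d (kappa T n r)) = (s - ?t) *\<^sub>R d ?t" .
qed

lemma step_set_integral_grid:
  fixes d :: "real \<Rightarrow> 'x::{banach, second_countable_topology}"
  assumes T: "0 < T" "0 < n"
  shows "set_integrable lborel {0..grid T n i} (\<lambda>r. d (kappa T n r)) \<and>
    (LINT r:{0..grid T n i}|lborel. d (kappa T n r)) = (\<Sum>l<i. (T / real n) *\<^sub>R d (grid T n l))"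
proof (induction i)
  case 0
  have eq: "(\<lambda>r. indicator {0..0::real} r *\<^sub>R d (kappa T n r)) = (\<lambda>r. indicator {0} r *\<^sub>R d (kappa T n 0))"
    by (auto simp: indicator_def fun_eq_iff)
  have "integrable lborel (\<lambda>r. indicator {0::real} r *\<^sub>R d (kappa T n 0))"
    by (intro integrable_scaleR_left integrable_real_indicator) auto
  moreover have "(\<integral>r. indicator {0::real} r *\<^sub>R d (kappa T n 0) \<partial>lborel) = 0"
    by (subst integral_scaleR_left) auto
  ultimately show ?case
    unfolding grid_0 set_integrable_def set_lebesgue_integral_def eq by simp
next
  case (Suc i)
  have le: "0 \<le> grid T n i" "grid T n i \<le> grid T n (Suc i)"
    using grid_mono[OF T(1), of 0 i n] grid_mono[OF T(1), of i "Suc i" n] by (auto simp: grid_0)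
  have un: "{0..grid T n (Suc i)} = {0..grid T n i} \<union> {grid T n i<..grid T n (Suc i)}"
    using le by auto
  have dis: "{0..grid T n i} \<inter> {grid T n i<..grid T n (Suc i)} = {}" by auto
  note c = step_set_integral_cell[OF T le(2) order_refl, of d]
  show ?case unfolding un
    using Suc c set_integrable_Un[OF conjunct1[OF Suc] c(1)] set_integral_Un[OF dis conjunct1[OF Suc] c(1)]
    by (simp add: grid_Suc)
qed

lemma step_set_integral:
  fixes d :: "real \<Rightarrow> 'x::{banach, second_countable_topology}"
  assumes T: "0 < T" "0 < n" and s: "grid T n i \<le> s" "s \<le> grid T n (Suc i)"
  shows "(LINT r:{0..s}|lborel. d (kappa T n r))
    = (LINT r:{0..grid T n i}|lborel. d (kappa T n r)) + (s - grid T n i) *\<^sub>R d (grid T n i)"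
proof -
  have "0 \<le> grid T n i" using grid_mono[OF T(1), of 0 i n] by (simp add: grid_0)
  then have un: "{0..s} = {0..grid T n i} \<union> {grid T n i<..s}" using s by auto
  have dis: "{0..grid T n i} \<inter> {grid T n i<..s} = {}" by auto
  note c = step_set_integral_cell[OF T s, of d]
  show ?thesis unfolding un
    using c set_integral_Un[OF dis conjunct1[OF step_set_integral_grid[OF T]] c(1)] by simp
qed

text \<open>Nonnegativity allows the upper limit to be moved from \<open>t\<close> to the grid point
  \<open>T\<close>, where the integral is a full sum over the cells.\<close>

lemma step_set_integral_le_sum:
  fixes d :: "real \<Rightarrow> real"
  assumes T: "0 < T" "0 < n" and t: "0 \<le> t" "t \<le> T" and d: "\<And>r. 0 \<le> d r"
  shows "(LINT r:{0..t}|lborel. d (kappa T n r)) \<le> T / real n * (\<Sum>l<n. d (grid T n l))"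
    and "0 \<le> (LINT r:{0..t}|lborel. d (kappa T n r))"
proof -
  note g = step_set_integral_grid[OF T, of n d, unfolded grid_n[OF T(2)]]
  have "set_integrable lborel {0..t} (\<lambda>r. d (kappa T n r))"
    using conjunct1[OF g] by (rule set_integrable_subset) (use t in auto)
  then have "(LINT r:{0..t}|lborel. d (kappa T n r)) \<le> (LINT r:{0..T}|lborel. d (kappa T n r))"
    using conjunct1[OF g] t d unfolding set_lebesgue_integral_def set_integrable_def
    by (intro integral_mono) (auto simp: indicator_def)
  with conjunct2[OF g] show "(LINT r:{0..t}|lborel. d (kappa T n r)) \<le> T / real n * (\<Sum>l<n. d (grid T n l))"
    by (simp add: sum_distrib_left)
  show "0 \<le> (LINT r:{0..t}|lborel. d (kappa T n r))"
    unfolding set_lebesgue_integral_def using d by (intro integral_nonneg_AE) auto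
qed

text \<open>Summands of earlier cells have reached their right end and those of later cells have not
  started, so moving inside cell \<open>i\<close> changes the \<open>i\<close>-th summand
  only.\<close>

lemma step_ito_integral_cell:
  assumes T: "0 < T" "0 < n" and i: "i < n" and s: "grid T n i \<le> s" "s \<le> grid T n (Suc i)"
  shows "step_ito_integral T n k chi W \<Phi> s \<omega> = step_ito_integral T n k chi W \<Phi> (grid T n i) \<omega>
    + (\<Sum>j<k. (W s (chi j) \<omega> - W (grid T n i) (chi j) \<omega>) *\<^sub>R \<Phi> (grid T n i) \<omega> (chi j))"
proof -
  let ?g = "grid T n"
  define a where "a r l = (\<Sum>j<k. (W (min r (?g (Suc l))) (chi j) \<omega> - W (min r (?g l)) (chi j) \<omega>)
          *\<^sub>R \<Phi> (?g l) \<omega> (chi j))" for r l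
  let ?m = "(\<Sum>j<k. (W s (chi j) \<omega> - W (?g i) (chi j) \<omega>) *\<^sub>R \<Phi> (?g i) \<omega> (chi j))"
  have "a s l = a (?g i) l + (if l = i then ?m else 0)" for l
  proof -
    consider "l < i" | "l = i" | "i < l" by linarith
    then show ?thesis
    proof cases
      case 1
      then have "?g (Suc l) \<le> ?g i" "?g l \<le> ?g i" using grid_mono[OF T(1)] by auto
      then have "min s (?g (Suc l)) = ?g (Suc l)" "min s (?g l) = ?g l"
        "min (?g i) (?g (Suc l)) = ?g (Suc l)" "min (?g i) (?g l) = ?g l"
        using s by auto
      then show ?thesis using 1 by (simp add: a_def)
    next
      case 2
      then have "min s (?g (Suc l)) = s" "min s (?g l) = ?g i"
        "min (?g i) (?g (Suc l)) = ?g i" "min (?g i) (?g l) = ?g i"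
        using s by auto
      then show ?thesis using 2 by (simp add: a_def)
    next
      case 3
      then have "?g (Suc i) \<le> ?g l" "?g (Suc i) \<le> ?g (Suc l)" using grid_mono[OF T(1)] by auto
      then have "min s (?g (Suc l)) = s" "min s (?g l) = s"
        "min (?g i) (?g (Suc l)) = ?g i" "min (?g i) (?g l) = ?g i"
        using s by auto
      then show ?thesis using 3 by (simp add: a_def)
    qed
  qed
  then have "(\<Sum>l<n. a s l) = (\<Sum>l<n. a (?g i) l) + (\<Sum>l<n. if l = i then ?m else 0)"
    by (simp add: sum.distrib)
  also have "(\<Sum>l<n. if l = i then ?m else 0) = ?m" using i by simp
  finally show ?thesis by (simp add: step_ito_integral_def a_def)
qed

lemma scheme_cell:
  fixes u :: "real \<Rightarrow> 'w \<Rightarrow> 'v::{banach, second_countable_topology}"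
  assumes T: "0 < T" "0 < n" and i: "i < n" and s: "grid T n i \<le> s" "s \<le> grid T n (Suc i)"
    and eq: "\<forall>t\<in>{0..T}. u t \<omega> = u 0 \<omega> + (LINT r:{0..t}|lborel. d (kappa T n r))
          + step_ito_integral T n k chi W (\<lambda>r \<omega>. \<Phi> (kappa T n r) \<omega>) t \<omega>"
  shows "u s \<omega> = u (grid T n i) \<omega> + (s - grid T n i) *\<^sub>R d (grid T n i)
    + (\<Sum>j<k. (W s (chi j) \<omega> - W (grid T n i) (chi j) \<omega>) *\<^sub>R \<Phi> (grid T n i) \<omega> (chi j))"
proof -
  have "grid T n i \<in> {0..T}" "grid T n (Suc i) \<in> {0..T}" using grid_in[OF T(1) _ T(2)] i by auto
  then have "s \<in> {0..T}" "grid T n i \<in> {0..T}" using s by auto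
  from eq[rule_format, OF this(1)] eq[rule_format, OF this(2)] show ?thesis
    unfolding step_set_integral[OF T s, of d] step_ito_integral_cell[OF T i s] kappa_grid[OF T]
    by (simp add: algebra_simps)
qed

text \<open>Pairings with projected functionals can be evaluated only at points of the Galerkin
  space, so the nodes must be known to lie there. The cell formula carries membership from each node
  to the next.\<close>

lemma scheme_in_subspace:
  fixes u :: "real \<Rightarrow> 'w \<Rightarrow> 'v::{banach, second_countable_topology}"
  assumes T: "0 < T" "0 < n" and i: "i \<le> n" and S: "subspace S" "u 0 \<omega> \<in> S"
    and d: "\<And>r. d r \<in> S" and \<Phi>: "\<And>r g. \<Phi> r \<omega> g \<in> S"
    and eq: "\<forall>t\<in>{0..T}. u t \<omega> = u 0 \<omega> + (LINT r:{0..t}|lborel. d (kappa T n r))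
          + step_ito_integral T n k chi W (\<lambda>r \<omega>. \<Phi> (kappa T n r) \<omega>) t \<omega>"
  shows "u (grid T n i) \<omega> \<in> S"
  using i
proof (induction i)
  case 0
  then show ?case using S by (simp add: grid_0)
next
  case (Suc i)
  then have i: "i < n" "u (grid T n i) \<omega> \<in> S" by auto
  have "grid T n i \<le> grid T n (Suc i)" using T by (simp add: grid_Suc)
  from scheme_cell[where u = u and d = d and \<Phi> = \<Phi> and \<omega> = \<omega> and W = W and chi = chi and k = k,
      OF T i(1) this order_refl eq] show ?case
    using i S d \<Phi> by (auto intro!: subspace_add subspace_mul subspace_sum)
qed

section \<open>Projections and the energy of the drift\<close>

lemma mult_self_le_imp_le:
  fixes x y :: real
  assumes "x * x \<le> x * y" "0 \<le> x" "0 \<le> y"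
  shows "x \<le> y"
proof (cases "x = 0")
  case False
  then show ?thesis using assms by (simp add: mult_le_cancel_left)
qed (use assms in simp)

text \<open>Symmetry of the projection combined with its being the identity on \<open>Vm m\<close>.
  Linearity of \<open>Pr m\<close> is not among the assumptions; this identity, tested with a
  projected functional as \<open>v\<close>, takes its place in the norm estimates.\<close>

lemma projection_inner:
  assumes "projection_assumption j1 i1 i2 Vm Pr \<cc>" "v \<in> Vm m"
  shows "inner (j1 (i1 v)) (j1 (i1 (Pr m f))) = blinfun_apply f v"
proof -
  let ?\<iota> = "H_to_dual (j1 o\<^sub>L i1)"
  have "Pr m (?\<iota> (j1 (i1 v))) = v"
    using assms unfolding projection_assumption_def Let_def by (simp)
  moreover have "blinfun_apply f (Pr m (?\<iota> (j1 (i1 v)))) = blinfun_apply (?\<iota> (j1 (i1 v))) (Pr m f)"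
    using assms(1) unfolding projection_assumption_def Let_def by simp
  ultimately show ?thesis by (simp add: H_to_dual_def)
qed

lemma projection_in: "projection_assumption j1 i1 i2 Vm Pr \<cc> \<Longrightarrow> Pr m f \<in> Vm m"
  unfolding projection_assumption_def Let_def by simp

text \<open>Testing the projected sum x against itself gives |x|^2 = (x, P f1 + P f2), and
  Cauchy-Schwarz allows one factor |x| to be cancelled.\<close>

lemma norm_projection_dual_add_le:
  assumes "projection_assumption j1 i1 i2 Vm Pr \<cc>"
  shows "norm (j1 (i1 (Pr m (dual_add i1 i2 f1 f2))))
    \<le> norm (j1 (i1 (Pr m (f1 o\<^sub>L i1)))) + norm (j1 (i1 (Pr m (f2 o\<^sub>L i2))))"
proof -
  define v where "v = Pr m (dual_add i1 i2 f1 f2)"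
  define x where "x = j1 (i1 v)"
  have v: "v \<in> Vm m" unfolding v_def by (rule projection_in[OF assms])
  note pr = projection_inner[OF assms v]
  have "inner x x = blinfun_apply (dual_add i1 i2 f1 f2) v"
    unfolding x_def using pr[of "dual_add i1 i2 f1 f2"] by (simp add: v_def)
  also have "\<dots> = blinfun_apply (f1 o\<^sub>L i1) v + blinfun_apply (f2 o\<^sub>L i2) v"
    by (simp add: dual_add_def plus_blinfun.rep_eq)
  also have "\<dots> = inner x (j1 (i1 (Pr m (f1 o\<^sub>L i1))) + j1 (i1 (Pr m (f2 o\<^sub>L i2))))"
    unfolding x_def inner_add_right pr ..
  also have "\<dots> \<le> norm x * norm (j1 (i1 (Pr m (f1 o\<^sub>L i1))) + j1 (i1 (Pr m (f2 o\<^sub>L i2))))"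
    by (rule norm_cauchy_schwarz)
  also have "\<dots> \<le> norm x * (norm (j1 (i1 (Pr m (f1 o\<^sub>L i1)))) + norm (j1 (i1 (Pr m (f2 o\<^sub>L i2)))))"
    by (intro mult_left_mono norm_triangle_ineq) auto
  finally have "norm x * norm x \<le> norm x * (norm (j1 (i1 (Pr m (f1 o\<^sub>L i1)))) + norm (j1 (i1 (Pr m (f2 o\<^sub>L i2)))))"
    by (simp add: power2_norm_eq_inner flip: power2_eq_square)
  then have "norm x \<le> norm (j1 (i1 (Pr m (f1 o\<^sub>L i1)))) + norm (j1 (i1 (Pr m (f2 o\<^sub>L i2))))"
    by (rule mult_self_le_imp_le) auto
  then show ?thesis by (simp add: x_def v_def)
qed

text \<open>With y the untamed projection, the tamed one has norm at most |y| / (1 + |y| / sqrt n),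
  which stays below sqrt n. Its square times the step T / n is at most T, however large
  \<open>A2\<close> is: this is the purpose of the taming.\<close>

lemma norm_projection_tamed_le:
  assumes "projection_assumption j1 i1 i2 Vm Pr \<cc>" "0 < n"
  shows "(norm (j1 (i1 (Pr m (tamed n (j1 (i1 (Pr m (f o\<^sub>L i2)))) f o\<^sub>L i2)))))\<^sup>2 \<le> real n"
proof -
  define y where "y = j1 (i1 (Pr m (f o\<^sub>L i2)))"
  define a where "a = 1 / (1 + real n powr (- 1 / 2) * norm y)"
  define v where "v = Pr m (tamed n y f o\<^sub>L i2)"
  define x where "x = j1 (i1 v)"
  have v: "v \<in> Vm m" unfolding v_def by (rule projection_in[OF assms(1)])
  note pr = projection_inner[OF assms(1) v]
  have a0: "0 \<le> a" by (simp add: a_def)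
  have "inner x x = blinfun_apply (tamed n y f o\<^sub>L i2) v"
    unfolding x_def using pr[of "tamed n y f o\<^sub>L i2"] by (simp add: v_def)
  also have "\<dots> = a * inner x y"
    unfolding x_def y_def pr by (simp add: tamed_def a_def y_def scaleR_blinfun.rep_eq)
  also have "\<dots> \<le> a * (norm x * norm y)" by (rule mult_left_mono[OF norm_cauchy_schwarz a0])
  finally have "inner x x \<le> norm x * (a * norm y)" by (simp add: algebra_simps)
  then have "norm x * norm x \<le> norm x * (a * norm y)"
    by (simp add: power2_norm_eq_inner flip: power2_eq_square)
  then have xa: "norm x \<le> a * norm y"
    using a0 by - (rule mult_self_le_imp_le, auto)
  have "a * norm y \<le> sqrt (real n)"
  proof -
    have r: "0 < sqrt (real n)" using assms(2) by simp
    have p: "real n powr (- 1 / 2) = 1 / sqrt (real n)"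
      using powr_minus_divide[of "real n" "1 / 2"] by (simp add: powr_half_sqrt)
    have "sqrt (real n) * (1 + 1 / sqrt (real n) * norm y) = sqrt (real n) + norm y"
      using r by (simp only: distrib_left) simp
    then have "norm y \<le> sqrt (real n) * (1 + 1 / sqrt (real n) * norm y)" using r by linarith
    moreover have "0 < 1 + 1 / sqrt (real n) * norm y" using r by (intro add_pos_nonneg) auto
    ultimately show ?thesis unfolding a_def p by (simp only: divide_le_eq times_divide_eq_left) simp
  qed
  with xa have "norm x \<le> sqrt (real n)" by linarith
  then have "(norm x)\<^sup>2 \<le> (sqrt (real n))\<^sup>2" by (intro power_mono) auto
  then show ?thesis by (simp add: x_def v_def y_def)
qed

text \<open>The splitting f + 0 is admissible in the infimum, so the dual norm of \<open>f\<close>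
  restricted to \<open>V\<close> is at most the norm of \<open>f\<close> on \<open>V1\<close>; the
  constant \<open>\<cc> m\<close> is then paired with the step size.\<close>

lemma norm_projection_le_norm:
  fixes i1 :: "'v::real_normed_vector \<Rightarrow>\<^sub>L 'a::real_normed_vector"
    and i2 :: "'v \<Rightarrow>\<^sub>L 'b::real_normed_vector"
  assumes "projection_assumption j1 i1 i2 Vm Pr \<cc>" "\<cc> m * \<tau> \<le> \<epsilon>" "0 \<le> \<epsilon>" "0 \<le> \<tau>"
  shows "\<tau> * (norm (j1 (i1 (Pr m (f o\<^sub>L i1)))))\<^sup>2 \<le> \<epsilon> * (norm f)\<^sup>2"
proof -
  define d where "d = dual_norm i1 i2 (f o\<^sub>L i1)"
  let ?S = "{max (norm f1) (norm f2) | f1 f2. f o\<^sub>L i1 = dual_add i1 i2 f1 f2}"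
  have "f o\<^sub>L i1 = dual_add i1 i2 f 0" by (simp add: dual_add_def)
  then have mem: "max (norm f) (norm (0 :: 'b \<Rightarrow>\<^sub>L real)) \<in> ?S" by blast
  have bdd: "bdd_below ?S" by (intro bdd_belowI[of _ 0]) (auto simp: le_max_iff_disj)
  have "d \<le> norm f" unfolding d_def dual_norm_def using cInf_lower[OF mem bdd] by simp
  moreover have "0 \<le> d" unfolding d_def dual_norm_def using mem by (intro cInf_greatest) (auto simp: le_max_iff_disj)
  ultimately have d: "d\<^sup>2 \<le> (norm f)\<^sup>2" by (intro power_mono)
  have "(norm (j1 (i1 (Pr m (f o\<^sub>L i1)))))\<^sup>2 \<le> \<cc> m * d\<^sup>2"
    using assms(1) unfolding projection_assumption_def Let_def d_def by simp
  then have "\<tau> * (norm (j1 (i1 (Pr m (f o\<^sub>L i1)))))\<^sup>2 \<le> \<tau> * (\<cc> m * d\<^sup>2)"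
    using assms(4) by (intro mult_left_mono)
  also have "\<dots> = (\<cc> m * \<tau>) * d\<^sup>2" by simp
  also have "\<dots> \<le> \<epsilon> * d\<^sup>2" using assms by (intro mult_right_mono) auto
  also have "\<dots> \<le> \<epsilon> * (norm f)\<^sup>2" using assms d by (intro mult_left_mono) auto
  finally show ?thesis .
qed

lemma hs_norm_partial_sum_le:
  assumes "hilbert_schmidt chi S"
  shows "(\<Sum>j<k. (norm (S (chi j)))\<^sup>2) \<le> (hs_norm chi S)\<^sup>2"
proof -
  have "summable (\<lambda>j. (norm (S (chi j)))\<^sup>2)" using assms by (simp add: hilbert_schmidt_def)
  then show ?thesis unfolding hs_norm_def
    by (simp add: sum_le_suminf suminf_nonneg)
qed

lemma hilbert_schmidt_add:
  assumes "hilbert_schmidt chi S" "hilbert_schmidt chi S'"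
  shows "hilbert_schmidt chi (S + S')"
  unfolding hilbert_schmidt_def
proof (rule summable_comparison_test')
  show "summable (\<lambda>j. 2 * (norm (S (chi j)))\<^sup>2 + 2 * (norm (S' (chi j)))\<^sup>2)"
    using assms unfolding hilbert_schmidt_def by (intro summable_add summable_mult)
  fix j :: nat
  let ?a = "norm (S (chi j))" and ?b = "norm (S' (chi j))"
  have "(norm ((S + S') (chi j)))\<^sup>2 \<le> (?a + ?b)\<^sup>2"
    by (intro power_mono) (auto simp: plus_blinfun.rep_eq norm_triangle_ineq)
  also have "\<dots> \<le> 2 * ?a\<^sup>2 + 2 * ?b\<^sup>2"
    using sum_squares_bound[of ?a ?b] by (simp add: power2_sum)
  finally show "norm ((norm ((S + S') (chi j)))\<^sup>2) \<le> 2 * ?a\<^sup>2 + 2 * ?b\<^sup>2" by simp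
qed

text \<open>Expanding the square, the inner product with the drift yields -\<mu> times the squared
  \<open>V1\<close> norm. The squared drift gives back half of it: (a + b)^2 \<le> 2 a^2 + 2 b^2 is
  used twice, so the \<open>A1\<close> part costs 4 (\<mu> / (8 K)) K = \<mu> / 2. In the constant,
  2 K stems from the two coercivity bounds, \<mu> / 2 from the affine part of the growth of
  \<open>A1\<close>, and 4 T from the tamed part.\<close>

lemma scheme_drift_energy:
  fixes A1 :: "'a::{banach, second_countable_topology} \<Rightarrow> 'w \<Rightarrow> ('a \<Rightarrow>\<^sub>L real)"
    and A2 :: "'b::{banach, second_countable_topology} \<Rightarrow> 'w \<Rightarrow> ('b \<Rightarrow>\<^sub>L real)"
    and B1 :: "'a \<Rightarrow> 'w \<Rightarrow> ('u::real_inner \<Rightarrow>\<^sub>L 'h::{real_inner, banach})"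
    and B2 :: "'b \<Rightarrow> 'w \<Rightarrow> ('u \<Rightarrow>\<^sub>L 'h)"
    and i1 :: "'v::{banach, second_countable_topology} \<Rightarrow>\<^sub>L 'a"
  assumes pr: "projection_assumption j1 i1 i2 Vm Pr \<cc>" and v: "v \<in> Vm m" and j: "j1 (i1 v) = j2 (i2 v)"
    and coer1: "2 * A1 (i1 v) \<omega> (i1 v) + (hs_norm chi (B1 (i1 v) \<omega>))\<^sup>2
        \<le> - \<mu> * (norm (i1 v))\<^sup>2 + K * (1 + (norm (j1 (i1 v)))\<^sup>2)"
    and coer2: "2 * A2 (i2 v) \<omega> (i2 v) + (hs_norm chi (B2 (i2 v) \<omega>))\<^sup>2 \<le> K * (1 + (norm (j2 (i2 v)))\<^sup>2)"
    and growth: "(norm (A1 (i1 v) \<omega>))\<^sup>2 \<le> K * (1 + (norm (i1 v))\<^sup>2)"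
    and cc: "\<cc> m * (T / real n) \<le> \<mu> / (8 * K)" and pos: "0 < n" "0 < T" "0 < K" "0 < \<mu>"
    and h: "0 \<le> h" "h \<le> T / real n"
  shows "(norm (j1 (i1 v) + h *\<^sub>R j1 (i1 (scheme_drift j1 i1 i2 A1 A2 (Pr m) n v \<omega>)) + y))\<^sup>2
      + \<mu> / 2 * h * (norm (i1 v))\<^sup>2
    \<le> (norm (j1 (i1 v)))\<^sup>2 + (2 * K + \<mu> / 2 + 4 * T) * h * (1 + (norm (j1 (i1 v)))\<^sup>2)
      + 2 * inner (j1 (i1 v)) y + 2 * (norm y)\<^sup>2"
proof -
  define x where "x = j1 (i1 v)"
  define f2 where "f2 = A2 (i2 v) \<omega>"
  define ft where "ft = tamed n (j1 (i1 (Pr m (f2 o\<^sub>L i2)))) f2"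
  define d where "d = j1 (i1 (scheme_drift j1 i1 i2 A1 A2 (Pr m) n v \<omega>))"
  define a where "a = 1 / (1 + real n powr (- 1 / 2) * norm (j1 (i1 (Pr m (f2 o\<^sub>L i2)))))"
  define Y where "Y = 1 + (norm x)\<^sup>2"
  define N where "N = (norm (i1 v))\<^sup>2"
  have a: "0 \<le> a" "a \<le> 1" by (auto simp: a_def divide_le_eq add_pos_nonneg)
  have d: "d = j1 (i1 (Pr m (dual_add i1 i2 (A1 (i1 v) \<omega>) ft)))"
    by (simp add: d_def scheme_drift_def ft_def f2_def)
  have "inner x d = A1 (i1 v) \<omega> (i1 v) + a * A2 (i2 v) \<omega> (i2 v)"
    unfolding x_def d projection_inner[OF pr v]
    by (simp add: dual_add_def ft_def tamed_def a_def f2_def plus_blinfun.rep_eq scaleR_blinfun.rep_eq)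
  moreover have "2 * A1 (i1 v) \<omega> (i1 v) \<le> - \<mu> * N + K * Y"
    using coer1 zero_le_power2[of "hs_norm chi (B1 (i1 v) \<omega>)"] unfolding N_def Y_def x_def by linarith
  \<comment> \<open>The taming factor lies in [0, 1], and the upper bound survives it because
    \<open>K * Y\<close> is nonnegative, whatever the sign of the pairing.\<close>
  moreover have "2 * (a * A2 (i2 v) \<omega> (i2 v)) \<le> K * Y"
  proof -
    have "2 * A2 (i2 v) \<omega> (i2 v) \<le> K * Y"
      using coer2 zero_le_power2[of "hs_norm chi (B2 (i2 v) \<omega>)"] unfolding Y_def x_def j by linarith
    then have "a * (2 * A2 (i2 v) \<omega> (i2 v)) \<le> a * (K * Y)" using a by (intro mult_left_mono)
    also have "\<dots> \<le> 1 * (K * Y)" using a pos by (intro mult_right_mono) (auto simp: Y_def)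
    finally show ?thesis by simp
  qed
  ultimately have xd: "2 * inner x d \<le> - \<mu> * N + 2 * K * Y" by simp
  have dn: "T / real n * (norm d)\<^sup>2 \<le> \<mu> / 4 * (1 + N) + 2 * T"
  proof -
    let ?p = "norm (j1 (i1 (Pr m (A1 (i1 v) \<omega> o\<^sub>L i1))))" and ?q = "norm (j1 (i1 (Pr m (ft o\<^sub>L i2))))"
    have "(norm d)\<^sup>2 \<le> (?p + ?q)\<^sup>2"
      unfolding d by (intro power_mono norm_projection_dual_add_le[OF pr]) auto
    also have "\<dots> \<le> 2 * ?p\<^sup>2 + 2 * ?q\<^sup>2"
      using sum_squares_bound[of ?p ?q] by (simp add: power2_sum)
    also have "?q\<^sup>2 \<le> real n" unfolding ft_def by (rule norm_projection_tamed_le[OF pr pos(1)])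
    finally have "(norm d)\<^sup>2 \<le> 2 * ?p\<^sup>2 + 2 * real n" by simp
    then have "T / real n * (norm d)\<^sup>2 \<le> T / real n * (2 * ?p\<^sup>2 + 2 * real n)"
      using pos by (intro mult_left_mono) auto
    also have "\<dots> = 2 * (T / real n * ?p\<^sup>2) + 2 * T"
      using pos by (simp add: field_simps)
    also have "T / real n * ?p\<^sup>2 \<le> \<mu> / (8 * K) * (norm (A1 (i1 v) \<omega>))\<^sup>2"
      using pos by (intro norm_projection_le_norm[OF pr cc]) auto
    also have "\<dots> \<le> \<mu> / (8 * K) * (K * (1 + N))"
      using growth pos unfolding N_def by (intro mult_left_mono) auto
    also have "\<dots> = \<mu> / 8 * (1 + N)" using pos by simp
    finally show ?thesis by simp
  qed
  have "(norm (x + h *\<^sub>R d + y))\<^sup>2 = (norm x)\<^sup>2 + 2 * h * inner x d + 2 * inner x y + (norm (h *\<^sub>R d + y))\<^sup>2"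
    by (simp add: power2_norm_eq_inner inner_add_left inner_add_right inner_commute algebra_simps)
  also have "(norm (h *\<^sub>R d + y))\<^sup>2 \<le> (h * norm d + norm y)\<^sup>2"
    using h norm_triangle_ineq[of "h *\<^sub>R d" y] by (intro power_mono) auto
  also have "\<dots> \<le> 2 * (h * norm d)\<^sup>2 + 2 * (norm y)\<^sup>2"
    using sum_squares_bound[of "h * norm d" "norm y"] by (simp add: power2_sum)
  also have "(h * norm d)\<^sup>2 = h * (h * (norm d)\<^sup>2)" by (simp add: power2_eq_square)
  also have "h * (h * (norm d)\<^sup>2) \<le> h * (\<mu> / 4 * (1 + N) + 2 * T)"
    using dn h mult_right_mono[OF h(2), of "(norm d)\<^sup>2"] by (intro mult_left_mono) auto
  finally have "(norm (x + h *\<^sub>R d + y))\<^sup>2 \<le> (norm x)\<^sup>2 + h * (2 * inner x d) + 2 * inner x y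
      + 2 * (h * (\<mu> / 4 * (1 + N) + 2 * T)) + 2 * (norm y)\<^sup>2" by simp
  also have "h * (2 * inner x d) \<le> h * (- \<mu> * N + 2 * K * Y)" using xd h by (intro mult_left_mono)
  finally have "(norm (x + h *\<^sub>R d + y))\<^sup>2 + \<mu> / 2 * h * N
     \<le> (norm x)\<^sup>2 + h * (2 * K * Y + \<mu> / 2 + 4 * T) + 2 * inner x y + 2 * (norm y)\<^sup>2"
    by (simp add: field_simps)
  also have "h * (2 * K * Y + \<mu> / 2 + 4 * T) \<le> h * ((2 * K + \<mu> / 2 + 4 * T) * Y)"
  proof (intro mult_left_mono h)
    have "(\<mu> / 2 + 4 * T) * 1 \<le> (\<mu> / 2 + 4 * T) * Y" using pos by (intro mult_left_mono) (auto simp: Y_def)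
    then show "2 * K * Y + \<mu> / 2 + 4 * T \<le> (2 * K + \<mu> / 2 + 4 * T) * Y" by (simp add: algebra_simps)
  qed
  finally show ?thesis by (simp add: x_def d_def Y_def N_def algebra_simps)
qed

section \<open>Moments of the majorant\<close>

text \<open>
  Measurability is always derived in \<open>'v\<close>: the space \<open>'h\<close> is not assumed to be second countable, so sums of
  measurable \<open>'h\<close>-valued functions need not be measurable.
\<close>
lemma borel_measurable_inner_blinfun:
  fixes J :: "'v::{real_normed_vector, second_countable_topology} \<Rightarrow>\<^sub>L 'h::real_inner"
  assumes "f \<in> borel_measurable N" "g \<in> borel_measurable N"
  shows "(\<lambda>\<omega>. inner (J (f \<omega>)) (J (g \<omega>))) \<in> borel_measurable N"
  using assms by (rule borel_measurable_continuous_Pair) (intro continuous_intros)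

lemma abs_inner_le_mean: "\<bar>inner x y\<bar> \<le> ((norm x)\<^sup>2 + (norm y)\<^sup>2) / 2"
proof -
  have "\<bar>inner x y\<bar> \<le> norm x * norm y" by (rule Cauchy_Schwarz_ineq2)
  then show ?thesis using sum_squares_bound[of "norm x" "norm y"] by simp
qed

lemma grid_fine:
  assumes "0 < a"
  shows "grid T (n * a) (i * a) = grid T n i"
  using assms by (simp add: grid_def field_simps)

lemma grid_fine_div:
  assumes "0 < T" "0 < n" "0 < a"
  shows "grid T n (g div a) \<le> grid T (n * a) g" "grid T (n * a) (Suc g) \<le> grid T n (Suc (g div a))"
proof -
  have "g div a * a \<le> g" "Suc g \<le> Suc (g div a) * a"
    using assms(3) dividend_less_div_times[of a g] by (auto simp: algebra_simps Suc_le_eq)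
  then have "grid T (n * a) (g div a * a) \<le> grid T (n * a) g"
    "grid T (n * a) (Suc g) \<le> grid T (n * a) (Suc (g div a) * a)"
    using grid_mono[OF assms(1)] by auto
  then show "grid T n (g div a) \<le> grid T (n * a) g" "grid T (n * a) (Suc g) \<le> grid T n (Suc (g div a))"
    using grid_fine[OF assms(3)] by metis+
qed

text \<open>Interface between the analysis and the probability: past the cell-wise inequality
  \<open>energy\<close>, the drift no longer appears. For the scheme, \<open>J\<close> embeds
  \<open>V\<close> into \<open>H\<close>, \<open>b i j\<close> is the projected diffusion at node
  \<open>i\<close> in direction \<open>chi j\<close>, \<open>sq i\<close> is the squared
  \<open>V1\<close> norm at node \<open>i\<close>, \<nu> is \<mu> / 2, and \<open>C\<close> is 2 K +
  \<mu> / 2 + 4 T.\<close>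

locale galerkin_energy = prob_space M for M :: "'w measure" +
  fixes T :: real and F :: "real \<Rightarrow> 'w measure" and W :: "real \<Rightarrow> 'u::real_inner \<Rightarrow> 'w \<Rightarrow> real"
    and chi :: "nat \<Rightarrow> 'u" and n k :: nat
    and J :: "'v::{banach, second_countable_topology} \<Rightarrow>\<^sub>L 'h::{real_inner, banach}"
    and u :: "real \<Rightarrow> 'w \<Rightarrow> 'v" and b :: "nat \<Rightarrow> nat \<Rightarrow> 'w \<Rightarrow> 'v" and sq :: "nat \<Rightarrow> 'w \<Rightarrow> real"
    and K \<nu> C :: real
  assumes T: "0 < T" and n: "0 < n" and K: "0 < K" and lam: "0 \<le> \<nu>" and C: "0 \<le> C"
    and filt: "filtration_on M T F" and W: "cylindrical_wiener M T F W" and chi: "orthonormal_basis chi"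
    and u_adapted: "\<And>t. t \<in> {0..T} \<Longrightarrow> u t \<in> borel_measurable (F t)"
    and b_adapted: "\<And>i j. i < n \<Longrightarrow> b i j \<in> borel_measurable (F (grid T n i))"
    and sq_adapted: "\<And>i. i < n \<Longrightarrow> sq i \<in> borel_measurable (F (grid T n i))"
    and sq_nonneg: "\<And>i \<omega>. 0 \<le> sq i \<omega>"
    and trace: "AE \<omega> in M. \<forall>i<n. (\<Sum>j<k. (norm (J (b i j \<omega>)))\<^sup>2) \<le> K * (1 + (norm (J (u (grid T n i) \<omega>)))\<^sup>2)"
    and energy: "AE \<omega> in M. \<forall>i<n. \<forall>s\<in>{grid T n i..grid T n (Suc i)}.
      (norm (J (u s \<omega>)))\<^sup>2 + \<nu> * (s - grid T n i) * sq i \<omega>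
      \<le> (norm (J (u (grid T n i) \<omega>)))\<^sup>2
        + C * (s - grid T n i) * (1 + (norm (J (u (grid T n i) \<omega>)))\<^sup>2)
        + 2 * inner (J (u (grid T n i) \<omega>))
            (J (\<Sum>j<k. (W s (chi j) \<omega> - W (grid T n i) (chi j) \<omega>) *\<^sub>R b i j \<omega>))
        + 2 * (norm (J (\<Sum>j<k. (W s (chi j) \<omega> - W (grid T n i) (chi j) \<omega>) *\<^sub>R b i j \<omega>)))\<^sup>2"
    and cont: "AE \<omega> in M. \<forall>i<n. continuous_on {grid T n i..grid T n (Suc i)} (\<lambda>s. J (u s \<omega>))"
begin

definition noise :: "nat \<Rightarrow> real \<Rightarrow> 'w \<Rightarrow> 'v" where
  "noise i s \<omega> = (\<Sum>j<k. (W s (chi j) \<omega> - W (grid T n i) (chi j) \<omega>) *\<^sub>R b i j \<omega>)"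

text \<open>The added 1 makes affine growth bounds linear in this quantity and keeps the majorant
  away from zero, so that it can be divided by.\<close>

definition node_energy :: "nat \<Rightarrow> 'w \<Rightarrow> real" where
  "node_energy i \<omega> = 1 + (norm (J (u (grid T n i) \<omega>)))\<^sup>2"

text \<open>
  Between grid points the energy is replaced by this upper bound, which does not contain the drift and,
  unlike \<open>|u(s)|\<^sup>2\<close>, changes by a drift-free increment on every step of a finer grid.
\<close>
definition majorant :: "nat \<Rightarrow> real \<Rightarrow> 'w \<Rightarrow> real" where
  "majorant i s \<omega> = node_energy i \<omega> + \<nu> * (T / real n) * (\<Sum>l<i. sq l \<omega>) + C * (s - grid T n i) * node_energy i \<omega>
    + 2 * inner (J (u (grid T n i) \<omega>)) (J (noise i s \<omega>)) + 2 * (norm (J (noise i s \<omega>)))\<^sup>2"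

text \<open>A fine node that is also a coarse node is assigned to the cell on its right. At
  \<open>g = n * a\<close> the cell index is \<open>n\<close>, beyond the last cell; there the noise
  vanishes and the value is the final node energy plus the cost of all cells.\<close>

definition fine_majorant :: "nat \<Rightarrow> nat \<Rightarrow> 'w \<Rightarrow> real" where
  "fine_majorant a g = majorant (g div a) (grid T (n * a) g)"

lemma node_energy_ge_1: "1 \<le> node_energy i \<omega>" by (simp add: node_energy_def)

lemma cost_nonneg: "0 \<le> \<nu> * (T / real n) * (\<Sum>l<i. sq l \<omega>)"
  using T lam by (intro mult_nonneg_nonneg sum_nonneg sq_nonneg) auto

text \<open>Completing the square: with z the node value and m the noise, |z|^2 + 2 (z, m) + 2 |m|^2
  = |z|^2 / 2 + |z + 2 m|^2 / 2. The \<open>C\<close> term is kept in the first bound because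
  \<open>majorant_step\<close> has to subtract a part of it.\<close>

lemma majorant_lower:
  assumes "grid T n i \<le> s"
  shows "node_energy i \<omega> / 2 + C * (s - grid T n i) * node_energy i \<omega> \<le> majorant i s \<omega>"
    and "\<nu> * (T / real n) * (\<Sum>l<i. sq l \<omega>) \<le> majorant i s \<omega>"
proof -
  let ?z = "J (u (grid T n i) \<omega>)" and ?m = "J (noise i s \<omega>)"
  have "0 \<le> (norm (?z + 2 *\<^sub>R ?m))\<^sup>2" by simp
  also have "\<dots> = (norm ?z)\<^sup>2 + 4 * inner ?z ?m + 4 * (norm ?m)\<^sup>2"
    by (simp add: power2_norm_eq_inner inner_add_left inner_add_right inner_commute algebra_simps)
  finally have *: "0 \<le> (norm ?z)\<^sup>2 + 4 * inner ?z ?m + 4 * (norm ?m)\<^sup>2" .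
  have **: "0 \<le> C * (s - grid T n i) * node_energy i \<omega>" using C assms node_energy_ge_1[of i \<omega>] by simp
  show "node_energy i \<omega> / 2 + C * (s - grid T n i) * node_energy i \<omega> \<le> majorant i s \<omega>"
  proof -
    have "1 + (norm ?z)\<^sup>2 = node_energy i \<omega>" by (simp add: node_energy_def)
    then show ?thesis using * cost_nonneg[of \<omega> i] unfolding majorant_def by linarith
  qed
  show "\<nu> * (T / real n) * (\<Sum>l<i. sq l \<omega>) \<le> majorant i s \<omega>"
  proof -
    have "1 + (norm ?z)\<^sup>2 = node_energy i \<omega>" by (simp add: node_energy_def)
    then show ?thesis using * ** node_energy_ge_1[of i \<omega>] unfolding majorant_def by linarith
  qed
qed

lemma majorant_ge_node_energy: "grid T n i \<le> s \<Longrightarrow> node_energy i \<omega> / 2 \<le> majorant i s \<omega>"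
proof -
  assume s: "grid T n i \<le> s"
  then have "0 \<le> C * (s - grid T n i) * node_energy i \<omega>" using C node_energy_ge_1[of i \<omega>] by (intro mult_nonneg_nonneg) auto
  with majorant_lower(1)[OF s, of \<omega>] show "node_energy i \<omega> / 2 \<le> majorant i s \<omega>" by linarith
qed

lemma majorant_pos: "grid T n i \<le> s \<Longrightarrow> 0 < majorant i s \<omega>"
  using majorant_ge_node_energy[of i s \<omega>] node_energy_ge_1[of i \<omega>] by linarith

lemma fine_majorant_pos: "0 < a \<Longrightarrow> 0 < fine_majorant a g \<omega>"
  unfolding fine_majorant_def by (intro majorant_pos grid_fine_div T n)

section \<open>Adaptedness of the majorant\<close>

lemma F_sub: "t \<in> {0..T} \<Longrightarrow> subalgebra M (F t)"
  using filt by (auto simp: filtration_on_def)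

lemma F_mono:
  assumes "f \<in> borel_measurable (F s)" "0 \<le> s" "s \<le> t" "t \<le> T"
  shows "f \<in> borel_measurable (F t)"
proof (rule measurable_from_subalg)
  have "space (F s) = space (F t)" using F_sub[of s] F_sub[of t] assms by (simp add: subalgebra_def)
  moreover have "sets (F s) \<subseteq> sets (F t)" using filt assms unfolding filtration_on_def by blast
  ultimately show "subalgebra (F t) (F s)" by (simp add: subalgebra_def)
qed fact

lemma grid_bounds: "i \<le> n \<Longrightarrow> 0 \<le> grid T n i \<and> grid T n i \<le> T"
  using grid_in[OF T _ n] by auto

lemma W_adapted: "t \<in> {0..T} \<Longrightarrow> W t h \<in> borel_measurable (F t)"
  using W by (auto simp: cylindrical_wiener_def)

lemma noise_adapted:
  assumes "i < n" "grid T n i \<le> s" "s \<le> T"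
  shows "noise i s \<in> borel_measurable (F s)"
proof -
  have g: "0 \<le> grid T n i" "grid T n i \<le> T" using grid_bounds assms by auto
  have [measurable]: "W s (chi j) \<in> borel_measurable (F s)" for j using W_adapted assms g by simp
  have [measurable]: "W (grid T n i) (chi j) \<in> borel_measurable (F s)" for j
    using W_adapted assms g by - (rule F_mono[of _ "grid T n i"], auto)
  have [measurable]: "b i j \<in> borel_measurable (F s)" for j
    using b_adapted assms g by - (rule F_mono[of _ "grid T n i"], auto)
  show ?thesis unfolding noise_def[abs_def] by measurable
qed

lemma noise_start: "noise i (grid T n i) \<omega> = 0"
  by (simp add: noise_def)

lemma u_grid_adapted: "i \<le> n \<Longrightarrow> grid T n i \<le> s \<Longrightarrow> s \<le> T \<Longrightarrow> u (grid T n i) \<in> borel_measurable (F s)"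
  using u_adapted grid_bounds by - (rule F_mono[of _ "grid T n i"], auto)

lemma majorant_adapted:
  assumes "i \<le> n" "grid T n i \<le> s" "s \<le> T"
  shows "majorant i s \<in> borel_measurable (F s)"
proof -
  have [measurable]: "u (grid T n i) \<in> borel_measurable (F s)" using u_grid_adapted assms by simp
  have [measurable]: "node_energy i \<in> borel_measurable (F s)"
    unfolding node_energy_def[abs_def] power2_norm_eq_inner
    by (intro borel_measurable_add borel_measurable_inner_blinfun) measurable
  have [measurable]: "sq l \<in> borel_measurable (F s)" if "l < i" for l
    using that assms sq_adapted[of l] grid_bounds[of l] grid_mono[OF T, of l i n]
    by - (rule F_mono[of _ "grid T n l"], auto)
  have [measurable]: "noise i s \<in> borel_measurable (F s)"
  proof (cases "i < n")
    case True
    then show ?thesis using noise_adapted assms by simp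
  next
    case False
    then have "i = n" using assms by simp
    then have "s = grid T n i" using assms(2,3) grid_n[OF n, of T] by simp
    then have "noise i s = (\<lambda>_. 0)" using noise_start by auto
    then show ?thesis by simp
  qed
  have [measurable]: "(\<lambda>\<omega>. inner (J (u (grid T n i) \<omega>)) (J (noise i s \<omega>))) \<in> borel_measurable (F s)"
    "(\<lambda>\<omega>. inner (J (noise i s \<omega>)) (J (noise i s \<omega>))) \<in> borel_measurable (F s)"
    by (intro borel_measurable_inner_blinfun; measurable)+
  show ?thesis unfolding majorant_def[abs_def] power2_norm_eq_inner by measurable
qed

lemma div_le_cells: "0 < a \<Longrightarrow> g \<le> n * a \<Longrightarrow> g div a \<le> n"
  by (metis div_le_mono nonzero_mult_div_cancel_right less_not_refl2)

lemma div_less_cells: "0 < a \<Longrightarrow> g < n * a \<Longrightarrow> g div a < n"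
  by (simp add: less_mult_imp_div_less)

lemma fine_in: "0 < a \<Longrightarrow> g \<le> n * a \<Longrightarrow> 0 \<le> grid T (n * a) g \<and> grid T (n * a) g \<le> T"
  using grid_in[OF T, of g "n * a"] n by auto

lemma fine_majorant_adapted:
  assumes "0 < a" "l \<le> g" "g \<le> n * a"
  shows "fine_majorant a l \<in> borel_measurable (F (grid T (n * a) g))"
proof -
  have l: "l \<le> n * a" using assms by simp
  have "fine_majorant a l \<in> borel_measurable (F (grid T (n * a) l))"
    unfolding fine_majorant_def
    by (rule majorant_adapted[OF div_le_cells[OF assms(1) l] grid_fine_div(1)[OF T n assms(1)]])
      (use fine_in[OF assms(1) l] in blast)
  moreover have "0 \<le> grid T (n * a) l" using fine_in[OF assms(1) l] by blast
  moreover have "grid T (n * a) g \<le> T" using fine_in[OF assms(1,3)] by blast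
  ultimately show ?thesis
    using F_mono[of "fine_majorant a l" "grid T (n * a) l" "grid T (n * a) g"] grid_mono[OF T assms(2), of "n * a"] by blast
qed

text \<open>This is \<open>energy\<close> at the right end of the cell: the new node energy together
  with the newly completed cost stays below the old majorant, so a change of cell can only lower the
  process.\<close>

lemma majorant_next_cell:
  "AE \<omega> in M. \<forall>i<n. majorant (Suc i) (grid T n (Suc i)) \<omega> \<le> majorant i (grid T n (Suc i)) \<omega>"
  using energy
proof eventually_elim
  case (elim \<omega>)
  show ?case
  proof (intro allI impI)
    fix i assume i: "i < n"
    have "grid T n (Suc i) \<in> {grid T n i..grid T n (Suc i)}" using T n by (simp add: grid_Suc)
    from elim[rule_format, OF i this] show "majorant (Suc i) (grid T n (Suc i)) \<omega> \<le> majorant i (grid T n (Suc i)) \<omega>"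
      unfolding majorant_def noise_start noise_def[symmetric] by (simp add: node_energy_def grid_Suc algebra_simps)
  qed
qed

lemma norm_le_majorant:
  "AE \<omega> in M. \<forall>i<n. \<forall>s\<in>{grid T n i..grid T n (Suc i)}. (norm (J (u s \<omega>)))\<^sup>2 \<le> majorant i s \<omega>"
  using energy
proof eventually_elim
  case (elim \<omega>)
  show ?case
  proof (intro allI impI ballI)
    fix i s assume i: "i < n" and s: "s \<in> {grid T n i..grid T n (Suc i)}"
    have "0 \<le> \<nu> * (s - grid T n i) * sq i \<omega>" using lam s sq_nonneg by simp
    then show "(norm (J (u s \<omega>)))\<^sup>2 \<le> majorant i s \<omega>"
      using elim[rule_format, OF i s] cost_nonneg[of \<omega> i]
      unfolding majorant_def noise_def[symmetric] node_energy_def by simp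
  qed
qed

lemma norm_le_fine_majorant:
  assumes a: "0 < a"
  shows "AE \<omega> in M. \<forall>g\<le>n * a. (norm (J (u (grid T (n * a) g) \<omega>)))\<^sup>2 \<le> fine_majorant a g \<omega>"
  using norm_le_majorant
proof eventually_elim
  case (elim \<omega>)
  show ?case
  proof (intro allI impI)
    fix g assume g: "g \<le> n * a"
    show "(norm (J (u (grid T (n * a) g) \<omega>)))\<^sup>2 \<le> fine_majorant a g \<omega>"
    proof (cases "g < n * a")
      case True
      have "grid T (n * a) g \<le> grid T n (Suc (g div a))"
        using grid_fine_div(2)[OF T n a, of g] grid_mono[OF T, of g "Suc g" "n * a"] by simp
      then show ?thesis
        using elim div_less_cells[OF a True] grid_fine_div(1)[OF T n a, of g] unfolding fine_majorant_def by auto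
    next
      case False
      then have "g = n * a" using g by simp
      moreover have "n * a div a = n" using a by simp
      ultimately have "fine_majorant a g \<omega> = majorant n (grid T n n) \<omega>" "grid T (n * a) g = grid T n n"
        using grid_fine[OF a] unfolding fine_majorant_def by auto
      then show ?thesis
        using cost_nonneg[of \<omega> n] by (simp add: majorant_def noise_start node_energy_def)
    qed
  qed
qed

lemma noise_step: "noise i s' \<omega> = noise i s \<omega> + (\<Sum>j<k. (W s' (chi j) \<omega> - W s (chi j) \<omega>) *\<^sub>R b i j \<omega>)"
  by (simp add: noise_def algebra_simps flip: sum.distrib)

text \<open>As a quadratic polynomial in the noise, the majorant changes exactly by 2 (v, d) + 2
  |d|^2, where d is the noise increment and 2 v is the gradient at the old noise. The remaining
  term, \<open>C * (s' - s)\<close> times the node energy, is absorbed into the factor in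
  front.\<close>

lemma majorant_step:
  fixes i s s' \<omega>
  assumes "grid T n i \<le> s" "s \<le> s'"
  defines "v \<equiv> u (grid T n i) \<omega> + 2 *\<^sub>R noise i s \<omega>"
    and "w \<equiv> \<lambda>j. W s' (chi j) \<omega> - W s (chi j) \<omega>"
  shows "majorant i s' \<omega> \<le> (1 + 2 * C * (s' - s)) * (majorant i s \<omega> + 2 * (\<Sum>j<k. inner (J v) (J (b i j \<omega>)) * w j)
      + 2 * (\<Sum>j<k. \<Sum>l<k. inner (J (b i j \<omega>)) (J (b i l \<omega>)) * (w j * w l)))"
proof -
  define d where "d = (\<Sum>j<k. w j *\<^sub>R b i j \<omega>)"
  have Jd: "J d = (\<Sum>j<k. w j *\<^sub>R J (b i j \<omega>))"
    by (simp add: d_def blinfun.sum_right blinfun.scaleR_right)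
  have 1: "(\<Sum>j<k. inner (J v) (J (b i j \<omega>)) * w j) = inner (J v) (J d)"
    by (simp add: Jd inner_sum_right mult.commute)
  have 2: "(\<Sum>j<k. \<Sum>l<k. inner (J (b i j \<omega>)) (J (b i l \<omega>)) * (w j * w l)) = (norm (J d))\<^sup>2"
    by (simp add: Jd power2_norm_eq_inner inner_sum_right inner_sum_left sum_distrib_left mult_ac inner_commute)
  have ns: "noise i s' \<omega> = noise i s \<omega> + d"
    using noise_step[of i s' \<omega> s] by (simp add: d_def w_def)
  have *: "majorant i s' \<omega> = majorant i s \<omega> + C * (s' - s) * node_energy i \<omega> + 2 * inner (J v) (J d) + 2 * (norm (J d))\<^sup>2"
    unfolding majorant_def ns v_def
    by (simp add: blinfun.add_right blinfun.scaleR_right power2_norm_eq_inner inner_add_left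
        inner_add_right inner_commute algebra_simps)
  define Q where "Q = majorant i s \<omega> + 2 * inner (J v) (J d) + 2 * (norm (J d))\<^sup>2"
  \<comment> \<open>The lower bound is used at the later time. Subtracting
    \<open>C * (s' - s)\<close> times the node energy shows that half the node energy is dominated
    by \<open>Q\<close>, which already contains the random increment.\<close>
  have "node_energy i \<omega> / 2 + C * (s' - grid T n i) * node_energy i \<omega> \<le> majorant i s' \<omega>"
    by (rule majorant_lower) (use assms in simp)
  moreover have "0 \<le> C * (s - grid T n i) * node_energy i \<omega>" using C node_energy_ge_1[of i \<omega>] assms by simp
  ultimately have "node_energy i \<omega> \<le> 2 * Q" using * by (simp add: Q_def algebra_simps)
  then have "C * (s' - s) * node_energy i \<omega> \<le> C * (s' - s) * (2 * Q)"
    using C assms by (intro mult_left_mono) auto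
  then have "majorant i s' \<omega> \<le> (1 + 2 * C * (s' - s)) * Q" using * by (simp add: Q_def algebra_simps)
  then show ?thesis by (simp add: Q_def 1 2)
qed

text \<open>The constants of the leading term are free of \<open>k\<close>: the squared norms of the
  \<open>b i j\<close> sum to at most \<open>K\<close> times the node energy, hence
  \<open>2 * K\<close> times the majorant, and |v|^2 is at most twice the majorant, so
  Cauchy-Schwarz gives \<open>4 * K\<close>. The cruder bound \<open>1 + 2 * K\<close> on single
  coefficients enters only \<open>expansion_const\<close>.\<close>

lemma fine_majorant_moment_step:
  assumes a: "0 < a" and g: "g < n * a" and H: "H \<in> borel_measurable (F (grid T (n * a) g))" "\<And>\<omega>. 0 \<le> H \<omega>"
  defines "\<delta> \<equiv> T / real (n * a)"
  shows "(\<integral>\<^sup>+\<omega>. ennreal (H \<omega> * fine_majorant a (Suc g) \<omega> ^ N) \<partial>M)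
    \<le> ennreal ((1 + 2 * C * \<delta>) ^ N * (1 + \<delta> * (2 * real N * (2 * K) + 8 * (real N)\<^sup>2 * (4 * K))
        + real k * expansion_const k N (1 + 2 * K) * (sqrt \<delta> ^ 3 * std_normal_abs_moment 3
            + sqrt \<delta> ^ (6 + 2 * N) * std_normal_abs_moment (6 + 2 * N))))
      * (\<integral>\<^sup>+\<omega>. ennreal (H \<omega> * fine_majorant a g \<omega> ^ N) \<partial>M)"
proof -
  define i where "i = g div a"
  define s where "s = grid T (n * a) g"
  define s' where "s' = grid T (n * a) (Suc g)"
  have i: "i < n" using div_less_cells[OF a g] by (simp add: i_def)
  have s: "grid T n i \<le> s" "s' \<le> grid T n (Suc i)" "s' = s + \<delta>"
    using grid_fine_div[OF T n a] by (simp_all add: s_def s'_def i_def \<delta>_def grid_Suc)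
  have \<delta>: "0 < \<delta>" using T n a by (simp add: \<delta>_def)
  have sT: "0 \<le> s" "s \<le> T" "s' \<le> T"
    using fine_in[OF a, of g] fine_in[OF a, of "Suc g"] g by (auto simp: s_def s'_def)
  have Xg: "fine_majorant a g = majorant i s" by (simp add: fine_majorant_def i_def s_def)
  define v where "v \<omega> = u (grid T n i) \<omega> + 2 *\<^sub>R noise i s \<omega>" for \<omega>
  define w where "w j \<omega> = W s' (chi j) \<omega> - W s (chi j) \<omega>" for j \<omega>
  have noise': "normal_increments M (F s) \<delta> k w"
    using wiener_normal_increments[OF filt W chi, of s s' k] sT s \<delta> by (simp add: w_def[abs_def])
  have b_meas: "b i j \<in> borel_measurable (F s)" for j
    using b_adapted[OF i] grid_bounds[of i] i s sT by - (rule F_mono[of _ "grid T n i"], auto)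
  have v_meas: "v \<in> borel_measurable (F s)"
  proof -
    have [measurable]: "noise i s \<in> borel_measurable (F s)" "u (grid T n i) \<in> borel_measurable (F s)"
      using noise_adapted[OF i s(1)] u_grid_adapted[of i s] i s sT by auto
    show ?thesis unfolding v_def[abs_def] by measurable
  qed
  \<comment> \<open>When the fine step ends at a coarse node, \<open>fine_majorant\<close> already
    belongs to the next cell, and the change of cell goes in the right direction.\<close>
  have fine_majorant_le: "AE \<omega> in M. fine_majorant a (Suc g) \<omega> \<le> majorant i s' \<omega>"
    using majorant_next_cell
  proof eventually_elim
    case (elim \<omega>)
    show ?case
    proof (cases "Suc g div a = i")
      case True
      then show ?thesis by (simp add: fine_majorant_def s'_def)
    next
      case False
      then have *: "Suc g div a = Suc i" "Suc g = Suc i * a"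
        using div_Suc[of g a] by (auto simp: i_def split: if_splits)
      then have "s' = grid T n (Suc i)"
        unfolding s'_def using grid_fine[OF a, of T n "Suc i"] by simp
      then show ?thesis using elim i * by (simp add: fine_majorant_def s'_def)
    qed
  qed
  \<comment> \<open>\<open>v\<close> is the vector of the completed square, so |v|^2 / 2 is one of
    the terms of the majorant.\<close>
  have vx: "(norm (J (v \<omega>)))\<^sup>2 \<le> 2 * majorant i s \<omega>" for \<omega>
  proof -
    let ?z = "J (u (grid T n i) \<omega>)" and ?m = "J (noise i s \<omega>)"
    have "(norm (J (v \<omega>)))\<^sup>2 = (norm ?z)\<^sup>2 + 4 * inner ?z ?m + 4 * (norm ?m)\<^sup>2"
      by (simp add: v_def blinfun.add_right blinfun.scaleR_right power2_norm_eq_inner inner_add_left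
          inner_add_right inner_commute algebra_simps)
    moreover define B where "B = C * (s - grid T n i) * node_energy i \<omega>"
    moreover define A where "A = \<nu> * (T / real n) * (\<Sum>l<i. sq l \<omega>)"
    moreover have "majorant i s \<omega> = node_energy i \<omega> + A + B + 2 * inner ?z ?m + 2 * (norm ?m)\<^sup>2"
      by (simp add: majorant_def A_def B_def)
    moreover have "0 \<le> A" using cost_nonneg[of \<omega> i] by (simp add: A_def)
    moreover have "0 \<le> B" using C node_energy_ge_1[of i \<omega>] s by (simp add: B_def)
    moreover have "(norm ?z)\<^sup>2 + 1 = node_energy i \<omega>" by (simp add: node_energy_def)
    ultimately show ?thesis
      using zero_le_power2[of "norm ?z"] by linarith
  qed
  have bx: "AE \<omega> in M. (\<Sum>j<k. (norm (J (b i j \<omega>)))\<^sup>2) \<le> 2 * K * majorant i s \<omega>"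
    using trace
  proof eventually_elim
    case (elim \<omega>)
    have "(\<Sum>j<k. (norm (J (b i j \<omega>)))\<^sup>2) \<le> K * node_energy i \<omega>" using elim i by (simp add: node_energy_def)
    also have "\<dots> \<le> K * (2 * majorant i s \<omega>)" using majorant_ge_node_energy[OF s(1), of \<omega>] K by (intro mult_left_mono) auto
    finally show ?case by simp
  qed
  have bjx: "AE \<omega> in M. \<forall>j<k. (norm (J (b i j \<omega>)))\<^sup>2 \<le> 2 * K * majorant i s \<omega>"
    using bx
  proof eventually_elim
    case (elim \<omega>)
    show ?case
    proof (intro allI impI)
      fix j assume "j < k"
      then have "(norm (J (b i j \<omega>)))\<^sup>2 \<le> (\<Sum>j<k. (norm (J (b i j \<omega>)))\<^sup>2)"
        by (intro member_le_sum) auto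
      then show "(norm (J (b i j \<omega>)))\<^sup>2 \<le> 2 * K * majorant i s \<omega>" using elim by linarith
    qed
  qed
  show ?thesis
    unfolding Xg
  proof (rule normal_increments_power_step[where G = "F s" and w = w and a = "\<lambda>j \<omega>. inner (J (v \<omega>)) (J (b i j \<omega>))"
        and e = "\<lambda>j l \<omega>. inner (J (b i j \<omega>)) (J (b i l \<omega>))"])
    show "subalgebra M (F s)" using F_sub sT by simp
    show "majorant i s \<in> borel_measurable (F s)" using majorant_adapted i s sT by simp
    show "H \<in> borel_measurable (F s)" using H by (simp add: s_def)
    show "(\<lambda>\<omega>. inner (J (v \<omega>)) (J (b i j \<omega>))) \<in> borel_measurable (F s)" for j
      by (rule borel_measurable_inner_blinfun[OF v_meas b_meas])
    show "(\<lambda>\<omega>. inner (J (b i j \<omega>)) (J (b i l \<omega>))) \<in> borel_measurable (F s)" for j l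
      by (rule borel_measurable_inner_blinfun[OF b_meas b_meas])
    show "0 < majorant i s \<omega>" for \<omega> using majorant_pos s by simp
    show "0 \<le> fine_majorant a (Suc g) \<omega>" for \<omega> using fine_majorant_pos[OF a, of "Suc g" \<omega>] by simp
    show "0 < 1 + 2 * C * \<delta>" using C \<delta> by (simp add: add_pos_nonneg)
    show "AE \<omega> in M. fine_majorant a (Suc g) \<omega> \<le> (1 + 2 * C * \<delta>) * (majorant i s \<omega> + 2 * (\<Sum>j<k. inner (J (v \<omega>)) (J (b i j \<omega>)) * w j \<omega>)
        + 2 * (\<Sum>j<k. \<Sum>l<k. inner (J (b i j \<omega>)) (J (b i l \<omega>)) * (w j \<omega> * w l \<omega>)))"
      using fine_majorant_le
    proof eventually_elim
      case (elim \<omega>)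
      have "s \<le> s'" using s \<delta> by simp
      from majorant_step[OF s(1) this, of \<omega>] elim show ?case
        unfolding v_def w_def using s(3) by simp
    qed
    show "AE \<omega> in M. \<forall>j<k. \<bar>inner (J (v \<omega>)) (J (b i j \<omega>))\<bar> \<le> (1 + 2 * K) * majorant i s \<omega>"
      using bjx
    proof eventually_elim
      case (elim \<omega>)
      have "0 \<le> K * majorant i s \<omega>" using K majorant_pos[OF s(1), of \<omega>] by simp
      show ?case
      proof (intro allI impI)
        fix j assume "j < k"
        then have "(norm (J (b i j \<omega>)))\<^sup>2 \<le> 2 * K * majorant i s \<omega>" using elim by blast
        then have "\<bar>inner (J (v \<omega>)) (J (b i j \<omega>))\<bar> \<le> majorant i s \<omega> + K * majorant i s \<omega>"
          using abs_inner_le_mean[of "J (v \<omega>)" "J (b i j \<omega>)"] vx[of \<omega>] by argo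
        then show "\<bar>inner (J (v \<omega>)) (J (b i j \<omega>))\<bar> \<le> (1 + 2 * K) * majorant i s \<omega>"
          using \<open>0 \<le> K * majorant i s \<omega>\<close> by (simp add: algebra_simps)
      qed
    qed
    show "AE \<omega> in M. \<forall>j<k. \<forall>l<k. \<bar>inner (J (b i j \<omega>)) (J (b i l \<omega>))\<bar> \<le> (1 + 2 * K) * majorant i s \<omega>"
      using bjx
    proof eventually_elim
      case (elim \<omega>)
      have x0: "0 \<le> majorant i s \<omega>" using majorant_pos[OF s(1), of \<omega>] by simp
      show ?case
      proof (intro allI impI)
        fix j l assume "j < k" "l < k"
        then have "(norm (J (b i j \<omega>)))\<^sup>2 \<le> 2 * K * majorant i s \<omega>" "(norm (J (b i l \<omega>)))\<^sup>2 \<le> 2 * K * majorant i s \<omega>"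
          using elim by auto
        then have "\<bar>inner (J (b i j \<omega>)) (J (b i l \<omega>))\<bar> \<le> 2 * K * majorant i s \<omega>"
          using abs_inner_le_mean[of "J (b i j \<omega>)" "J (b i l \<omega>)"] by argo
        then show "\<bar>inner (J (b i j \<omega>)) (J (b i l \<omega>))\<bar> \<le> (1 + 2 * K) * majorant i s \<omega>"
          using x0 by (simp add: algebra_simps)
      qed
    qed
    show "AE \<omega> in M. (\<Sum>j<k. (inner (J (v \<omega>)) (J (b i j \<omega>)))\<^sup>2) \<le> 4 * K * (majorant i s \<omega>)\<^sup>2"
      using bx
    proof eventually_elim
      case (elim \<omega>)
      have "(\<Sum>j<k. (inner (J (v \<omega>)) (J (b i j \<omega>)))\<^sup>2) \<le> (\<Sum>j<k. (norm (J (v \<omega>)))\<^sup>2 * (norm (J (b i j \<omega>)))\<^sup>2)"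
        using Cauchy_Schwarz_ineq by (intro sum_mono) (simp add: power2_norm_eq_inner)
      also have "\<dots> = (norm (J (v \<omega>)))\<^sup>2 * (\<Sum>j<k. (norm (J (b i j \<omega>)))\<^sup>2)"
        by (simp add: sum_distrib_left)
      also have "\<dots> \<le> (2 * majorant i s \<omega>) * (2 * K * majorant i s \<omega>)"
        using vx elim majorant_pos[OF s(1), of \<omega>] by (intro mult_mono) (auto intro: sum_nonneg)
      also have "\<dots> = 4 * K * (majorant i s \<omega>)\<^sup>2" by (simp add: power2_eq_square)
      finally show ?case .
    qed
    show "AE \<omega> in M. (\<Sum>j<k. inner (J (b i j \<omega>)) (J (b i j \<omega>))) \<le> 2 * K * majorant i s \<omega>"
      using bx by (simp add: power2_norm_eq_inner)
  qed (use H(2) K \<delta> noise' in auto)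
qed

text \<open>Exponential growth rate of E X^N: \<open>2 * C * N\<close> comes from the factor
  \<open>(1 + 2 * C * \<delta>) ^ N\<close>, the next two terms from the trace and the sum of
  squares, and the final 1 pays for the remainder once it is at most \<delta>.\<close>

definition rate :: "nat \<Rightarrow> real" where
  "rate N = 2 * C * real N + 4 * K * real N + 32 * K * (real N)\<^sup>2 + 1"

text \<open>The resulting constant contains neither \<open>n\<close>, \<open>k\<close> nor
  \<open>a\<close>. The number of noise coordinates is felt only in \<open>small\<close>, which says
  how fine the refinement has to be.\<close>

lemma max_moment:
  assumes a: "0 < a" and q: "0 < q" "q < real N"
  defines "\<delta> \<equiv> T / real (n * a)"
  assumes small: "real k * expansion_const k N (1 + 2 * K) * (sqrt \<delta> ^ 3 * std_normal_abs_moment 3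
            + sqrt \<delta> ^ (6 + 2 * N) * std_normal_abs_moment (6 + 2 * N)) \<le> \<delta>"
  shows "(\<integral>\<^sup>+\<omega>. ennreal (Max ((\<lambda>g. fine_majorant a g \<omega>) ` {..n * a}) powr q) \<partial>M)
    \<le> ennreal (exp (rate N * T) / (1 - q / real N)) * (\<integral>\<^sup>+\<omega>. ennreal (node_energy 0 \<omega> powr q) \<partial>M)"
proof -
  define \<alpha> where "\<alpha> = q / real N"
  define \<theta> where "\<theta> = exp (rate N * \<delta>)"
  define S where "S g \<omega> = fine_majorant a g \<omega> ^ N / \<theta> ^ g" for g \<omega>
  define G where "G g = F (grid T (n * a) g)" for g
  have N: "0 < N" using q by (cases N) auto
  have \<alpha>: "0 < \<alpha>" "\<alpha> < 1" using q N by (auto simp: \<alpha>_def)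
  have \<delta>: "0 < \<delta>" using T n a by (simp add: \<delta>_def)
  have \<theta>: "0 < \<theta>" by (simp add: \<theta>_def)
  have rate: "0 \<le> rate N" using C K by (simp add: rate_def)
  have factor: "(1 + 2 * C * \<delta>) ^ N * (1 + \<delta> * (2 * real N * (2 * K) + 8 * (real N)\<^sup>2 * (4 * K))
        + real k * expansion_const k N (1 + 2 * K) * (sqrt \<delta> ^ 3 * std_normal_abs_moment 3
            + sqrt \<delta> ^ (6 + 2 * N) * std_normal_abs_moment (6 + 2 * N))) \<le> \<theta>" (is "?f ^ N * ?h \<le> \<theta>")
  proof -
    have "?f ^ N \<le> exp (2 * C * \<delta>) ^ N"
      using C \<delta> exp_ge_add_one_self[of "2 * C * \<delta>"] by (intro power_mono) auto
    moreover have "?h \<le> exp (\<delta> * (4 * K * real N + 32 * K * (real N)\<^sup>2 + 1))"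
    proof -
      have "\<delta> * (2 * real N * (2 * K) + 8 * (real N)\<^sup>2 * (4 * K)) + \<delta>
          = \<delta> * (4 * K * real N + 32 * K * (real N)\<^sup>2 + 1)" by (simp add: algebra_simps)
      with small have "?h \<le> 1 + \<delta> * (4 * K * real N + 32 * K * (real N)\<^sup>2 + 1)" by linarith
      then show ?thesis using exp_ge_add_one_self order_trans by blast
    qed
    moreover have "0 \<le> ?h"
    proof -
      have "0 \<le> expansion_const k N (1 + 2 * K)" using K by (intro expansion_const) simp
      moreover have "0 \<le> std_normal_abs_moment p" for p
        unfolding std_normal_abs_moment_def by (intro integral_nonneg_AE) simp
      ultimately show ?thesis using K \<delta> by (intro add_nonneg_nonneg mult_nonneg_nonneg) auto
    qed
    ultimately have "?f ^ N * ?h \<le> exp (2 * C * \<delta>) ^ N * exp (\<delta> * (4 * K * real N + 32 * K * (real N)\<^sup>2 + 1))"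
      by (intro mult_mono) auto
    also have "\<dots> = \<theta>"
      by (simp add: \<theta>_def rate_def algebra_simps flip: exp_of_nat_mult exp_add)
    finally show ?thesis .
  qed
  have "ennreal (1 - \<alpha>) * (\<integral>\<^sup>+\<omega>. ennreal (Max ((\<lambda>g. S g \<omega>) ` {..n * a}) powr \<alpha>) \<partial>M)
     \<le> (\<integral>\<^sup>+\<omega>. ennreal (S 0 \<omega> powr \<alpha>) \<partial>M)"
  proof (rule positive_supermartingale_maximal[where F = G])
    show "subalgebra M (G g)" if "g \<le> n * a" for g
      unfolding G_def using F_sub fine_in[OF a that] by simp
    show "S l \<in> borel_measurable (G g)" if "l \<le> g" "g \<le> n * a" for l g
    proof -
      have [measurable]: "fine_majorant a l \<in> borel_measurable (G g)" unfolding G_def by (rule fine_majorant_adapted[OF a that])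
      show ?thesis unfolding S_def[abs_def] by measurable
    qed
    show "0 < S g \<omega>" for g \<omega> using fine_majorant_pos[OF a, of g \<omega>] \<theta> by (simp add: S_def)
    fix g and H :: "'w \<Rightarrow> real" assume g: "g < n * a" and H: "H \<in> borel_measurable (G g)" "\<And>\<omega>. 0 \<le> H \<omega>"
    \<comment> \<open>The discount is deterministic, so it can be moved into the weight without
      spoiling its measurability at step \<open>g\<close>.\<close>
    define H' where "H' \<omega> = H \<omega> / \<theta> ^ Suc g" for \<omega>
    have H': "H' \<in> borel_measurable (F (grid T (n * a) g))" "\<And>\<omega>. 0 \<le> H' \<omega>"
      using H \<theta> unfolding H'_def G_def by auto
    have "(\<integral>\<^sup>+\<omega>. ennreal (H \<omega> * S (Suc g) \<omega>) \<partial>M) = (\<integral>\<^sup>+\<omega>. ennreal (H' \<omega> * fine_majorant a (Suc g) \<omega> ^ N) \<partial>M)"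
      by (simp add: H'_def S_def)
    also have "\<dots> \<le> ennreal \<theta> * (\<integral>\<^sup>+\<omega>. ennreal (H' \<omega> * fine_majorant a g \<omega> ^ N) \<partial>M)"
      using fine_majorant_moment_step[OF a g H', of N] factor unfolding \<delta>_def[symmetric]
      by (elim order_trans) (intro mult_right_mono ennreal_leI; simp)
    also have "\<dots> = (\<integral>\<^sup>+\<omega>. ennreal \<theta> * ennreal (H' \<omega> * fine_majorant a g \<omega> ^ N) \<partial>M)"
    proof (rule nn_integral_cmult[symmetric])
      have "fine_majorant a g \<in> borel_measurable M" "H' \<in> borel_measurable M"
        using fine_majorant_adapted[OF a order_refl, of g] H' g fine_in[OF a, of g]
        by (auto intro!: measurable_from_subalg[OF F_sub])
      then show "(\<lambda>\<omega>. ennreal (H' \<omega> * fine_majorant a g \<omega> ^ N)) \<in> borel_measurable M" by measurable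
    qed
    also have "\<dots> = (\<integral>\<^sup>+\<omega>. ennreal (H \<omega> * S g \<omega>) \<partial>M)"
      using \<theta> by (simp add: H'_def S_def flip: ennreal_mult')
    finally show "(\<integral>\<^sup>+\<omega>. ennreal (H \<omega> * S (Suc g) \<omega>) \<partial>M) \<le> (\<integral>\<^sup>+\<omega>. ennreal (H \<omega> * S g \<omega>) \<partial>M)" .
  qed (use \<alpha> in auto)
  moreover have "S 0 \<omega> powr \<alpha> = node_energy 0 \<omega> powr q" for \<omega>
  proof -
    have "fine_majorant a 0 \<omega> = node_energy 0 \<omega>"
      using noise_start[of 0 \<omega>] by (simp add: fine_majorant_def majorant_def grid_0)
    then show ?thesis
      using N node_energy_ge_1[of 0 \<omega>] by (simp add: S_def \<alpha>_def powr_powr flip: powr_realpow)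
  qed
  moreover have "Max ((\<lambda>g. fine_majorant a g \<omega>) ` {..n * a}) powr q
      \<le> exp (rate N * T) * Max ((\<lambda>g. S g \<omega>) ` {..n * a}) powr \<alpha>" for \<omega>
  proof -
    have "Max ((\<lambda>g. fine_majorant a g \<omega>) ` {..n * a}) \<in> (\<lambda>g. fine_majorant a g \<omega>) ` {..n * a}" by (intro Max_in) auto
    then obtain g where g: "g \<le> n * a" "Max ((\<lambda>g. fine_majorant a g \<omega>) ` {..n * a}) = fine_majorant a g \<omega>"
      by (elim imageE) (use that in simp)
    have Sg: "0 \<le> S g \<omega>" "S g \<omega> \<le> Max ((\<lambda>g. S g \<omega>) ` {..n * a})"
      using g fine_majorant_pos[OF a, of g \<omega>] \<theta> by (auto simp: S_def less_imp_le)
    have "\<theta> ^ g \<le> exp (rate N * T)"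
    proof -
      have "real g * \<delta> \<le> T" using fine_in[OF a g(1)] by (simp add: grid_def \<delta>_def)
      then have "rate N * (real g * \<delta>) \<le> rate N * T" using rate by (intro mult_left_mono)
      then show ?thesis by (simp add: \<theta>_def mult_ac flip: exp_of_nat_mult)
    qed
    \<comment> \<open>Since \<open>\<theta> ^ g\<close> is at least 1, dropping the exponent
      \<alpha> only enlarges it.\<close>
    moreover have "(\<theta> ^ g) powr \<alpha> \<le> \<theta> ^ g"
    proof -
      have "1 \<le> \<theta> ^ g" using rate \<delta> by (intro one_le_power) (simp add: \<theta>_def)
      then show ?thesis using powr_mono[of \<alpha> 1 "\<theta> ^ g"] \<alpha> by simp
    qed
    ultimately have th: "(\<theta> ^ g) powr \<alpha> \<le> exp (rate N * T)" by linarith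
    have "fine_majorant a g \<omega> powr q = (fine_majorant a g \<omega> ^ N) powr \<alpha>"
      using N fine_majorant_pos[OF a, of g \<omega>] by (simp add: \<alpha>_def powr_powr flip: powr_realpow)
    also have "\<dots> = (\<theta> ^ g * S g \<omega>) powr \<alpha>" using \<theta> by (simp add: S_def)
    also have "\<dots> = (\<theta> ^ g) powr \<alpha> * S g \<omega> powr \<alpha>" using \<theta> Sg by (simp add: powr_mult)
    also have "\<dots> \<le> exp (rate N * T) * Max ((\<lambda>g. S g \<omega>) ` {..n * a}) powr \<alpha>"
      using th Sg \<alpha> by (intro mult_mono powr_mono2) auto
    finally show ?thesis using g by simp
  qed
  then have "(\<integral>\<^sup>+\<omega>. ennreal (Max ((\<lambda>g. fine_majorant a g \<omega>) ` {..n * a}) powr q) \<partial>M)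
     \<le> (\<integral>\<^sup>+\<omega>. ennreal (exp (rate N * T)) * ennreal (Max ((\<lambda>g. S g \<omega>) ` {..n * a}) powr \<alpha>) \<partial>M)"
    by (intro nn_integral_mono) (simp add: ennreal_leI flip: ennreal_mult')
  moreover have "(\<integral>\<^sup>+\<omega>. ennreal (exp (rate N * T)) * ennreal (Max ((\<lambda>g. S g \<omega>) ` {..n * a}) powr \<alpha>) \<partial>M)
     = ennreal (exp (rate N * T)) * (\<integral>\<^sup>+\<omega>. ennreal (Max ((\<lambda>g. S g \<omega>) ` {..n * a}) powr \<alpha>) \<partial>M)"
  proof (rule nn_integral_cmult)
    have "fine_majorant a g \<in> borel_measurable M" if "g \<le> n * a" for g
      using fine_majorant_adapted[OF a order_refl that] fine_in[OF a that] by (auto intro!: measurable_from_subalg[OF F_sub])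
    then have "S g \<in> borel_measurable M" if "g \<le> n * a" for g
      using that unfolding S_def[abs_def] by (intro borel_measurable_divide borel_measurable_power) auto
    then have "(\<lambda>\<omega>. Max ((\<lambda>g. S g \<omega>) ` {..n * a})) \<in> borel_measurable M"
      by (intro borel_measurable_Max) auto
    then show "(\<lambda>\<omega>. ennreal (Max ((\<lambda>g. S g \<omega>) ` {..n * a}) powr \<alpha>)) \<in> borel_measurable M" by measurable
  qed
  ultimately have 1: "(\<integral>\<^sup>+\<omega>. ennreal (Max ((\<lambda>g. fine_majorant a g \<omega>) ` {..n * a}) powr q) \<partial>M)
     \<le> ennreal (exp (rate N * T)) * (\<integral>\<^sup>+\<omega>. ennreal (Max ((\<lambda>g. S g \<omega>) ` {..n * a}) powr \<alpha>) \<partial>M)"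
    and 2: "ennreal (1 - \<alpha>) * (\<integral>\<^sup>+\<omega>. ennreal (Max ((\<lambda>g. S g \<omega>) ` {..n * a}) powr \<alpha>) \<partial>M)
     \<le> (\<integral>\<^sup>+\<omega>. ennreal (node_energy 0 \<omega> powr q) \<partial>M)"
    by simp_all
  have c: "ennreal (exp (rate N * T)) = ennreal (exp (rate N * T) / (1 - \<alpha>)) * ennreal (1 - \<alpha>)"
    using \<alpha> by (simp flip: ennreal_mult')
  show ?thesis
    using 1 mult_left_mono[OF 2, of "ennreal (exp (rate N * T) / (1 - \<alpha>))"]
    unfolding c by (simp add: \<alpha>_def mult.assoc)
qed

end

section \<open>From the refined grids to all times\<close>

lemma norm_powr_double: "norm z powr (2 * q) = ((norm z)\<^sup>2) powr q"
  by (cases "norm z = 0") (simp_all add: powr_powr[symmetric] powr_numeral del: norm_eq_zero)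

lemma grid_cell_ex:
  assumes "0 \<le> s" "s \<le> grid T n m" "0 < m"
  shows "\<exists>i<m. s \<in> {grid T n i..grid T n (Suc i)}"
  using assms
proof (induction m)
  case (Suc m)
  show ?case
  proof (cases "0 < m \<and> s \<le> grid T n m")
    case True
    then show ?thesis using Suc less_Suc_eq by blast
  next
    case False
    then show ?thesis using Suc.prems by (intro exI[of _ m]) (auto simp: grid_0)
  qed
qed simp

lemma fine_step_tendsto_0: "(\<lambda>a. T / real (n * Suc a)) \<longlonglongrightarrow> 0"
proof -
  have "(\<lambda>a. T / real n * (1 / real (Suc a))) \<longlonglongrightarrow> T / real n * 0"
    by (intro tendsto_mult tendsto_const lim_1_over_n[THEN LIMSEQ_Suc])
  moreover have "T / real n * (1 / real (Suc a)) = T / real (n * Suc a)" for a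
    by (simp add: algebra_simps)
  ultimately show ?thesis by (simp only: mult_zero_right)
qed

context galerkin_energy
begin

text \<open>Both exponents of the square root of \<delta>, 3 and 6 + 2 N, exceed 2, so a factor
  \<delta> splits off and the rest tends to zero. Here \<open>n\<close>, \<open>k\<close> and
  \<open>N\<close> stay fixed; the refinement factor is \<open>Suc a\<close>, hence never
  zero.\<close>

lemma eventually_remainder_small:
  "\<forall>\<^sub>F a in sequentially. real k * expansion_const k N (1 + 2 * K)
      * (sqrt (T / real (n * Suc a)) ^ 3 * std_normal_abs_moment 3
        + sqrt (T / real (n * Suc a)) ^ (6 + 2 * N) * std_normal_abs_moment (6 + 2 * N)) \<le> T / real (n * Suc a)"
proof -
  define \<delta> where "\<delta> a = T / real (n * Suc a)" for a
  define h where "h a = real k * expansion_const k N (1 + 2 * K)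
      * (sqrt (\<delta> a) * std_normal_abs_moment 3 + sqrt (\<delta> a) ^ (4 + 2 * N) * std_normal_abs_moment (6 + 2 * N))" for a
  have \<delta>0: "0 \<le> \<delta> a" for a using T by (simp add: \<delta>_def)
  have "\<delta> \<longlonglongrightarrow> 0" unfolding \<delta>_def[abs_def] by (rule fine_step_tendsto_0)
  then have sq: "(\<lambda>a. sqrt (\<delta> a)) \<longlonglongrightarrow> 0" using tendsto_real_sqrt by fastforce
  have "h \<longlonglongrightarrow> real k * expansion_const k N (1 + 2 * K)
      * (0 * std_normal_abs_moment 3 + 0 ^ (4 + 2 * N) * std_normal_abs_moment (6 + 2 * N))"
    unfolding h_def by (intro tendsto_intros sq)
  then have "h \<longlonglongrightarrow> 0" by (simp add: power_add)
  then have "\<forall>\<^sub>F a in sequentially. h a < 1" by (rule order_tendstoD) simp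
  then show ?thesis
  proof eventually_elim
    case (elim a)
    have s3: "sqrt (\<delta> a) ^ 3 = \<delta> a * sqrt (\<delta> a)" using \<delta>0[of a] by (simp add: power3_eq_cube)
    have "sqrt (\<delta> a) ^ (6 + 2 * N) = (sqrt (\<delta> a))\<^sup>2 * sqrt (\<delta> a) ^ (4 + 2 * N)"
      by (simp only: power_add[symmetric]) simp
    then have sL: "sqrt (\<delta> a) ^ (6 + 2 * N) = \<delta> a * sqrt (\<delta> a) ^ (4 + 2 * N)" using \<delta>0[of a] by simp
    have "real k * expansion_const k N (1 + 2 * K) * (sqrt (\<delta> a) ^ 3 * std_normal_abs_moment 3
        + sqrt (\<delta> a) ^ (6 + 2 * N) * std_normal_abs_moment (6 + 2 * N)) = \<delta> a * h a"
      unfolding s3 sL h_def by (simp add: distrib_left mult_ac)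
    also have "\<dots> \<le> \<delta> a * 1" using elim \<delta>0[of a] by (intro mult_left_mono) auto
    finally show ?case by (simp add: \<delta>_def)
  qed
qed

text \<open>Path continuity is available on each closed cell, so the approximating nodes must not
  leave the cell of \<open>s\<close>. Rounding \<open>s\<close> down ensures this: the left end of
  the cell is a node of every refinement.\<close>

lemma fine_grid_approx:
  assumes "i < n" "s \<in> {grid T n i..grid T n (Suc i)}"
  obtains g where "\<And>a. g a \<le> n * Suc a"
    and "\<And>a. grid T (n * Suc a) (g a) \<in> {grid T n i..grid T n (Suc i)}"
    and "(\<lambda>a. grid T (n * Suc a) (g a)) \<longlonglongrightarrow> s"
proof -
  define g where "g a = nat \<lfloor>s / (T / real (n * Suc a))\<rfloor>" for a
  define \<delta> where "\<delta> a = T / real (n * Suc a)" for a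
  have \<delta>: "0 < \<delta> a" for a
    unfolding \<delta>_def using T n by (intro divide_pos_pos) (auto simp del: of_nat_mult of_nat_Suc mult_Suc_right)
  have gr: "grid T (n * Suc a) l = real l * \<delta> a" for a l by (simp add: grid_def \<delta>_def)
  have "s \<in> {0..T}"
    using assms(2) grid_bounds[of i] grid_bounds[of "Suc i"] assms(1) by auto
  then have s: "0 \<le> s / \<delta> a" "s \<le> T" for a using \<delta>[of a] by auto
  have g: "real (g a) \<le> s / \<delta> a" "s / \<delta> a < real (g a) + 1" for a
  proof -
    have "real (g a) = real_of_int \<lfloor>s / \<delta> a\<rfloor>"
      using s(1)[of a] unfolding g_def \<delta>_def[symmetric] by simp
    then show "real (g a) \<le> s / \<delta> a" "s / \<delta> a < real (g a) + 1"
      using floor_correct[of "s / \<delta> a"] by auto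
  qed
  have up: "real (g a) * \<delta> a \<le> s" for a using g(1)[of a] \<delta>[of a] by (simp add: le_divide_eq)
  have lo: "s - \<delta> a \<le> real (g a) * \<delta> a" for a
    using g(2)[of a] \<delta>[of a] by (simp add: divide_less_eq algebra_simps)
  have g1: "g a \<le> n * Suc a" for a
  proof -
    have "real (n * Suc a) * \<delta> a = T"
      using n by (simp add: \<delta>_def del: of_nat_mult of_nat_Suc mult_Suc_right)
    then have "s \<le> real (n * Suc a) * \<delta> a" using s(2) by simp
    then have "real (g a) * \<delta> a \<le> real (n * Suc a) * \<delta> a" using up[of a] by linarith
    then have "real (g a) \<le> real (n * Suc a)" using \<delta>[of a] by (rule mult_right_le_imp_le)
    then show ?thesis by (simp only: of_nat_le_iff)
  qed
  have g2: "grid T (n * Suc a) (g a) \<in> {grid T n i..grid T n (Suc i)}" for a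
  proof -
    have i: "grid T n i = real (i * Suc a) * \<delta> a"
      using grid_fine[of "Suc a" T n i] gr[of a "i * Suc a"] by simp
    have "real (i * Suc a) \<le> s / \<delta> a" using assms(2) \<delta>[of a] i by (simp add: le_divide_eq)
    then have "i * Suc a \<le> g a" unfolding g_def \<delta>_def[symmetric] by (rule le_nat_floor)
    then have "grid T n i \<le> grid T (n * Suc a) (g a)"
      using grid_mono[OF T, of "i * Suc a" "g a" "n * Suc a"] grid_fine[of "Suc a" T n i] by simp
    then show ?thesis using up[of a] assms(2) unfolding gr by auto
  qed
  have \<delta>0: "\<delta> \<longlonglongrightarrow> 0" unfolding \<delta>_def[abs_def] by (rule fine_step_tendsto_0)
  have g3: "(\<lambda>a. grid T (n * Suc a) (g a)) \<longlonglongrightarrow> s"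
    unfolding gr
  proof (rule tendsto_sandwich)
    show "(\<lambda>a. s - \<delta> a) \<longlonglongrightarrow> s" using tendsto_diff[OF tendsto_const \<delta>0, of s] by simp
    show "\<forall>\<^sub>F a in sequentially. s - \<delta> a \<le> real (g a) * \<delta> a" using lo by (intro always_eventually allI)
    show "\<forall>\<^sub>F a in sequentially. real (g a) * \<delta> a \<le> s" using up by (intro always_eventually allI)
  qed (rule tendsto_const)
  from that[OF g1 g2 g3] show thesis .
qed

text \<open>The supremum over uncountably many times is compared with \<open>liminf Y\<close> by
  monotonicity of the nonnegative integral, and Fatou's lemma is applied to the measurable maxima
  \<open>Y a\<close>. The passage to the limsup uses that the moment bound holds for all large
  refinements.\<close>

lemma sup_moment:
  assumes q: "0 < q" "q < real N"
  shows "(\<integral>\<^sup>+\<omega>. (SUP s\<in>{0..T}. ennreal (norm (J (u s \<omega>)) powr (2 * q))) \<partial>M)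
    \<le> ennreal (exp (rate N * T) / (1 - q / real N)) * (\<integral>\<^sup>+\<omega>. ennreal (node_energy 0 \<omega> powr q) \<partial>M)"
proof -
  define Y where "Y a \<omega> = ennreal (Max ((\<lambda>g. fine_majorant (Suc a) g \<omega>) ` {..n * Suc a}) powr q)" for a \<omega>
  have Y_meas: "Y a \<in> borel_measurable M" for a
  proof -
    have "fine_majorant (Suc a) g \<in> borel_measurable M" if "g \<le> n * Suc a" for g
      using fine_majorant_adapted[OF _ order_refl that] fine_in[OF _ that] by (auto intro!: measurable_from_subalg[OF F_sub])
    then have "(\<lambda>\<omega>. Max ((\<lambda>g. fine_majorant (Suc a) g \<omega>) ` {..n * Suc a})) \<in> borel_measurable M"
      by (intro borel_measurable_Max) auto
    then show ?thesis unfolding Y_def[abs_def] by measurable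
  qed
  have "AE \<omega> in M. \<forall>a. \<forall>g\<le>n * Suc a. (norm (J (u (grid T (n * Suc a) g) \<omega>)))\<^sup>2 \<le> fine_majorant (Suc a) g \<omega>"
    by (rule AE_all_countable[THEN iffD2]) (intro allI norm_le_fine_majorant zero_less_Suc)
  then have "AE \<omega> in M. (SUP s\<in>{0..T}. ennreal (norm (J (u s \<omega>)) powr (2 * q))) \<le> liminf (\<lambda>a. Y a \<omega>)"
    using cont
  proof eventually_elim
    case (elim \<omega>)
    show ?case
    proof (rule SUP_least)
      fix s assume s: "s \<in> {0..T}"
      obtain i where i: "i < n" "s \<in> {grid T n i..grid T n (Suc i)}"
        using grid_cell_ex[of s T n n] s grid_n[OF n] n by auto
      obtain g where g: "\<And>a. g a \<le> n * Suc a"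
        "\<And>a. grid T (n * Suc a) (g a) \<in> {grid T n i..grid T n (Suc i)}"
        "(\<lambda>a. grid T (n * Suc a) (g a)) \<longlonglongrightarrow> s"
        using fine_grid_approx[OF i] by blast
      have "(\<lambda>a. J (u (grid T (n * Suc a) (g a)) \<omega>)) \<longlonglongrightarrow> J (u s \<omega>)"
      proof (rule continuous_on_tendsto_compose[where f = "\<lambda>s. J (u s \<omega>)"])
        show "continuous_on {grid T n i..grid T n (Suc i)} (\<lambda>s. J (u s \<omega>))" using elim(2) i by blast
        show "\<forall>\<^sub>F a in sequentially. grid T (n * Suc a) (g a) \<in> {grid T n i..grid T n (Suc i)}"
          using g(2) by (intro always_eventually allI)
      qed fact+
      then have "(\<lambda>a. norm (J (u (grid T (n * Suc a) (g a)) \<omega>)) powr (2 * q)) \<longlonglongrightarrow> norm (J (u s \<omega>)) powr (2 * q)"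
        using q by (intro tendsto_powr' tendsto_norm tendsto_const) auto
      then have "(\<lambda>a. ennreal (norm (J (u (grid T (n * Suc a) (g a)) \<omega>)) powr (2 * q)))
          \<longlonglongrightarrow> ennreal (norm (J (u s \<omega>)) powr (2 * q))"
        by (rule tendsto_ennrealI)
      then have "ennreal (norm (J (u s \<omega>)) powr (2 * q))
          = liminf (\<lambda>a. ennreal (norm (J (u (grid T (n * Suc a) (g a)) \<omega>)) powr (2 * q)))"
        by (intro lim_imp_Liminf[symmetric] trivial_limit_sequentially)
      also have "\<dots> \<le> liminf (\<lambda>a. Y a \<omega>)"
      proof (intro Liminf_mono always_eventually allI)
        fix a
        have "(norm (J (u (grid T (n * Suc a) (g a)) \<omega>)))\<^sup>2 \<le> fine_majorant (Suc a) (g a) \<omega>" using elim(1) g(1) by blast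
        also have "\<dots> \<le> Max ((\<lambda>g. fine_majorant (Suc a) g \<omega>) ` {..n * Suc a})" using g(1)[of a] by (intro Max_ge) auto
        finally show "ennreal (norm (J (u (grid T (n * Suc a) (g a)) \<omega>)) powr (2 * q)) \<le> Y a \<omega>"
          unfolding Y_def norm_powr_double using q by (intro ennreal_leI powr_mono2) auto
      qed
      finally show "ennreal (norm (J (u s \<omega>)) powr (2 * q)) \<le> liminf (\<lambda>a. Y a \<omega>)" .
    qed
  qed
  then have "(\<integral>\<^sup>+\<omega>. (SUP s\<in>{0..T}. ennreal (norm (J (u s \<omega>)) powr (2 * q))) \<partial>M)
      \<le> (\<integral>\<^sup>+\<omega>. liminf (\<lambda>a. Y a \<omega>) \<partial>M)"
    by (rule nn_integral_mono_AE)
  also have "\<dots> \<le> liminf (\<lambda>a. \<integral>\<^sup>+\<omega>. Y a \<omega> \<partial>M)"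
    using Y_meas by (rule nn_integral_liminf)
  also have "\<dots> \<le> limsup (\<lambda>a. \<integral>\<^sup>+\<omega>. Y a \<omega> \<partial>M)" by (rule Liminf_le_Limsup) simp
  also have "\<dots> \<le> ennreal (exp (rate N * T) / (1 - q / real N)) * (\<integral>\<^sup>+\<omega>. ennreal (node_energy 0 \<omega> powr q) \<partial>M)"
  proof (rule Limsup_bounded)
    show "\<forall>\<^sub>F a in sequentially. (\<integral>\<^sup>+\<omega>. Y a \<omega> \<partial>M)
        \<le> ennreal (exp (rate N * T) / (1 - q / real N)) * (\<integral>\<^sup>+\<omega>. ennreal (node_energy 0 \<omega> powr q) \<partial>M)"
      using eventually_remainder_small[of N]
      by eventually_elim (unfold Y_def, rule max_moment[OF zero_less_Suc q])
  qed
  finally show ?thesis .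
qed

text \<open>At the terminal node the majorant contains the cost of all cells, so the same maximum
  bounds it. One sufficiently fine refinement is enough; no limit is taken.\<close>

lemma cost_moment:
  assumes q: "0 < q" "q < real N"
  shows "(\<integral>\<^sup>+\<omega>. ennreal ((\<nu> * (T / real n) * (\<Sum>l<n. sq l \<omega>)) powr q) \<partial>M)
    \<le> ennreal (exp (rate N * T) / (1 - q / real N)) * (\<integral>\<^sup>+\<omega>. ennreal (node_energy 0 \<omega> powr q) \<partial>M)"
proof -
  obtain a where a: "real k * expansion_const k N (1 + 2 * K)
      * (sqrt (T / real (n * Suc a)) ^ 3 * std_normal_abs_moment 3
        + sqrt (T / real (n * Suc a)) ^ (6 + 2 * N) * std_normal_abs_moment (6 + 2 * N)) \<le> T / real (n * Suc a)"
    using eventually_happens'[OF sequentially_bot eventually_remainder_small[of N]] by blast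
  have "(\<nu> * (T / real n) * (\<Sum>l<n. sq l \<omega>)) powr q
      \<le> Max ((\<lambda>g. fine_majorant (Suc a) g \<omega>) ` {..n * Suc a}) powr q" for \<omega>
  proof (intro powr_mono2)
    have "n * Suc a div Suc a = n" by (rule nonzero_mult_div_cancel_right) simp
    then have "fine_majorant (Suc a) (n * Suc a) \<omega> = majorant n (grid T n n) \<omega>"
      using grid_fine[of "Suc a" T n n] unfolding fine_majorant_def by (simp only:)
    then have "\<nu> * (T / real n) * (\<Sum>l<n. sq l \<omega>) \<le> fine_majorant (Suc a) (n * Suc a) \<omega>"
      using majorant_lower(2)[OF order_refl, of \<omega> n] by simp
    also have "\<dots> \<le> Max ((\<lambda>g. fine_majorant (Suc a) g \<omega>) ` {..n * Suc a})" by (intro Max_ge) auto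
    finally show "\<nu> * (T / real n) * (\<Sum>l<n. sq l \<omega>) \<le> Max ((\<lambda>g. fine_majorant (Suc a) g \<omega>) ` {..n * Suc a})" .
  qed (use q cost_nonneg in auto)
  then have "(\<integral>\<^sup>+\<omega>. ennreal ((\<nu> * (T / real n) * (\<Sum>l<n. sq l \<omega>)) powr q) \<partial>M)
    \<le> (\<integral>\<^sup>+\<omega>. ennreal (Max ((\<lambda>g. fine_majorant (Suc a) g \<omega>) ` {..n * Suc a}) powr q) \<partial>M)"
    by (intro nn_integral_mono ennreal_leI)
  also note max_moment[OF zero_less_Suc q a]
  finally show ?thesis .
qed

lemma initial_moment:
  assumes q: "0 < q"
  shows "(\<integral>\<^sup>+\<omega>. ennreal (node_energy 0 \<omega> powr q) \<partial>M)
    \<le> ennreal (2 powr q) * (1 + (\<integral>\<^sup>+\<omega>. ennreal (norm (J (u 0 \<omega>)) powr (2 * q)) \<partial>M))"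
proof -
  have le: "node_energy 0 \<omega> powr q \<le> 2 powr q * (1 + norm (J (u 0 \<omega>)) powr (2 * q))" for \<omega>
  proof -
    define z where "z = (norm (J (u 0 \<omega>)))\<^sup>2"
    have z: "0 \<le> z" by (simp add: z_def)
    have "(1 + z) powr q \<le> (2 * max 1 z) powr q" using z q by (intro powr_mono2) auto
    also have "\<dots> = 2 powr q * max 1 z powr q" using z by (simp add: powr_mult)
    also have "max 1 z powr q \<le> 1 + z powr q" by (simp add: max_def)
    finally show ?thesis by (simp add: node_energy_def z_def norm_powr_double grid_0)
  qed
  have [measurable]: "(\<lambda>\<omega>. ennreal (norm (J (u 0 \<omega>)) powr (2 * q))) \<in> borel_measurable M"
  proof -
    have "u 0 \<in> borel_measurable M" using u_adapted[of 0] F_sub[of 0] T by (auto intro: measurable_from_subalg)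
    then have "(\<lambda>\<omega>. (norm (J (u 0 \<omega>)))\<^sup>2) \<in> borel_measurable M"
      unfolding power2_norm_eq_inner by (intro borel_measurable_inner_blinfun)
    then show ?thesis unfolding norm_powr_double by measurable
  qed
  have "(\<integral>\<^sup>+\<omega>. ennreal (node_energy 0 \<omega> powr q) \<partial>M)
     \<le> (\<integral>\<^sup>+\<omega>. ennreal (2 powr q) * (1 + ennreal (norm (J (u 0 \<omega>)) powr (2 * q))) \<partial>M)"
    using le by (intro nn_integral_mono) (simp add: ennreal_leI flip: ennreal_1 ennreal_plus ennreal_mult')
  also have "\<dots> = ennreal (2 powr q) * (\<integral>\<^sup>+\<omega>. 1 + ennreal (norm (J (u 0 \<omega>)) powr (2 * q)) \<partial>M)"
    by (rule nn_integral_cmult) measurable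
  also have "(\<integral>\<^sup>+\<omega>. 1 + ennreal (norm (J (u 0 \<omega>)) powr (2 * q)) \<partial>M)
     = (\<integral>\<^sup>+\<omega>. 1 \<partial>M) + (\<integral>\<^sup>+\<omega>. ennreal (norm (J (u 0 \<omega>)) powr (2 * q)) \<partial>M)"
    by (rule nn_integral_add) measurable
  also have "(\<integral>\<^sup>+\<omega>. 1 \<partial>M) = 1" by (simp add: emeasure_space_1)
  finally show ?thesis .
qed

end

section \<open>The estimate for the scheme\<close>

text \<open>The almost sure operator bounds hold for all \<open>v\<close> outside a single null set,
  so they may be evaluated at the random node values.\<close>

lemma scheme_galerkin_energy:
  fixes M :: "'w measure" and W :: "real \<Rightarrow> 'u::{real_inner, banach, second_countable_topology} \<Rightarrow> 'w \<Rightarrow> real"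
    and j1 :: "'a::{banach, second_countable_topology} \<Rightarrow>\<^sub>L 'h::{real_inner, banach}"
    and j2 :: "'b::{banach, second_countable_topology} \<Rightarrow>\<^sub>L 'h"
    and i1 :: "'v::{banach, second_countable_topology} \<Rightarrow>\<^sub>L 'a" and i2 :: "'v \<Rightarrow>\<^sub>L 'b"
  assumes pos: "0 < T" "0 < K" "0 < \<mu>" "0 < n"
    and M: "prob_space M" and filt: "filtration_on M T F" and W: "cylindrical_wiener M T F W"
    and setting: "intersection_setting e1 e2 j1 j2 i1 i2" and chi: "orthonormal_basis chi"
    and meas: "op_measurability chi M (F 0) A1 B1" "op_measurability chi M (F 0) A2 B2"
    and coer: "op_coercivity K \<mu> chi M j1 j2 A1 A2 B1 B2"
    and growth: "op_growth K p chi M j1 i1 i2 A1 A2 B1 B2"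
    and gal: "galerkin_scheme Vm" and pr: "projection_assumption j1 i1 i2 Vm Pr \<cc>"
    and u0: "\<forall>\<omega>\<in>space M. u 0 \<omega> \<in> Vm m"
    and scheme: "is_scheme M T F W chi j1 i1 i2 A1 A2 B1 B2 (Pr m) n k u"
    and cc: "\<cc> m * (T / real n) \<le> \<mu> / (8 * K)"
  shows "galerkin_energy M T F W chi n k (j1 o\<^sub>L i1) u
    (\<lambda>i j \<omega>. scheme_diffusion j1 i1 i2 B1 B2 (Pr m) (u (grid T n i) \<omega>) \<omega> (chi j))
    (\<lambda>i \<omega>. (norm (i1 (u (grid T n i) \<omega>)))\<^sup>2) K (\<mu> / 2) (2 * K + \<mu> / 2 + 4 * T)"
proof -
  let ?b = "\<lambda>i j \<omega>. scheme_diffusion j1 i1 i2 B1 B2 (Pr m) (u (grid T n i) \<omega>) \<omega> (chi j)"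
  let ?noise = "\<lambda>i s \<omega>. \<Sum>j<k. (W s (chi j) \<omega> - W (grid T n i) (chi j) \<omega>) *\<^sub>R ?b i j \<omega>"
  let ?drift = "\<lambda>i \<omega>. scheme_drift j1 i1 i2 A1 A2 (Pr m) n (u (grid T n i) \<omega>) \<omega>"
  have u_adapted: "u t \<in> borel_measurable (F t)" if "t \<in> {0..T}" for t
    using scheme that unfolding is_scheme_def by blast
  have AE_scheme: "AE \<omega> in M. \<forall>t\<in>{0..T}. u t \<omega> = u 0 \<omega>
      + (LINT s:{0..t}|lborel. scheme_drift j1 i1 i2 A1 A2 (Pr m) n (u (kappa T n s) \<omega>) \<omega>)
      + step_ito_integral T n k chi W
          (\<lambda>s \<omega>. scheme_diffusion j1 i1 i2 B1 B2 (Pr m) (u (kappa T n s) \<omega>) \<omega>) t \<omega>"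
    using scheme unfolding is_scheme_def by (elim conjE)
  \<comment> \<open>Inside a cell the coefficients are frozen at the left node. This formula is the
    source of both the energy inequality and the path continuity below.\<close>
  have cell: "AE \<omega> in M. \<forall>i<n. u (grid T n i) \<omega> \<in> Vm m \<and> (\<forall>s\<in>{grid T n i..grid T n (Suc i)}.
      u s \<omega> = u (grid T n i) \<omega> + (s - grid T n i) *\<^sub>R ?drift i \<omega> + ?noise i s \<omega>)"
    using AE_scheme AE_space
  proof eventually_elim
    case (elim \<omega>)
    let ?d = "\<lambda>r. scheme_drift j1 i1 i2 A1 A2 (Pr m) n (u r \<omega>) \<omega>"
    let ?\<Phi> = "\<lambda>r \<omega>. scheme_diffusion j1 i1 i2 B1 B2 (Pr m) (u r \<omega>) \<omega>"
    have eq: "\<forall>t\<in>{0..T}. u t \<omega> = u 0 \<omega> + (LINT r:{0..t}|lborel. ?d (kappa T n r))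
          + step_ito_integral T n k chi W (\<lambda>r \<omega>. ?\<Phi> (kappa T n r) \<omega>) t \<omega>"
      using elim(1) .
    have sub: "subspace (Vm m)"
    proof -
      obtain B where "Vm m = span B" using gal unfolding galerkin_scheme_def by blast
      then show ?thesis by simp
    qed
    show ?case
    proof (intro allI impI conjI ballI)
      fix i assume i: "i < n"
      show "u (grid T n i) \<omega> \<in> Vm m"
      proof (rule scheme_in_subspace[where u = u and \<omega> = \<omega> and W = W and chi = chi and k = k and d = ?d and \<Phi> = ?\<Phi>,
            OF pos(1,4) less_imp_le[OF i] sub _ _ _ eq])
        show "u 0 \<omega> \<in> Vm m" using u0 elim(2) by blast
        show "?d r \<in> Vm m" for r unfolding scheme_drift_def by (rule projection_in[OF pr])
        show "?\<Phi> r \<omega> g \<in> Vm m" for r g unfolding scheme_diffusion_def by (rule projection_in[OF pr])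
      qed
      fix s assume "s \<in> {grid T n i..grid T n (Suc i)}"
      then have s: "grid T n i \<le> s" "s \<le> grid T n (Suc i)" by auto
      show "u s \<omega> = u (grid T n i) \<omega> + (s - grid T n i) *\<^sub>R ?drift i \<omega> + ?noise i s \<omega>"
        by (rule scheme_cell[where u = u and \<omega> = \<omega> and W = W and chi = chi and k = k and d = ?d and \<Phi> = ?\<Phi>,
            OF pos(1,4) i s eq])
    qed
  qed
  show ?thesis
  proof (intro galerkin_energy.intro galerkin_energy_axioms.intro)
    show "?b i j \<in> borel_measurable (F (grid T n i))" if "i < n" for i j
      using scheme that unfolding is_scheme_def by blast
    show "(\<lambda>\<omega>. (norm (i1 (u (grid T n i) \<omega>)))\<^sup>2) \<in> borel_measurable (F (grid T n i))" if "i < n" for i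
    proof (rule measurable_compose[where g = "\<lambda>v. (norm (i1 v))\<^sup>2"])
      show "u (grid T n i) \<in> borel_measurable (F (grid T n i))"
        using grid_in[OF pos(1) less_imp_le[OF that] pos(4)] by (rule u_adapted)
      show "(\<lambda>v. (norm (i1 v))\<^sup>2) \<in> borel_measurable borel"
        by (intro borel_measurable_continuous_onI continuous_intros)
    qed
    show "AE \<omega> in M. \<forall>i<n. (\<Sum>j<k. (norm ((j1 o\<^sub>L i1) (?b i j \<omega>)))\<^sup>2)
        \<le> K * (1 + (norm ((j1 o\<^sub>L i1) (u (grid T n i) \<omega>)))\<^sup>2)"
    proof -
      have "AE \<omega> in M. \<forall>v. (hs_norm chi (B_sum i1 i2 B1 B2 v \<omega>))\<^sup>2 \<le> K * (1 + (norm (j1 (i1 v)))\<^sup>2)"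
        using growth unfolding op_growth_def by blast
      then show ?thesis
        using AE_space
      proof eventually_elim
        case (elim \<omega>)
        show ?case
        proof (intro allI impI)
          fix i
          let ?v = "u (grid T n i) \<omega>"
          have hs: "hilbert_schmidt chi (B_sum i1 i2 B1 B2 ?v \<omega>)"
            unfolding B_sum_def using meas elim(2) by (intro hilbert_schmidt_add) (auto simp: op_measurability_def)
          \<comment> \<open>The projection does not increase the norm of \<open>H\<close>, so the
            Hilbert-Schmidt bound passes from the full diffusion to the projected one.\<close>
          have "norm (j1 (i1 (?b i j \<omega>))) \<le> norm (B_sum i1 i2 B1 B2 ?v \<omega> (chi j))" for j
            using pr unfolding projection_assumption_def Let_def scheme_diffusion_def by simp
          then have "(\<Sum>j<k. (norm ((j1 o\<^sub>L i1) (?b i j \<omega>)))\<^sup>2) \<le> (\<Sum>j<k. (norm (B_sum i1 i2 B1 B2 ?v \<omega> (chi j)))\<^sup>2)"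
            by (intro sum_mono power_mono) auto
          also have "\<dots> \<le> (hs_norm chi (B_sum i1 i2 B1 B2 ?v \<omega>))\<^sup>2" by (rule hs_norm_partial_sum_le[OF hs])
          also have "\<dots> \<le> K * (1 + (norm (j1 (i1 ?v)))\<^sup>2)" using elim(1) by blast
          finally show "(\<Sum>j<k. (norm ((j1 o\<^sub>L i1) (?b i j \<omega>)))\<^sup>2) \<le> K * (1 + (norm ((j1 o\<^sub>L i1) ?v))\<^sup>2)" by simp
        qed
      qed
    qed
    show "AE \<omega> in M. \<forall>i<n. \<forall>s\<in>{grid T n i..grid T n (Suc i)}.
      (norm ((j1 o\<^sub>L i1) (u s \<omega>)))\<^sup>2 + \<mu> / 2 * (s - grid T n i) * (norm (i1 (u (grid T n i) \<omega>)))\<^sup>2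
      \<le> (norm ((j1 o\<^sub>L i1) (u (grid T n i) \<omega>)))\<^sup>2
        + (2 * K + \<mu> / 2 + 4 * T) * (s - grid T n i) * (1 + (norm ((j1 o\<^sub>L i1) (u (grid T n i) \<omega>)))\<^sup>2)
        + 2 * inner ((j1 o\<^sub>L i1) (u (grid T n i) \<omega>)) ((j1 o\<^sub>L i1) (?noise i s \<omega>))
        + 2 * (norm ((j1 o\<^sub>L i1) (?noise i s \<omega>)))\<^sup>2"
    proof -
      have "AE \<omega> in M. \<forall>v. 2 * A1 v \<omega> v + (hs_norm chi (B1 v \<omega>))\<^sup>2
              \<le> - \<mu> * (norm v)\<^sup>2 + K * (1 + (norm (j1 v))\<^sup>2)"
        "AE \<omega> in M. \<forall>v. 2 * A2 v \<omega> v + (hs_norm chi (B2 v \<omega>))\<^sup>2 \<le> K * (1 + (norm (j2 v))\<^sup>2)"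
        "AE \<omega> in M. \<forall>v. (norm (A1 v \<omega>))\<^sup>2 \<le> K * (1 + (norm v)\<^sup>2)"
        using coer growth unfolding op_coercivity_def op_growth_def by blast+
      then show ?thesis
        using cell
      proof eventually_elim
        case (elim \<omega>)
        show ?case
        proof (intro allI impI ballI)
          fix i s assume i: "i < n" and s: "s \<in> {grid T n i..grid T n (Suc i)}"
          let ?v = "u (grid T n i) \<omega>"
          have v: "?v \<in> Vm m" using elim(4) i by blast
          have j: "j1 (i1 ?v) = j2 (i2 ?v)" using setting unfolding intersection_setting_def by blast
          have c1: "2 * A1 (i1 ?v) \<omega> (i1 ?v) + (hs_norm chi (B1 (i1 ?v) \<omega>))\<^sup>2
              \<le> - \<mu> * (norm (i1 ?v))\<^sup>2 + K * (1 + (norm (j1 (i1 ?v)))\<^sup>2)" using elim(1) by blast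
          have c2: "2 * A2 (i2 ?v) \<omega> (i2 ?v) + (hs_norm chi (B2 (i2 ?v) \<omega>))\<^sup>2
              \<le> K * (1 + (norm (j2 (i2 ?v)))\<^sup>2)" using elim(2) by blast
          have c3: "(norm (A1 (i1 ?v) \<omega>))\<^sup>2 \<le> K * (1 + (norm (i1 ?v))\<^sup>2)" using elim(3) by blast
          have h: "0 \<le> s - grid T n i" "s - grid T n i \<le> T / real n" using s by (auto simp: grid_Suc)
          have eq: "u s \<omega> = ?v + (s - grid T n i) *\<^sub>R ?drift i \<omega> + ?noise i s \<omega>"
            using elim(4) i s by blast
          have "(j1 o\<^sub>L i1) (u s \<omega>) = j1 (i1 ?v) + (s - grid T n i) *\<^sub>R j1 (i1 (?drift i \<omega>)) + (j1 o\<^sub>L i1) (?noise i s \<omega>)"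
            unfolding eq by (simp add: blinfun.add_right blinfun.scaleR_right)
          then show "(norm ((j1 o\<^sub>L i1) (u s \<omega>)))\<^sup>2 + \<mu> / 2 * (s - grid T n i) * (norm (i1 ?v))\<^sup>2
            \<le> (norm ((j1 o\<^sub>L i1) ?v))\<^sup>2
              + (2 * K + \<mu> / 2 + 4 * T) * (s - grid T n i) * (1 + (norm ((j1 o\<^sub>L i1) ?v))\<^sup>2)
              + 2 * inner ((j1 o\<^sub>L i1) ?v) ((j1 o\<^sub>L i1) (?noise i s \<omega>))
              + 2 * (norm ((j1 o\<^sub>L i1) (?noise i s \<omega>)))\<^sup>2"
            using scheme_drift_energy[where ?A1.0 = A1 and ?A2.0 = A2 and ?B1.0 = B1 and ?B2.0 = B2 and \<omega> = \<omega> and v = ?v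
                and y = "(j1 o\<^sub>L i1) (?noise i s \<omega>)"
                and ?j2.0 = j2 and ?j1.0 = j1 and ?i1.0 = i1 and ?i2.0 = i2 and chi = chi and \<mu> = \<mu> and K = K,
                OF pr v j c1 c2 c3 cc pos(4,1,2,3) h]
            by simp
        qed
      qed
    qed
    show "AE \<omega> in M. \<forall>i<n. continuous_on {grid T n i..grid T n (Suc i)} (\<lambda>s. (j1 o\<^sub>L i1) (u s \<omega>))"
    proof -
      \<comment> \<open>The directions \<open>chi j\<close> are countably many, so one null set
        serves for all of them.\<close>
      have "AE \<omega> in M. \<forall>j. continuous_on {0..T} (\<lambda>t. W t (chi j) \<omega>)"
        unfolding AE_all_countable using W unfolding cylindrical_wiener_def by blast
      then show ?thesis
        using cell
      proof eventually_elim
        case (elim \<omega>)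
        show ?case
        proof (intro allI impI)
          fix i assume i: "i < n"
          have "{grid T n i..grid T n (Suc i)} \<subseteq> {0..T}"
            using grid_in[OF pos(1) _ pos(4), of i] grid_in[OF pos(1) _ pos(4), of "Suc i"] i by auto
          then have Wc: "continuous_on {grid T n i..grid T n (Suc i)} (\<lambda>t. W t (chi j) \<omega>)" for j
            using elim(1) continuous_on_subset by blast
          have term_cont: "continuous_on {grid T n i..grid T n (Suc i)}
              (\<lambda>s. (W s (chi j) \<omega> - W (grid T n i) (chi j) \<omega>) *\<^sub>R ?b i j \<omega>)" for j
            by (rule continuous_on_scaleR[OF continuous_on_diff[OF Wc continuous_on_const] continuous_on_const])
          have "continuous_on {grid T n i..grid T n (Suc i)} (\<lambda>s. ?noise i s \<omega>)"
            by (rule continuous_on_sum) (rule term_cont)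
          moreover have "continuous_on {grid T n i..grid T n (Suc i)}
              (\<lambda>s. u (grid T n i) \<omega> + (s - grid T n i) *\<^sub>R ?drift i \<omega>)"
            by (intro continuous_on_add continuous_on_const continuous_on_scaleR continuous_on_diff continuous_on_id)
          ultimately have "continuous_on {grid T n i..grid T n (Suc i)}
             (\<lambda>s. u (grid T n i) \<omega> + (s - grid T n i) *\<^sub>R ?drift i \<omega> + ?noise i s \<omega>)"
            by (auto intro: continuous_on_add)
          moreover have "u (grid T n i) \<omega> + (s - grid T n i) *\<^sub>R ?drift i \<omega> + ?noise i s \<omega> = u s \<omega>"
            if s: "s \<in> {grid T n i..grid T n (Suc i)}" for s
            by (rule elim(2)[rule_format, OF i, THEN conjunct2, rule_format, OF s, symmetric])
          ultimately have u_cont: "continuous_on {grid T n i..grid T n (Suc i)} (\<lambda>s. u s \<omega>)"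
            by (rule continuous_on_eq)
          have J_cont: "continuous_on UNIV (blinfun_apply (j1 o\<^sub>L i1))"
            by (rule linear_continuous_on[OF blinfun.bounded_linear_right])
          show "continuous_on {grid T n i..grid T n (Suc i)} (\<lambda>s. (j1 o\<^sub>L i1) (u s \<omega>))"
            by (rule continuous_on_compose2[OF J_cont u_cont subset_UNIV])
        qed
      qed
    qed
  qed (use pos M filt W chi u_adapted in auto)
qed

theorem theorem3p3:
  fixes T K p \<mu> q e1 e2 :: real
  assumes "T > 0" and "K > 0" and "p \<ge> 2" and "\<mu> > 0" and "q \<ge> 1"
  shows "\<exists>\<epsilon>>0. \<exists>c>0.
    \<forall>(M :: 'w measure) (F :: real \<Rightarrow> 'w measure)
     (W :: real \<Rightarrow> 'u::{real_inner, banach, second_countable_topology} \<Rightarrow> 'w \<Rightarrow> real)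
     (chi :: nat \<Rightarrow> 'u)
     (j1 :: 'a::{banach, second_countable_topology} \<Rightarrow>\<^sub>L 'h::{real_inner, banach})
     (j2 :: 'b::{banach, second_countable_topology} \<Rightarrow>\<^sub>L 'h)
     (i1 :: 'v::{banach, second_countable_topology} \<Rightarrow>\<^sub>L 'a) (i2 :: 'v \<Rightarrow>\<^sub>L 'b)
     (A1 :: 'a \<Rightarrow> 'w \<Rightarrow> ('a \<Rightarrow>\<^sub>L real)) (A2 :: 'b \<Rightarrow> 'w \<Rightarrow> ('b \<Rightarrow>\<^sub>L real))
     (B1 :: 'a \<Rightarrow> 'w \<Rightarrow> ('u \<Rightarrow>\<^sub>L 'h)) (B2 :: 'b \<Rightarrow> 'w \<Rightarrow> ('u \<Rightarrow>\<^sub>L 'h))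
     (Vm :: nat \<Rightarrow> 'v set) (Pr :: nat \<Rightarrow> ('v \<Rightarrow>\<^sub>L real) \<Rightarrow> 'v) (\<cc> :: nat \<Rightarrow> real)
     (n :: nat \<Rightarrow> nat) (m :: nat \<Rightarrow> nat) (k :: nat \<Rightarrow> nat)
     (u :: nat \<Rightarrow> real \<Rightarrow> 'w \<Rightarrow> 'v) (C0 :: real).
      prob_space M \<and> filtration_on M T F \<and> cylindrical_wiener M T F W \<and>
      intersection_setting e1 e2 j1 j2 i1 i2 \<and> orthonormal_basis chi \<and>
      op_measurability chi M (F 0) A1 B1 \<and> op_measurability chi M (F 0) A2 B2 \<and>
      op_coercivity K \<mu> chi M j1 j2 A1 A2 B1 B2 \<and>
      op_growth K p chi M j1 i1 i2 A1 A2 B1 B2 \<and>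
      galerkin_scheme Vm \<and> projection_assumption j1 i1 i2 Vm Pr \<cc> \<and>
      (\<forall>l. n l > 0) \<and>
      filterlim n at_top sequentially \<and> filterlim m at_top sequentially \<and>
      filterlim k at_top sequentially \<and>
      (\<forall>l. \<forall>\<omega>\<in>space M. u l 0 \<omega> \<in> Vm (m l)) \<and>
      (\<forall>l. u l 0 \<in> borel_measurable (F 0)) \<and>
      (\<forall>l. (\<integral>\<^sup>+\<omega>. ennreal (norm (j1 (i1 (u l 0 \<omega>))) powr (2 * q)) \<partial>M) < ennreal C0) \<and>
      (\<forall>l. is_scheme M T F W chi j1 i1 i2 A1 A2 B1 B2 (Pr (m l)) (n l) (k l) (u l))
      \<longrightarrow>
      (\<forall>l. \<cc> (m l) * (T / real (n l)) < \<epsilon> \<longrightarrow>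
        (\<forall>t\<in>{0..T}.
          (\<integral>\<^sup>+\<omega>. (SUP s\<in>{0..t}. ennreal (norm (j1 (i1 (u l s \<omega>))) powr (2 * q))) \<partial>M)
          + ennreal (\<mu> powr q) *
              (\<integral>\<^sup>+\<omega>. ennreal ((LINT s:{0..t}|lborel.
                  (norm (i1 (u l (kappa T (n l) s) \<omega>)))\<^sup>2) powr q) \<partial>M)
          \<le> ennreal c *
              (1 + (\<integral>\<^sup>+\<omega>. ennreal (norm (j1 (i1 (u l 0 \<omega>))) powr (2 * q)) \<partial>M))))"
proof -
  \<comment> \<open>An integer strictly above \<open>q\<close>: integer powers have a polynomial
    expansion, and the exponent \<open>q / N\<close> of the maximal inequality must be below
    1.\<close>
  define N where "N = Suc (nat \<lceil>q\<rceil>)"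
  define C where "C = 2 * K + \<mu> / 2 + 4 * T"
  define c0 where "c0 = exp ((2 * C * real N + 4 * K * real N + 32 * K * (real N)\<^sup>2 + 1) * T) / (1 - q / real N)"
  \<comment> \<open>The supremum contributes \<open>c0 * 2 powr q\<close>. The cost contributes this
    times \<open>2 powr q\<close>, since the majorant carries only \<mu> / 2. All constants depend
    on T, K, \<mu> and q alone, so they are fixed before the spaces and the discretization.\<close>
  define c where "c = (1 + 2 powr q) * (c0 * 2 powr q)"
  have q: "0 < q" "q < real N"
    using assms(5) real_nat_ceiling_ge[of q] unfolding N_def of_nat_Suc by linarith+
  have c0: "0 < c0" using q by (simp add: c0_def)
  have c: "0 < c" using c0 by (simp add: c_def add_pos_nonneg)
  have \<epsilon>: "0 < \<mu> / (8 * K)" using assms by simp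
  show ?thesis
  proof (rule exI[of _ "\<mu> / (8 * K)"], rule conjI[OF \<epsilon>], rule exI[of _ c], rule conjI[OF c],
      intro allI impI ballI, elim conjE)
    fix M :: "'w measure" and F :: "real \<Rightarrow> 'w measure" and W :: "real \<Rightarrow> 'u \<Rightarrow> 'w \<Rightarrow> real"
      and chi :: "nat \<Rightarrow> 'u" and j1 :: "'a \<Rightarrow>\<^sub>L 'h" and j2 :: "'b \<Rightarrow>\<^sub>L 'h"
      and i1 :: "'v \<Rightarrow>\<^sub>L 'a" and i2 :: "'v \<Rightarrow>\<^sub>L 'b"
      and A1 :: "'a \<Rightarrow> 'w \<Rightarrow> ('a \<Rightarrow>\<^sub>L real)" and A2 :: "'b \<Rightarrow> 'w \<Rightarrow> ('b \<Rightarrow>\<^sub>L real)"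
      and B1 :: "'a \<Rightarrow> 'w \<Rightarrow> ('u \<Rightarrow>\<^sub>L 'h)" and B2 :: "'b \<Rightarrow> 'w \<Rightarrow> ('u \<Rightarrow>\<^sub>L 'h)"
      and Vm :: "nat \<Rightarrow> 'v set" and Pr :: "nat \<Rightarrow> ('v \<Rightarrow>\<^sub>L real) \<Rightarrow> 'v" and \<cc> :: "nat \<Rightarrow> real"
      and n m k :: "nat \<Rightarrow> nat" and u :: "nat \<Rightarrow> real \<Rightarrow> 'w \<Rightarrow> 'v" and C0 :: real and l :: nat and t :: real
    assume M: "prob_space M" "filtration_on M T F" "cylindrical_wiener M T F W"
        "intersection_setting e1 e2 j1 j2 i1 i2" "orthonormal_basis chi"
        "op_measurability chi M (F 0) A1 B1" "op_measurability chi M (F 0) A2 B2"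
        "op_coercivity K \<mu> chi M j1 j2 A1 A2 B1 B2" "op_growth K p chi M j1 i1 i2 A1 A2 B1 B2"
        "galerkin_scheme Vm" "projection_assumption j1 i1 i2 Vm Pr \<cc>"
      and n: "\<forall>l. n l > 0" and u0: "\<forall>l. \<forall>\<omega>\<in>space M. u l 0 \<omega> \<in> Vm (m l)"
      and scheme: "\<forall>l. is_scheme M T F W chi j1 i1 i2 A1 A2 B1 B2 (Pr (m l)) (n l) (k l) (u l)"
      and cc: "\<cc> (m l) * (T / real (n l)) < \<mu> / (8 * K)" and t: "t \<in> {0..T}"
    define sq where "sq i \<omega> = (norm (i1 (u l (grid T (n l) i) \<omega>)))\<^sup>2" for i \<omega>
    define E0 where "E0 = (\<integral>\<^sup>+\<omega>. ennreal (norm (j1 (i1 (u l 0 \<omega>))) powr (2 * q)) \<partial>M)"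
    interpret galerkin_energy M T F W chi "n l" "k l" "j1 o\<^sub>L i1" "u l"
      "\<lambda>i j \<omega>. scheme_diffusion j1 i1 i2 B1 B2 (Pr (m l)) (u l (grid T (n l) i) \<omega>) \<omega> (chi j)" sq K "\<mu> / 2" C
      unfolding sq_def[abs_def] C_def
      by (rule scheme_galerkin_energy[OF assms(1,2,4) n[THEN spec, of l] M u0[THEN spec, of l]
            scheme[THEN spec, of l] less_imp_le[OF cc]])
    have c0_eq: "exp (rate N * T) / (1 - q / real N) = c0" by (simp add: c0_def rate_def)
    have init: "ennreal c0 * (\<integral>\<^sup>+\<omega>. ennreal (node_energy 0 \<omega> powr q) \<partial>M) \<le> ennreal (c0 * 2 powr q) * (1 + E0)"
    proof -
      have "ennreal c0 * (\<integral>\<^sup>+\<omega>. ennreal (node_energy 0 \<omega> powr q) \<partial>M) \<le> ennreal c0 * (ennreal (2 powr q) * (1 + E0))"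
        using initial_moment[OF q(1)] by (intro mult_left_mono) (auto simp: E0_def)
      also have "\<dots> = ennreal (c0 * 2 powr q) * (1 + E0)"
        using c0 by (simp add: ennreal_mult mult.assoc)
      finally show ?thesis .
    qed
    have "(\<integral>\<^sup>+\<omega>. (SUP s\<in>{0..t}. ennreal (norm (j1 (i1 (u l s \<omega>))) powr (2 * q))) \<partial>M)
        \<le> (\<integral>\<^sup>+\<omega>. (SUP s\<in>{0..T}. ennreal (norm ((j1 o\<^sub>L i1) (u l s \<omega>)) powr (2 * q))) \<partial>M)"
      using t by (intro nn_integral_mono SUP_subset_mono) auto
    also have "\<dots> \<le> ennreal (c0 * 2 powr q) * (1 + E0)"
      using sup_moment[OF q] init unfolding c0_eq by (rule order_trans)
    finally have sup_bound: "(\<integral>\<^sup>+\<omega>. (SUP s\<in>{0..t}. ennreal (norm (j1 (i1 (u l s \<omega>))) powr (2 * q))) \<partial>M)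
        \<le> ennreal (c0 * 2 powr q) * (1 + E0)" .
    have cost_bound: "ennreal (\<mu> powr q) * (\<integral>\<^sup>+\<omega>. ennreal ((LINT s:{0..t}|lborel.
          (norm (i1 (u l (kappa T (n l) s) \<omega>)))\<^sup>2) powr q) \<partial>M)
        \<le> ennreal (2 powr q) * (ennreal (c0 * 2 powr q) * (1 + E0))"
    proof -
      define S where "S \<omega> = \<mu> / 2 * (T / real (n l)) * (\<Sum>i<n l. sq i \<omega>)" for \<omega>
      have S0: "0 \<le> S \<omega>" for \<omega> unfolding S_def by (rule cost_nonneg)
      have S_meas: "S \<in> borel_measurable M"
      proof -
        have "sq i \<in> borel_measurable M" if "i < n l" for i
          using sq_adapted[OF that] grid_bounds[of i] that by (auto intro: measurable_from_subalg[OF F_sub])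
        then show ?thesis unfolding S_def[abs_def] by (intro borel_measurable_times borel_measurable_sum) auto
      qed
      let ?I = "\<lambda>\<omega>. LINT s:{0..t}|lborel. (norm (i1 (u l (kappa T (n l) s) \<omega>)))\<^sup>2"
      have "?I \<omega> powr q \<le> (2 / \<mu>) powr q * S \<omega> powr q" for \<omega>
      proof -
        have I: "?I \<omega> \<le> T / real (n l) * (\<Sum>i<n l. sq i \<omega>)" "0 \<le> ?I \<omega>"
          using step_set_integral_le_sum[of T "n l" t "\<lambda>r. (norm (i1 (u l r \<omega>)))\<^sup>2"] t n assms(1)
          by (auto simp: sq_def)
        have "T / real (n l) * (\<Sum>i<n l. sq i \<omega>) = 2 / \<mu> * S \<omega>" using assms(4) by (simp add: S_def)
        then have "?I \<omega> powr q \<le> (2 / \<mu> * S \<omega>) powr q" using I q by (intro powr_mono2) auto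
        also have "\<dots> = (2 / \<mu>) powr q * S \<omega> powr q"
          by (rule powr_mult)
        finally show ?thesis .
      qed
      then have "(\<integral>\<^sup>+\<omega>. ennreal (?I \<omega> powr q) \<partial>M) \<le> (\<integral>\<^sup>+\<omega>. ennreal ((2 / \<mu>) powr q) * ennreal (S \<omega> powr q) \<partial>M)"
        by (intro nn_integral_mono) (simp add: ennreal_leI flip: ennreal_mult')
      also have "\<dots> = ennreal ((2 / \<mu>) powr q) * (\<integral>\<^sup>+\<omega>. ennreal (S \<omega> powr q) \<partial>M)"
        using S_meas by (intro nn_integral_cmult) measurable
      also have "\<dots> \<le> ennreal ((2 / \<mu>) powr q) * (ennreal (c0 * 2 powr q) * (1 + E0))"
        using cost_moment[OF q] init unfolding c0_eq S_def by (intro mult_left_mono) (auto intro: order_trans)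
      finally have "ennreal (\<mu> powr q) * (\<integral>\<^sup>+\<omega>. ennreal (?I \<omega> powr q) \<partial>M)
          \<le> ennreal (\<mu> powr q) * (ennreal ((2 / \<mu>) powr q) * (ennreal (c0 * 2 powr q) * (1 + E0)))"
        by (rule mult_left_mono) simp
      also have "\<dots> = ennreal (\<mu> powr q * (2 / \<mu>) powr q) * (ennreal (c0 * 2 powr q) * (1 + E0))"
        by (simp add: ennreal_mult mult.assoc)
      also have "\<mu> powr q * (2 / \<mu>) powr q = 2 powr q"
        using assms(4) by (simp flip: powr_mult)
      finally show ?thesis .
    qed
    have "ennreal c = ennreal (c0 * 2 powr q) + ennreal (2 powr q) * ennreal (c0 * 2 powr q)"
      unfolding c_def distrib_right mult_1_left
      by (subst ennreal_plus) (use c0 in \<open>simp_all add: ennreal_mult\<close>)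
    then have "ennreal c * (1 + E0)
        = ennreal (c0 * 2 powr q) * (1 + E0) + ennreal (2 powr q) * (ennreal (c0 * 2 powr q) * (1 + E0))"
      by (simp only: distrib_right mult.assoc)
    then show "(\<integral>\<^sup>+\<omega>. (SUP s\<in>{0..t}. ennreal (norm (j1 (i1 (u l s \<omega>))) powr (2 * q))) \<partial>M)
          + ennreal (\<mu> powr q) *
              (\<integral>\<^sup>+\<omega>. ennreal ((LINT s:{0..t}|lborel.
                  (norm (i1 (u l (kappa T (n l) s) \<omega>)))\<^sup>2) powr q) \<partial>M)
          \<le> ennreal c *
              (1 + (\<integral>\<^sup>+\<omega>. ennreal (norm (j1 (i1 (u l 0 \<omega>))) powr (2 * q)) \<partial>M))"
      using add_mono[OF sup_bound cost_bound] by (simp only: E0_def)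
  qed
qed

end
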